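(* Let $\Lambda=\{\lambda_n,\mu_n\}_{n=1}^{\infty}$ belong to the class $ABCD$ and let $-\infty<\gamma<\beta<\infty$. Let $W(\Lambda,\gamma,\beta)$ be the set of functions on $(\gamma,\beta)$ that admit a representation $\sum_{n=1}^\infty\big(\sum_{k=0}^{\mu_n-1}c_{n,k}x^k\big)e^{\lambda_nx}$ converging pointwise at every point of $(\gamma,\beta)$. (i) Let $V(\Lambda,\gamma,\beta)$ be the set of functions $f\in C(\gamma,\beta,\{G_n\})$ satisfying $F(D)f(x)=0$ for all $x\in(\gamma,\beta)$. Then $V(\Lambda,\gamma,\beta)=W(\Lambda,\gamma,\beta)$. (ii) If $f\in W(\Lambda,\gamma,\beta)$ and $f\in L^p(\gamma,\beta)$ for some $p\ge1$, then $f$ belongs to the closed span of $E_\Lambda$ in $L^p(\gamma,\beta)$.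
   Context: A multiplicity sequence $\Lambda=\{\lambda_n,\mu_n\}_{n=1}^\infty$ consists of distinct nonzero complex numbers $\lambda_n$ with $|\lambda_n|\to\infty$, $|\lambda_n|\le|\lambda_{n+1}|$, and positive integers $\mu_n$. $A^0_{|z|}$ is the space of entire functions $F$ with: for every $\epsilon>0$ there is $M_\epsilon$ with $|F(z)|\le M_\epsilon e^{\epsilon|z|}$ on $\mathbb{C}$. $\Lambda$ is an interpolating variety for $A^0_{|z|}$ if for every doubly indexed complex sequence $(a_{n,k})_{n\in\mathbb{N},0\le k\le\mu_n-1}$ with $\sup_n\sum_{k}|a_{n,k}|e^{-\epsilon|\lambda_n|}<\infty$ for every $\epsilon>0$ there is $f\in A^0_{|z|}$ with $f^{(k)}(\lambda_n)/k!=a_{n,k}$ for all $n,k$. $\Lambda\in ABCD$ means: (A) $\sum_n\mu_n/|\lambda_n|<\infty$; (B) $\sup_n|\arg\lambda_n|<\pi/2$; (C) $\Lambda$ is an interpolating variety for $A^0_{|z|}$; (D) $n_\Lambda(t)\log t/t=O(1)$ as $t\to\infty$, where $n_\Lambda(t)=\sum_{|\lambda_n|\le t}\mu_n$. $F(z)=\prod_n(1-z/\lambda_n)^{\mu_n}$, $G(z)=\prod_n(1+z/|\lambda_n|)^{\mu_n}$, $G_n=G^{(n)}(0)/n!$. The class $C(\gamma,\beta,\{G_n\})$ consists of infinitely differentiable $f$ on $(\gamma,\beta)$ such that $\sum_{n\ge0}\frac{G^{(n)}(0)}{n!}|f^{(n)}(x)|$ converges uniformly on $(\gamma+\epsilon,\beta-\epsilon)$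 for every $\epsilon>0$; for such $f$, $F(D)f(x)=\sum_{n\ge0}\frac{F^{(n)}(0)}{n!}f^{(n)}(x)$. $E_\Lambda=\{x^ke^{\lambda_n x}:n\in\mathbb{N},\ 0\le k\le\mu_n-1\}$. *)

theory Defs
  imports "HOL-Complex_Analysis.Complex_Analysis" "HOL-Library.Landau_Symbols"
begin

text \<open>A multiplicity sequence, indexed by nat (starting at 0 instead of 1).\<close>
definition multiplicity_seq :: "(nat \<Rightarrow> complex) \<Rightarrow> (nat \<Rightarrow> nat) \<Rightarrow> bool" where
  "multiplicity_seq lam mu \<longleftrightarrow>
     inj lam \<and> (\<forall>n. lam n \<noteq> 0) \<and> filterlim (\<lambda>n. norm (lam n)) at_top sequentially \<and>
     (\<forall>n. norm (lam n) \<le> norm (lam (Suc n))) \<and> (\<forall>n. mu n \<ge> 1)"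

definition A0 :: "(complex \<Rightarrow> complex) set" where
  "A0 = {F. F holomorphic_on UNIV \<and>
            (\<forall>\<epsilon>>0. \<exists>M. \<forall>z. norm (F z) \<le> M * exp (\<epsilon> * norm z))}"

definition interpolating_variety_A0 :: "(nat \<Rightarrow> complex) \<Rightarrow> (nat \<Rightarrow> nat) \<Rightarrow> bool" where
  "interpolating_variety_A0 lam mu \<longleftrightarrow>
     (\<forall>a :: nat \<Rightarrow> nat \<Rightarrow> complex.
        (\<forall>\<epsilon>>0. bdd_above (range (\<lambda>n. (\<Sum>k<mu n. norm (a n k)) * exp (- \<epsilon> * norm (lam n)))))
        \<longrightarrow> (\<exists>f\<in>A0. \<forall>n. \<forall>k<mu n. (deriv ^^ k) f (lam n) / of_nat (fact k) = a n k))"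

definition counting_fun :: "(nat \<Rightarrow> complex) \<Rightarrow> (nat \<Rightarrow> nat) \<Rightarrow> real \<Rightarrow> nat" where
  "counting_fun lam mu t = (\<Sum>n\<in>{n. norm (lam n) \<le> t}. mu n)"

definition ABCD :: "(nat \<Rightarrow> complex) \<Rightarrow> (nat \<Rightarrow> nat) \<Rightarrow> bool" where
  "ABCD lam mu \<longleftrightarrow>
     multiplicity_seq lam mu \<and>
     summable (\<lambda>n. real (mu n) / norm (lam n)) \<and>
     (SUP n. \<bar>Arg (lam n)\<bar>) < pi / 2 \<and>
     interpolating_variety_A0 lam mu \<and>
     (\<lambda>t. real (counting_fun lam mu t) * ln t / t) \<in> O[at_top](\<lambda>_. 1)"

definition F_fun :: "(nat \<Rightarrow> complex) \<Rightarrow> (nat \<Rightarrow> nat) \<Rightarrow> complex \<Rightarrow> complex" where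
  "F_fun lam mu z = (\<Prod>n. (1 - z / lam n) ^ mu n)"

definition G_fun :: "(nat \<Rightarrow> complex) \<Rightarrow> (nat \<Rightarrow> nat) \<Rightarrow> complex \<Rightarrow> complex" where
  "G_fun lam mu z = (\<Prod>n. (1 + z / complex_of_real (norm (lam n))) ^ mu n)"

text \<open>Taylor coefficients F^{(n)}(0)/n! and G_n = G^{(n)}(0)/n! (the latter is real).\<close>
definition F_coef :: "(nat \<Rightarrow> complex) \<Rightarrow> (nat \<Rightarrow> nat) \<Rightarrow> nat \<Rightarrow> complex" where
  "F_coef lam mu n = (deriv ^^ n) (F_fun lam mu) 0 / of_nat (fact n)"

definition G_coef :: "(nat \<Rightarrow> complex) \<Rightarrow> (nat \<Rightarrow> nat) \<Rightarrow> nat \<Rightarrow> real" where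
  "G_coef lam mu n = Re ((deriv ^^ n) (G_fun lam mu) 0 / of_nat (fact n))"

definition vderivs :: "nat \<Rightarrow> (real \<Rightarrow> complex) \<Rightarrow> real \<Rightarrow> complex" where
  "vderivs k f = ((\<lambda>g x. vector_derivative g (at x)) ^^ k) f"

definition smooth_on_real :: "real set \<Rightarrow> (real \<Rightarrow> complex) \<Rightarrow> bool" where
  "smooth_on_real I f \<longleftrightarrow> (\<forall>k. \<forall>x\<in>I. vderivs k f differentiable (at x))"

definition class_C :: "real \<Rightarrow> real \<Rightarrow> (nat \<Rightarrow> real) \<Rightarrow> (real \<Rightarrow> complex) set" where
  "class_C \<gamma> \<beta> Gc = {f. smooth_on_real {\<gamma><..<\<beta>} f \<and>
      (\<forall>\<epsilon>>0. uniformly_convergent_on {\<gamma>+\<epsilon><..<\<beta>-\<epsilon>}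
                 (\<lambda>N x. \<Sum>n<N. Gc n * norm (vderivs n f x)))}"

text \<open>F(D) f (x) = sum_n F^{(n)}(0)/n! f^{(n)}(x); "F(D)f(x) = 0" means this series sums to 0.\<close>
definition V_set :: "(nat \<Rightarrow> complex) \<Rightarrow> (nat \<Rightarrow> nat) \<Rightarrow> real \<Rightarrow> real \<Rightarrow> (real \<Rightarrow> complex) set" where
  "V_set lam mu \<gamma> \<beta> = {f. f \<in> class_C \<gamma> \<beta> (G_coef lam mu) \<and>
      (\<forall>x\<in>{\<gamma><..<\<beta>}. (\<lambda>n. F_coef lam mu n * vderivs n f x) sums 0)}"

definition W_set :: "(nat \<Rightarrow> complex) \<Rightarrow> (nat \<Rightarrow> nat) \<Rightarrow> real \<Rightarrow> real \<Rightarrow> (real \<Rightarrow> complex) set" where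
  "W_set lam mu \<gamma> \<beta> = {f. \<exists>c :: nat \<Rightarrow> nat \<Rightarrow> complex. \<forall>x\<in>{\<gamma><..<\<beta>}.
      (\<lambda>n. (\<Sum>k<mu n. c n k * complex_of_real x ^ k) * exp (lam n * complex_of_real x)) sums f x}"

definition in_Lp :: "real \<Rightarrow> real \<Rightarrow> real \<Rightarrow> (real \<Rightarrow> complex) \<Rightarrow> bool" where
  "in_Lp p \<gamma> \<beta> f \<longleftrightarrow> set_borel_measurable lborel {\<gamma><..<\<beta>} f \<and>
      set_integrable lborel {\<gamma><..<\<beta>} (\<lambda>x. norm (f x) powr p)"

definition span_E :: "(nat \<Rightarrow> complex) \<Rightarrow> (nat \<Rightarrow> nat) \<Rightarrow> (real \<Rightarrow> complex) set" where
  "span_E lam mu = {g. \<exists>N (c :: nat \<Rightarrow> nat \<Rightarrow> complex). \<forall>x.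
      g x = (\<Sum>n<N. \<Sum>k<mu n. c n k * complex_of_real x ^ k * exp (lam n * complex_of_real x))}"

definition in_closed_span_Lp :: "(nat \<Rightarrow> complex) \<Rightarrow> (nat \<Rightarrow> nat) \<Rightarrow> real \<Rightarrow> real \<Rightarrow> real \<Rightarrow> (real \<Rightarrow> complex) \<Rightarrow> bool" where
  "in_closed_span_Lp lam mu p \<gamma> \<beta> f \<longleftrightarrow>
     (\<forall>\<epsilon>>0. \<exists>g\<in>span_E lam mu.
        (LINT x:{\<gamma><..<\<beta>}|lborel. norm (f x - g x) powr p) powr (1 / p) < \<epsilon>)"

end

theory Submission
  imports Defs
begin

text \<open>
  A pointwise convergent series is, by Baire's theorem and the Bernstein--Walsh inequality for the
  polynomial factors, normally convergent on a complex neighbourhood of the interval, so \<open>F(D)\<close> can be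
  applied termwise; translating it slightly to the left and truncating approximates it in \<open>L\<^sup>p\<close>.

  Conversely, to \<open>f\<close> with \<open>F(D) f = 0\<close> associate the entire function
  \<open>\<Phi>(u, x) = ((F(u) - F(D)) / (u - D)) f(x)\<close>, of exponential type zero in \<open>u\<close>. It satisfies
  \<open>\<partial>\<^sub>x \<Phi> = u \<Phi> - F(u) f\<close>, so the residues of \<open>\<Phi> / F\<close> are exponential monomials in \<open>x\<close>, and interpolation
  makes them decay like \<open>exp (- c |\<lambda>\<^sub>n|)\<close>. Subtracting their sum from \<open>f\<close> leaves a solution for which \<open>\<Phi> / F\<close> is
  entire in \<open>u\<close>; by the differential equation and Phragmen--Lindelof it is bounded, hence constant in \<open>u\<close>,
  which forces that solution to vanish.
\<close>

subsection \<open>Order of vanishing\<close>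

text \<open>The function \<open>f\<close> is only smooth on an open interval, without values off the
  real line or control at the end points, so every construction uses the jet of \<open>f\<close> at
  one interior point. The product behind \<open>G_coef\<close> makes this possible: its coefficients
  dominate those of \<open>F_fun\<close> and are submultiplicative, so the convergence demanded by
  \<open>class_C\<close> also controls the doubly indexed series for \<Phi>. Since exp (- u x)
  \<Phi>(u, x) is independent of x modulo F, a residue at x can be computed from \<Phi> at some y >
  x; the resulting factor exp (- (y - x) u) is the whole source of decay. The obstacle is division
  by F near clusters of its zeros, where 1 / F has no useful bound. Interpolation supplies a
  multiplier that is 1 at \<open>lam n\<close> and cancels the neighbouring zeros at subexponential
  cost. In the uniqueness part the quotient e(x) = \<Phi> / F satisfies e' = u e - h, where h is the
  difference of two solutions. As e does not depend on u, comparing two values of u gives e = 0, and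
  then h = 0.\<close>

definition vanishes :: "nat \<Rightarrow> (complex \<Rightarrow> complex) \<Rightarrow> complex \<Rightarrow> bool" where
  "vanishes m \<phi> b \<longleftrightarrow> (\<forall>k<m. (deriv ^^ k) \<phi> b = 0)"

text \<open>In the Leibniz sum only the term that differentiates the linear factor exactly once
  survives at \<open>b\<close>.\<close>

lemma higher_deriv_linear_factor:
  assumes "\<psi> holomorphic_on S" "open S" "b \<in> S"
  shows "(deriv ^^ Suc k) (\<lambda>w. (w - b) * \<psi> w) b = of_nat (Suc k) * (deriv ^^ k) \<psi> b"
proof -
  have D: "(deriv ^^ i) (\<lambda>w. w - b) b = (if i = 1 then 1 else 0)" for i
  proof -
    have "(deriv ^^ i) (\<lambda>w. w - b) b = (deriv ^^ i) (\<lambda>w. w) b - (deriv ^^ i) (\<lambda>w. b) b"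
      by (rule higher_deriv_diff[of _ UNIV]) (auto intro: holomorphic_intros)
    thus ?thesis by simp
  qed
  have "(deriv ^^ Suc k) (\<lambda>w. (w - b) * \<psi> w) b =
     (\<Sum>i = 0..Suc k. of_nat (Suc k choose i) * (deriv ^^ i) (\<lambda>w. w - b) b * (deriv ^^ (Suc k - i)) \<psi> b)"
    by (rule higher_deriv_mult[of _ S]) (use assms in \<open>auto intro!: holomorphic_intros\<close>)
  also have "\<dots> = (\<Sum>i = 0..Suc k. if i = 1 then of_nat (Suc k) * (deriv ^^ k) \<psi> b else 0)"
    by (rule sum.cong) (auto simp: D simp del: funpow.simps)
  finally show ?thesis by (simp del: funpow.simps)
qed

text \<open>One linear factor is split off at a time: the difference quotient is holomorphic by
  removability, and its derivatives at \<open>b\<close> are those of \<open>\<phi>\<close> one order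
  higher, up to a nonzero integer, so the order of vanishing drops by one.\<close>

lemma vanishes_imp_factor:
  assumes "\<phi> holomorphic_on S" "open S" "b \<in> S" "vanishes m \<phi> b"
  shows "\<exists>\<psi>. \<psi> holomorphic_on S \<and> (\<forall>z\<in>S. \<phi> z = (z - b) ^ m * \<psi> z)"
  using assms
proof (induction m arbitrary: \<phi>)
  case 0
  thus ?case by auto
next
  case (Suc m)
  have b0: "\<phi> b = 0"
    using Suc.prems(4) unfolding vanishes_def by (metis funpow_0 zero_less_Suc)
  define \<psi> where "\<psi> = (\<lambda>z. if z = b then deriv \<phi> b else (\<phi> z - \<phi> b) / (z - b))"
  have hol: "\<psi> holomorphic_on S"
    unfolding \<psi>_def by (rule pole_lemma_open) (use Suc.prems in auto)
  have eq: "\<phi> = (\<lambda>z. (z - b) * \<psi> z)"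
    by (auto simp: \<psi>_def b0)
  have "vanishes m \<psi> b"
    unfolding vanishes_def
  proof (intro allI impI)
    fix k assume "k < m"
    hence "(deriv ^^ Suc k) \<phi> b = 0"
      using Suc.prems(4) unfolding vanishes_def by (metis Suc_mono)
    moreover have "(deriv ^^ Suc k) \<phi> b = of_nat (Suc k) * (deriv ^^ k) \<psi> b"
      by (subst eq, rule higher_deriv_linear_factor) (use hol Suc.prems in auto)
    ultimately show "(deriv ^^ k) \<psi> b = 0"
      by (metis mult_eq_0_iff of_nat_eq_0_iff nat.distinct(1))
  qed
  from Suc.IH[OF hol Suc.prems(2,3) this] obtain \<theta> where
    \<theta>: "\<theta> holomorphic_on S" "\<forall>z\<in>S. \<psi> z = (z - b) ^ m * \<theta> z" by blast
  show ?case
    by (rule exI[of _ \<theta>]) (use \<theta> eq in \<open>auto simp: fun_eq_iff\<close>)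
qed

text \<open>Cauchy's inequality on circles of radius r about \<open>b\<close> bounds the k-th
  derivative by a multiple of r ^ (m - k), which tends to 0 with r because k < m.\<close>

lemma vanishesI_bound:
  assumes hol: "\<phi> holomorphic_on S" and S: "open S" "b \<in> S"
    and bd: "\<forall>\<^sub>F z in nhds b. norm (\<phi> z) \<le> C * norm (z - b) ^ m"
  shows "vanishes m \<phi> b"
  unfolding vanishes_def
proof (intro allI impI)
  fix k assume km: "k < m"
  obtain d where d: "d > 0" "\<And>z. dist z b < d \<Longrightarrow> norm (\<phi> z) \<le> C * norm (z - b) ^ m"
    using bd unfolding eventually_nhds_metric by blast
  obtain e where e: "e > 0" "cball b e \<subseteq> S"
    using S open_contains_cball by blast
  have "norm ((deriv ^^ k) \<phi> b) \<le> fact k * \<bar>C\<bar> * r" if r: "0 < r" "r < d" "r < e" "r < 1" for r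
  proof -
    have "norm ((deriv ^^ k) \<phi> b) \<le> (fact k) * (\<bar>C\<bar> * r ^ m) / r ^ k"
    proof (rule Cauchy_inequality)
      show "\<phi> holomorphic_on ball b r"
        using e r by (intro holomorphic_on_subset[OF hol]) (force simp: subset_iff)
      show "continuous_on (cball b r) \<phi>"
        using e r by (intro holomorphic_on_imp_continuous_on holomorphic_on_subset[OF hol])
                     (force simp: subset_iff)
      show "norm (\<phi> x) \<le> \<bar>C\<bar> * r ^ m" if "norm (b - x) = r" for x
      proof -
        have "norm (\<phi> x) \<le> C * norm (x - b) ^ m"
          using d(2)[of x] r that by (simp add: dist_norm norm_minus_commute)
        also have "\<dots> = C * r ^ m" using that by (simp add: norm_minus_commute)
        also have "\<dots> \<le> \<bar>C\<bar> * r ^ m" using r by (intro mult_right_mono) auto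
        finally show ?thesis .
      qed
    qed (use r in auto)
    also have "\<dots> = fact k * \<bar>C\<bar> * r ^ (m - k)"
      using km r by (simp add: power_diff)
    also have "\<dots> \<le> fact k * \<bar>C\<bar> * r ^ 1"
      using km r by (intro mult_left_mono power_decreasing) auto
    finally show ?thesis by simp
  qed
  hence "\<forall>\<^sub>F r in at_right 0. norm ((deriv ^^ k) \<phi> b) \<le> fact k * \<bar>C\<bar> * r"
    using d(1) e(1) by (intro eventually_at_rightI[of 0 "min 1 (min d e)"]) auto
  moreover have "((\<lambda>r. fact k * \<bar>C\<bar> * r) \<longlongrightarrow> fact k * \<bar>C\<bar> * 0) (at_right 0)"
    by (intro tendsto_intros)
  ultimately have "norm ((deriv ^^ k) \<phi> b) \<le> fact k * \<bar>C\<bar> * 0"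
    by (intro tendsto_lowerbound[of "\<lambda>r. fact k * \<bar>C\<bar> * r"]) auto
  thus "(deriv ^^ k) \<phi> b = 0" by simp
qed

text \<open>The bridge from analysis to divisibility: the mean value inequality yields estimates of
  the form |\<phi>| \<le> C |F| near a zero of F, and factoring the dominating function transfers
  its multiplicity.\<close>

lemma vanishes_dominated:
  assumes "\<phi> holomorphic_on S" "\<psi> holomorphic_on S" and S: "open S" "b \<in> S"
    and "vanishes m \<psi> b"
    and bd: "\<forall>\<^sub>F z in nhds b. norm (\<phi> z) \<le> C * norm (\<psi> z)"
  shows "vanishes m \<phi> b"
proof -
  obtain \<theta> where \<theta>: "\<theta> holomorphic_on S" "\<forall>z\<in>S. \<psi> z = (z - b) ^ m * \<theta> z"
    using vanishes_imp_factor[of \<psi> S b m] assms by blast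
  have "isCont \<theta> b"
    using \<theta> S by (metis continuous_on_eq_continuous_at holomorphic_on_imp_continuous_on)
  hence "((\<lambda>z. norm (\<theta> z)) \<longlongrightarrow> norm (\<theta> b)) (nhds b)"
    by (intro tendsto_norm) (simp add: tendsto_nhds_iff isCont_def)
  hence "\<forall>\<^sub>F z in nhds b. norm (\<theta> z) < norm (\<theta> b) + 1"
    by (rule order_tendstoD) auto
  moreover have "\<forall>\<^sub>F z in nhds b. z \<in> S"
    using S by (rule eventually_nhds_in_open)
  ultimately have "\<forall>\<^sub>F z in nhds b. norm (\<phi> z) \<le> (\<bar>C\<bar> * (norm (\<theta> b) + 1)) * norm (z - b) ^ m"
    using bd
  proof eventually_elim
    case (elim z)
    have "norm (\<phi> z) \<le> \<bar>C\<bar> * (norm (z - b) ^ m * norm (\<theta> z))"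
      using elim \<theta>(2) mult_right_mono[OF abs_ge_self[of C], of "norm (\<psi> z)"]
      by (simp add: norm_mult norm_power)
    also have "\<dots> \<le> \<bar>C\<bar> * (norm (z - b) ^ m * (norm (\<theta> b) + 1))"
      using elim by (intro mult_left_mono) auto
    finally show ?case by (simp add: mult_ac)
  qed
  thus ?thesis using assms by (intro vanishesI_bound[of \<phi> S]) auto
qed

lemma vanishes_mult:
  assumes "\<phi> holomorphic_on S" "\<theta> holomorphic_on S" "open S" "b \<in> S" "vanishes m \<phi> b"
  shows "vanishes m (\<lambda>z. \<phi> z * \<theta> z) b"
  unfolding vanishes_def
proof (intro allI impI)
  fix k assume "k < m"
  thus "(deriv ^^ k) (\<lambda>z. \<phi> z * \<theta> z) b = 0"
    using assms by (subst higher_deriv_mult[of _ S]) (auto simp: vanishes_def)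
qed

lemma vanishes_diff:
  assumes "\<phi> holomorphic_on S" "\<theta> holomorphic_on S" "open S" "b \<in> S" "vanishes m \<phi> b" "vanishes m \<theta> b"
  shows "vanishes m (\<lambda>z. \<phi> z - \<theta> z) b"
  using assms unfolding vanishes_def by (auto simp: higher_deriv_diff[of _ S])

lemma vanishes_add:
  assumes "\<phi> holomorphic_on S" "\<theta> holomorphic_on S" "open S" "b \<in> S" "vanishes m \<phi> b" "vanishes m \<theta> b"
  shows "vanishes m (\<lambda>z. \<phi> z + \<theta> z) b"
  using assms unfolding vanishes_def by (auto simp: higher_deriv_add[of _ S])

lemma vanishes_cong:
  assumes "\<forall>\<^sub>F z in nhds b. \<phi> z = \<theta> z"
  shows "vanishes m \<phi> b \<longleftrightarrow> vanishes m \<theta> b"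
  unfolding vanishes_def using higher_deriv_cong_ev[OF assms refl] by simp

lemma vanishes_power_mult:
  assumes "\<psi> holomorphic_on S" "open S" "b \<in> S"
  shows "vanishes m (\<lambda>z. (z - b) ^ m * \<psi> z) b"
proof (rule vanishes_mult)
  show "vanishes m (\<lambda>z. (z - b) ^ m) b"
    by (rule vanishesI_bound[of _ UNIV _ 1]) (auto intro!: holomorphic_intros simp: norm_power)
qed (use assms in \<open>auto intro!: holomorphic_intros\<close>)

lemma vanishes_deriv_eq:
  assumes "\<phi> holomorphic_on S" "\<theta> holomorphic_on S" "open S" "b \<in> S"
    and "vanishes m (\<lambda>z. \<phi> z - \<theta> z) b" "k < m"
  shows "(deriv ^^ k) \<phi> b = (deriv ^^ k) \<theta> b"
  using assms higher_deriv_diff[of \<phi> S \<theta> b k] unfolding vanishes_def by force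

subsection \<open>Canonical products of genus zero\<close>

text \<open>Factors outside \<open>T\<close> become 1 instead of being reindexed. The bounds below
  then hold with constants independent of \<open>T\<close>, as is needed when some zeros are divided
  out and the others estimated.\<close>

definition zprod :: "(nat \<Rightarrow> complex) \<Rightarrow> (nat \<Rightarrow> nat) \<Rightarrow> nat set \<Rightarrow> complex \<Rightarrow> complex" where
  "zprod lam mu T z = (\<Prod>n. if n \<in> T then (1 - z / lam n) ^ mu n else 1)"

lemma F_fun_eq_zprod: "F_fun lam mu = zprod lam mu UNIV"
  by (simp add: F_fun_def zprod_def fun_eq_iff)

lemma G_fun_eq_F_fun: "G_fun lam mu = F_fun (\<lambda>n. - complex_of_real (norm (lam n))) mu"
  by (simp add: F_fun_def G_fun_def fun_eq_iff)

lemma norm_power_minus_one_le: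
  fixes w :: complex
  shows "norm ((1 - w) ^ m - 1) \<le> real m * norm w * exp (real m * norm w)"
proof -
  have *: "norm (\<Sum>i<m. (1 - w) ^ i) \<le> (\<Sum>i<m. exp (real m * norm w))"
  proof (rule sum_norm_le)
    fix i assume "i \<in> {..<m}"
    have "norm ((1 - w) ^ i) \<le> (1 + norm w) ^ i"
      by (simp add: norm_power) (intro power_mono norm_triangle_ineq4[of 1 w, simplified], auto)
    also have "\<dots> \<le> (1 + norm w) ^ m" using \<open>i \<in> {..<m}\<close> by (intro power_increasing) auto
    also have "\<dots> \<le> exp (norm w) ^ m" by (intro power_mono) auto
    also have "\<dots> = exp (real m * norm w)" by (simp add: exp_of_nat_mult)
    finally show "norm ((1 - w) ^ i) \<le> exp (real m * norm w)" .
  qed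
  have "norm ((1 - w) ^ m - 1) = norm w * norm (\<Sum>i<m. (1 - w) ^ i)"
    by (subst power_diff_1_eq) (simp add: norm_mult)
  also have "\<dots> \<le> norm w * (\<Sum>i<m. exp (real m * norm w))"
    using * by (rule mult_left_mono) simp
  finally show ?thesis by (simp add: mult_ac)
qed

text \<open>General enough to be interpreted a second time at the points
  \<open>- norm (lam n)\<close>, which may repeat; this yields the theory of
  \<open>G_fun\<close>.\<close>

locale zero_seq =
  fixes lam :: "nat \<Rightarrow> complex" and mu :: "nat \<Rightarrow> nat"
  assumes nz: "\<And>n. lam n \<noteq> 0"
    and mu_pos: "\<And>n. mu n > 0"
    and summ: "summable (\<lambda>n. real (mu n) / norm (lam n))"
begin

abbreviation dens :: "nat \<Rightarrow> real" where "dens n \<equiv> real (mu n) / norm (lam n)"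
abbreviation fac :: "nat set \<Rightarrow> nat \<Rightarrow> complex \<Rightarrow> complex" where
  "fac T n z \<equiv> (if n \<in> T then (1 - z / lam n) ^ mu n else 1)"

lemma fac_minus_one:
  assumes "norm z \<le> R"
  shows "norm (fac T n z - 1) \<le> dens n * (R * exp (suminf dens * R))"
proof -
  have R: "R \<ge> 0" using assms norm_ge_zero[of z] by linarith
  have d: "dens n \<le> suminf dens"
    using sum_le_suminf[OF summ, of "{n}"] by auto
  have w: "real (mu n) * norm (z / lam n) \<le> dens n * R"
    using assms by (simp add: norm_divide divide_right_mono mult_left_mono)
  have "norm (fac T n z - 1) \<le> real (mu n) * norm (z / lam n) * exp (real (mu n) * norm (z / lam n))"
    using norm_power_minus_one_le[of "z / lam n" "mu n"] by auto
  also have "\<dots> \<le> (dens n * R) * exp (suminf dens * R)"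
  proof (rule mult_mono[OF w])
    have "dens n * R \<le> suminf dens * R" by (rule mult_right_mono[OF d R])
    thus "exp (real (mu n) * norm (z / lam n)) \<le> exp (suminf dens * R)" using w by simp
  qed (use R in auto)
  finally show ?thesis by (simp add: mult_ac)
qed

lemma convergent_fac: "convergent_prod (\<lambda>n. fac T n z)"
proof -
  have "summable (\<lambda>n. norm (fac T n z - 1))"
  proof (rule summable_comparison_test)
    show "summable (\<lambda>n. dens n * (norm z * exp (suminf dens * norm z)))"
      by (rule summable_mult2[OF summ])
  qed (use fac_minus_one[of z "norm z"] in auto)
  thus ?thesis
    by (intro abs_convergent_prod_imp_convergent_prod) (simp add: abs_convergent_prod_conv_summable)
qed

lemma zprod_LIMSEQ: "(\<lambda>N. \<Prod>n<N. fac T n z) \<longlonglongrightarrow> zprod lam mu T z"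
  unfolding zprod_def using convergent_prod_LIMSEQ[OF convergent_fac, of T z]
  by (rule LIMSEQ_lessThan_iff_atMost[THEN iffD2])

lemma zprod_uniform_limit:
  "uniform_limit (cball 0 R) (\<lambda>N z. \<Prod>n<N. fac T n z) (zprod lam mu T) sequentially"
proof -
  have "uniformly_convergent_on (cball 0 R) (\<lambda>N z. \<Prod>n<N. 1 + (fac T n z - 1))"
  proof (rule uniformly_convergent_on_prod)
    show "continuous_on (cball 0 R) (\<lambda>z. fac T n z - 1)" for n
      by (cases "n \<in> T") (use nz in \<open>auto intro!: continuous_intros\<close>)
    show "uniformly_convergent_on (cball 0 R) (\<lambda>N x. \<Sum>n<N. norm (fac T n x - 1))"
      by (rule Weierstrass_m_test'[where M = "\<lambda>n. dens n * (R * exp (suminf dens * R))"])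
         (use fac_minus_one[of _ R] summable_mult2[OF summ] in auto)
  qed auto
  hence "uniform_limit (cball 0 R) (\<lambda>N z. \<Prod>n<N. fac T n z) (\<lambda>z. lim (\<lambda>N. \<Prod>n<N. fac T n z)) sequentially"
    by (simp add: uniformly_convergent_uniform_limit_iff cong: if_cong)
  moreover have "lim (\<lambda>N. \<Prod>n<N. fac T n z) = zprod lam mu T z" for z
    by (rule limI[OF zprod_LIMSEQ])
  ultimately show ?thesis by (simp only:)
qed

lemma holomorphic_partial: "(\<lambda>z. \<Prod>n<N. fac T n z) holomorphic_on S"
proof (rule holomorphic_on_prod)
  show "fac T n holomorphic_on S" for n
    by (cases "n \<in> T") (use nz in \<open>auto intro!: holomorphic_intros\<close>)
qed

lemma zprod_holomorphic: "zprod lam mu T holomorphic_on S"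
proof -
  have "zprod lam mu T holomorphic_on UNIV"
  proof (rule holomorphic_uniform_sequence)
    show "(\<lambda>z. \<Prod>n<N. fac T n z) holomorphic_on UNIV" for N by (rule holomorphic_partial)
    show "\<exists>d>0. cball x d \<subseteq> UNIV \<and>
        uniform_limit (cball x d) (\<lambda>N z. \<Prod>n<N. fac T n z) (zprod lam mu T) sequentially" for x
    proof (intro exI[of _ 1] conjI)
      show "uniform_limit (cball x 1) (\<lambda>N z. \<Prod>n<N. fac T n z) (zprod lam mu T) sequentially"
        by (rule uniform_limit_on_subset[OF zprod_uniform_limit[where R = "norm x + 1"]])
           (auto simp: cball_subset_cball_iff)
    qed auto
  qed auto
  thus ?thesis by (rule holomorphic_on_subset) auto
qed

lemma zprod_0 [simp]: "zprod lam mu T 0 = 1"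
  by (simp add: zprod_def cong: if_cong)

lemma zprod_eq_0_iff:
  "zprod lam mu T z = 0 \<longleftrightarrow> (\<exists>n\<in>T. z = lam n)"
proof -
  have "zprod lam mu T z = 0 \<longleftrightarrow> 0 \<in> range (\<lambda>n. fac T n z)"
    using has_prod_eq_0_iff[OF convergent_prod_has_prod[OF convergent_fac[of T z]]]
    by (simp add: zprod_def)
  also have "\<dots> \<longleftrightarrow> (\<exists>n\<in>T. z = lam n)"
    using nz mu_pos by (auto simp: image_iff split: if_splits)
  finally show ?thesis .
qed

lemma zprod_finite: "finite T \<Longrightarrow> zprod lam mu T z = (\<Prod>n\<in>T. (1 - z / lam n) ^ mu n)"
  unfolding zprod_def
  using has_prod_unique[OF has_prod_If_finite_set[of T "\<lambda>n. (1 - z / lam n) ^ mu n"]] by simp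

lemma zprod_split:
  assumes "A \<inter> B = {}"
  shows "zprod lam mu (A \<union> B) z = zprod lam mu A z * zprod lam mu B z"
  unfolding zprod_def
  by (subst prodinf_mult[OF convergent_fac convergent_fac], rule prodinf_cong) (use assms in auto)

lemma zprod_remove:
  "n \<in> T \<Longrightarrow> zprod lam mu T z = (1 - z / lam n) ^ mu n * zprod lam mu (T - {n}) z"
  using zprod_split[of "{n}" "T - {n}" z] by (simp add: zprod_finite insert_absorb)

text \<open>Finitely many indices are charged by their multiplicity, the others by the small tail of
  \<open>\<Sum> mu n / |lam n|\<close>; all estimates of size \<open>exp (o(|z|))\<close> come from this.\<close>

definition weight_bound :: "real \<Rightarrow> real \<Rightarrow> nat \<Rightarrow> bool" where
  "weight_bound C \<epsilon> N \<longleftrightarrow> (\<forall>s \<eta> L e N'. s \<ge> 0 \<longrightarrow> \<eta> \<ge> 0 \<longrightarrow> L \<ge> 0 \<longrightarrow>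
       (\<forall>n. e n \<le> L * real (mu n) + \<eta> * s * dens n) \<longrightarrow> (\<forall>n. e n \<le> C * s * dens n) \<longrightarrow>
       (\<Sum>n<N'. e n) \<le> L * (\<Sum>n<N. real (mu n)) + (\<eta> * suminf dens + \<epsilon>) * s)"

lemma ex_weight_bound:
  assumes "\<epsilon> > 0" "C \<ge> 0"
  shows "\<exists>N. weight_bound C \<epsilon> N"
proof -
  have "(\<lambda>N. C * (\<Sum>n. dens (n + N))) \<longlonglongrightarrow> C * 0"
    by (intro tendsto_intros suminf_exist_split2[OF summ])
  hence "\<forall>\<^sub>F N in sequentially. C * (\<Sum>n. dens (n + N)) < \<epsilon>"
    using assms by (intro order_tendstoD) auto
  then obtain N where N: "C * (\<Sum>n. dens (n + N)) < \<epsilon>"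
    by (auto simp: eventually_sequentially)
  show ?thesis unfolding weight_bound_def
  proof (intro exI[of _ N] allI impI)
    fix s \<eta> L :: real and e :: "nat \<Rightarrow> real" and N'
    assume s: "s \<ge> 0" "\<eta> \<ge> 0" "L \<ge> 0" and e1: "\<forall>n. e n \<le> L * real (mu n) + \<eta> * s * dens n"
      and e2: "\<forall>n. e n \<le> C * s * dens n"
    define d where "d = (\<lambda>n. L * real (mu n) + \<eta> * s * dens n)"
    have dn: "d n \<ge> 0" for n using s by (simp add: d_def)
    have "(\<Sum>n<N'. e n) \<le> (\<Sum>n<N'. if n < N then d n else C * s * dens n)"
      by (rule sum_mono) (use e1 e2 in \<open>auto simp: d_def\<close>)
    also have "\<dots> \<le> (\<Sum>n<N+N'. if n < N then d n else C * s * dens n)"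
      by (rule sum_mono2) (use s assms dn in \<open>auto intro!: mult_nonneg_nonneg\<close>)
    also have "\<dots> = (\<Sum>n<N. d n) + (\<Sum>n<N'. C * s * dens (n + N))"
    proof -
      have "(\<Sum>n<N+N'. if n < N then d n else C * s * dens n) =
          (\<Sum>n<N. if n < N then d n else C * s * dens n) + (\<Sum>n=N..<N+N'. if n < N then d n else C * s * dens n)"
        by (subst sum.atLeastLessThan_concat[symmetric, of 0 N "N+N'" , unfolded atLeast0LessThan]) auto
      also have "(\<Sum>n=N..<N+N'. if n < N then d n else C * s * dens n) = (\<Sum>n=0+N..<N'+N. C * s * dens n)"
        by (rule sum.cong) (auto simp: add.commute)
      also have "\<dots> = (\<Sum>n<N'. C * s * dens (n + N))"
        by (subst sum.shift_bounds_nat_ivl) (simp add: atLeast0LessThan)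
      finally show ?thesis by simp
    qed
    also have "(\<Sum>n<N'. C * s * dens (n + N)) = C * s * (\<Sum>n<N'. dens (n + N))"
      by (simp only: sum_distrib_left)
    also have "\<dots> \<le> C * s * (\<Sum>n. dens (n + N))"
      using s assms summable_ignore_initial_segment[OF summ, of N]
      by (intro mult_left_mono sum_le_suminf) auto
    also have "\<dots> = (C * (\<Sum>n. dens (n + N))) * s" by simp
    also have "\<dots> \<le> \<epsilon> * s" using N s by (intro mult_right_mono) auto
    also have "(\<Sum>n<N. d n) = L * (\<Sum>n<N. real (mu n)) + \<eta> * s * (\<Sum>n<N. dens n)"
      by (simp only: d_def sum.distrib sum_distrib_left)
    also have "\<eta> * s * (\<Sum>n<N. dens n) \<le> \<eta> * s * suminf dens"
      using s by (intro mult_left_mono sum_le_suminf[OF summ]) auto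
    finally show "(\<Sum>n<N'. e n) \<le> L * (\<Sum>n<N. real (mu n)) + (\<eta> * suminf dens + \<epsilon>) * s"
      by (simp add: algebra_simps)
  qed
qed

text \<open>With t = |z| / |lam n|, a factor contributes \<open>mu n\<close> times ln (1 + t), which
  is at most t and also at most L + \<eta> t; \<open>weight_bound\<close> combines the two. The
  second bound rests on \<eta> (1 + t) \<le> exp (\<eta> t), whence L = ln (1 / \<eta>).\<close>

lemma zprod_upper:
  assumes "\<epsilon> > 0"
  obtains K where "K > 0" "\<And>T z. norm (zprod lam mu T z) \<le> K * exp (\<epsilon> * norm z)"
proof -
  obtain N where N: "weight_bound 1 (\<epsilon> / 2) N"
    using assms ex_weight_bound[of "\<epsilon> / 2" 1] by auto
  have S: "suminf dens \<ge> 0" by (rule suminf_nonneg[OF summ]) auto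
  define \<eta> where "\<eta> = min 1 (\<epsilon> / (2 * (suminf dens + 1)))"
  have \<eta>: "\<eta> > 0" "\<eta> \<le> 1" using assms S by (auto simp: \<eta>_def)
  have "\<eta> * suminf dens \<le> \<epsilon> / (2 * (suminf dens + 1)) * suminf dens"
    using S by (intro mult_right_mono) (auto simp: \<eta>_def)
  also have "\<dots> \<le> \<epsilon> / 2" using S assms by (simp add: field_simps)
  finally have \<eta>S: "\<eta> * suminf dens + \<epsilon> / 2 \<le> \<epsilon>" by simp
  define L where "L = ln (1 / \<eta>)"
  have L: "L \<ge> 0" using \<eta> by (simp add: L_def)
  define K where "K = exp (L * (\<Sum>n<N. real (mu n)))"
  show thesis
  proof (rule that[of K])
    fix T z
    have "norm (\<Prod>n<N'. fac T n z) \<le> K * exp (\<epsilon> * norm z)" for N'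
    proof -
      define e where "e = (\<lambda>n. real (mu n) * ln (1 + norm z / norm (lam n)))"
      have "norm (\<Prod>n<N'. fac T n z) = (\<Prod>n<N'. norm (fac T n z))" by (simp add: prod_norm)
      also have "\<dots> \<le> (\<Prod>n<N'. exp (e n))"
      proof (rule prod_mono, intro conjI)
        fix n
        have "norm (1 - z / lam n) \<le> 1 + norm z / norm (lam n)"
          using norm_triangle_ineq4[of 1 "z / lam n"] by (simp add: norm_divide)
        hence "norm (1 - z / lam n) ^ mu n \<le> (1 + norm z / norm (lam n)) ^ mu n"
          by (intro power_mono) auto
        also have "\<dots> = exp (e n)"
          unfolding e_def by (subst exp_of_nat_mult) (simp add: exp_ln add_pos_nonneg)
        finally have *: "norm (1 - z / lam n) ^ mu n \<le> exp (e n)" .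
        have "e n \<ge> 0" by (auto simp: e_def)
        thus "norm (fac T n z) \<le> exp (e n)"
          using * by (auto simp: norm_power)
      qed auto
      also have "\<dots> = exp (\<Sum>n<N'. e n)" by (simp add: exp_sum)
      also have "(\<Sum>n<N'. e n) \<le> L * (\<Sum>n<N. real (mu n)) + (\<eta> * suminf dens + \<epsilon> / 2) * norm z"
      proof (rule N[unfolded weight_bound_def, rule_format])
        fix n
        define t where "t = norm z / norm (lam n)"
        have t: "t \<ge> 0" by (simp add: t_def)
        have st: "norm z * dens n = real (mu n) * t" by (simp add: t_def)
        have "ln (1 + t) \<le> t" using t by (rule ln_add_one_self_le_self)
        hence "real (mu n) * ln (1 + t) \<le> real (mu n) * t" by (intro mult_left_mono) auto
        thus "e n \<le> 1 * norm z * dens n" using st by (simp add: e_def t_def mult_ac)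
        have "ln (1 + t) \<le> L + \<eta> * t"
        proof -
          have "\<eta> * (1 + t) \<le> 1 + \<eta> * t" using \<eta> by (simp add: algebra_simps)
          also have "\<dots> \<le> exp (\<eta> * t)" by simp
          finally have "1 + t \<le> 1 / \<eta> * exp (\<eta> * t)" using \<eta> by (simp add: field_simps)
          hence "ln (1 + t) \<le> ln (1 / \<eta> * exp (\<eta> * t))" using t \<eta> by (subst ln_le_cancel_iff) auto
          also have "\<dots> = L + \<eta> * t" using \<eta> by (subst ln_mult) (auto simp: L_def)
          finally show ?thesis .
        qed
        hence "real (mu n) * ln (1 + t) \<le> real (mu n) * (L + \<eta> * t)" by (intro mult_left_mono) auto
        also have "\<dots> = L * real (mu n) + \<eta> * (norm z * dens n)" unfolding st by (simp add: algebra_simps)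
        finally show "e n \<le> L * real (mu n) + \<eta> * norm z * dens n" by (simp add: e_def t_def mult_ac)
      qed (use \<eta> L in auto)
      also have "\<dots> \<le> L * (\<Sum>n<N. real (mu n)) + \<epsilon> * norm z"
        using \<eta>S by (intro add_left_mono mult_right_mono) auto
      finally show ?thesis by (simp add: K_def exp_add)
    qed
    thus "norm (zprod lam mu T z) \<le> K * exp (\<epsilon> * norm z)"
      by (intro Lim_bounded[OF tendsto_norm[OF zprod_LIMSEQ]]) auto
  qed (simp add: K_def)
qed

text \<open>A factor costs at most \<open>min L (C * t)\<close> per multiplicity, where t = |z| /
  |lam n|: for t \<ge> 1/4 it is bounded below by hypothesis, otherwise by 1 - t. The constant bound
  pays for finitely many indices, the linear one for the tail.\<close>

lemma zprod_lower:
  assumes "\<epsilon> > 0" "c > 0"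
  obtains K where "K > 0"
    "\<And>T z. (\<And>n. n \<in> T \<Longrightarrow> norm (lam n) \<le> 4 * norm z \<Longrightarrow> norm (1 - z / lam n) \<ge> c) \<Longrightarrow>
        K * exp (- \<epsilon> * norm z) \<le> norm (zprod lam mu T z)"
proof -
  \<comment> \<open>The cap 1/2 makes \<open>c'\<close> a lower bound also for the far factors 1 - t
    with t \<le> 1/4.\<close>
  define c' where "c' = min c (1/2)"
  have c': "0 < c'" "c' \<le> 1/2" using assms by (auto simp: c'_def)
  define L where "L = ln (1 / c')"
  have L: "L > 0" using c' by (simp add: L_def)
  have cL: "c' = exp (- L)" using c' by (simp add: L_def ln_div)
  \<comment> \<open>The value 2 serves exp (- 2 t) \<le> 1 - t for t \<le> 1/4; the value
    \<open>4 * L\<close> makes \<open>C * t\<close> at least \<open>L\<close> once t \<ge> 1/4, so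
    that the minimum is then \<open>L\<close>.\<close>
  define C where "C = max 2 (4 * L)"
  have C: "C \<ge> 2" "C \<ge> 4 * L" by (auto simp: C_def)
  obtain N where N: "weight_bound C \<epsilon> N"
    using assms C ex_weight_bound[of "\<epsilon>" C] by auto
  define K where "K = exp (- (L * (\<Sum>n<N. real (mu n))))"
  show thesis
  proof (rule that[of K])
    fix T z assume H: "\<And>n. n \<in> T \<Longrightarrow> norm (lam n) \<le> 4 * norm z \<Longrightarrow> norm (1 - z / lam n) \<ge> c"
    have "norm (\<Prod>n<N'. fac T n z) \<ge> K * exp (- \<epsilon> * norm z)" for N'
    proof -
      define e where "e = (\<lambda>n. real (mu n) * min L (C * (norm z / norm (lam n))))"
      have "(\<Sum>n<N'. e n) \<le> L * (\<Sum>n<N. real (mu n)) + (0 * suminf dens + \<epsilon>) * norm z"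
      proof (rule N[unfolded weight_bound_def, rule_format])
        fix n
        have "e n \<le> real (mu n) * (C * (norm z / norm (lam n)))"
          unfolding e_def by (intro mult_left_mono) auto
        thus "e n \<le> C * norm z * dens n" by (simp add: mult_ac)
        have "e n \<le> real (mu n) * L"
          unfolding e_def by (intro mult_left_mono) auto
        thus "e n \<le> L * real (mu n) + 0 * norm z * dens n" by (simp add: mult_ac)
      qed (use L in auto)
      hence "K * exp (- \<epsilon> * norm z) \<le> exp (- (\<Sum>n<N'. e n))"
        by (simp add: K_def exp_add[symmetric])
      also have "\<dots> = (\<Prod>n<N'. exp (- e n))" by (simp add: exp_sum sum_negf[symmetric])
      also have "\<dots> \<le> (\<Prod>n<N'. norm (fac T n z))"
      proof (rule prod_mono, intro conjI)
        fix n
        define t where "t = norm z / norm (lam n)"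
        have t: "t \<ge> 0" by (simp add: t_def)
        have "exp (- min L (C * t)) \<le> norm (1 - z / lam n)" if nT: "n \<in> T"
        proof (cases "norm (lam n) \<le> 4 * norm z")
          case True
          hence "t \<ge> 1/4" using nz[of n] by (simp add: t_def field_simps)
          hence "C * t \<ge> 4 * L * (1/4)" using C L t by (intro mult_mono) auto
          hence "exp (- min L (C * t)) = c'" using cL by (simp add: min_def)
          also have "\<dots> \<le> c" by (simp add: c'_def)
          finally show ?thesis using H[OF nT True] by linarith
        next
          case False
          hence t4: "t \<le> 1/4" using nz[of n] by (simp add: t_def field_simps)
          have "norm (1 - z / lam n) \<ge> 1 - t"
            using norm_triangle_ineq2[of 1 "z / lam n"] by (simp add: norm_divide t_def)
          moreover have "c' \<le> 1 - t" using c' t4 by simp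
          moreover have "exp (- (C * t)) \<le> 1 - t"
          proof -
            have "exp (- (C * t)) \<le> exp (- (2 * t))" using C t by (simp add: mult_right_mono)
            also have "\<dots> \<le> 1 / (1 + 2 * t)"
              using t exp_ge_add_one_self[of "2 * t"] by (simp add: exp_minus field_simps)
            also have "\<dots> \<le> 1 - t" using t t4 by (auto simp: field_simps intro: mult_left_le)
            finally show ?thesis .
          qed
          ultimately show ?thesis using cL by (simp add: min_def)
        qed
        hence "exp (- min L (C * t)) ^ mu n \<le> norm (1 - z / lam n) ^ mu n" if "n \<in> T"
          using that by (intro power_mono) auto
        moreover have "exp (- min L (C * t)) ^ mu n = exp (- e n)"
          by (simp add: e_def t_def exp_of_nat_mult[symmetric])
        moreover have "e n \<ge> 0" using L C t unfolding e_def t_def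
          by (intro mult_nonneg_nonneg) auto
        ultimately show "exp (- e n) \<le> norm (fac T n z)"
          by (auto simp: norm_power)
      qed auto
      also have "\<dots> = norm (\<Prod>n<N'. fac T n z)" by (simp add: prod_norm)
      finally show ?thesis .
    qed
    thus "K * exp (- \<epsilon> * norm z) \<le> norm (zprod lam mu T z)"
      by (intro Lim_bounded2[OF tendsto_norm[OF zprod_LIMSEQ]]) auto
  qed (simp add: K_def)
qed

lemma zprod_vanishes:
  assumes "n \<in> T"
  shows "vanishes (mu n) (zprod lam mu T) (lam n)"
proof -
  have "zprod lam mu T = (\<lambda>z. (z - lam n) ^ mu n * ((- 1 / lam n) ^ mu n * zprod lam mu (T - {n}) z))"
  proof
    fix z
    have "1 - z / lam n = (z - lam n) * (- 1 / lam n)" using nz[of n] by (simp add: field_simps)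
    thus "zprod lam mu T z = (z - lam n) ^ mu n * ((- 1 / lam n) ^ mu n * zprod lam mu (T - {n}) z)"
      using zprod_remove[OF assms, of z] by (metis mult.assoc power_mult_distrib)
  qed
  moreover have "vanishes (mu n) (\<lambda>z. (z - lam n) ^ mu n * ((- 1 / lam n) ^ mu n * zprod lam mu (T - {n}) z)) (lam n)"
    by (rule vanishes_power_mult[of _ UNIV]) (auto intro!: holomorphic_on_mult zprod_holomorphic)
  ultimately show ?thesis by (simp only:)
qed

end

subsection \<open>Taylor coefficients and division by products\<close>

definition tc :: "(complex \<Rightarrow> complex) \<Rightarrow> nat \<Rightarrow> complex" where
  "tc \<phi> j = (deriv ^^ j) \<phi> 0 / fact j"

lemma F_coef_eq_tc: "F_coef lam mu j = tc (F_fun lam mu) j"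
  by (simp add: F_coef_def tc_def)

lemma G_coef_eq_tc: "G_coef lam mu j = Re (tc (G_fun lam mu) j)"
  by (simp add: G_coef_def tc_def)

lemma tc_mult_linear:
  assumes "\<phi> holomorphic_on UNIV"
  shows "tc (\<lambda>z. (1 + a * z) * \<phi> z) 0 = tc \<phi> 0"
    and "tc (\<lambda>z. (1 + a * z) * \<phi> z) (Suc j) = tc \<phi> (Suc j) + a * tc \<phi> j"
proof -
  show "tc (\<lambda>z. (1 + a * z) * \<phi> z) 0 = tc \<phi> 0" by (simp add: tc_def)
  have "(deriv ^^ Suc j) (\<lambda>z. (1 + a * z) * \<phi> z) 0 =
        (deriv ^^ Suc j) (\<lambda>z. \<phi> z + a * ((z - 0) * \<phi> z)) 0"
    by (rule arg_cong2[where f = "deriv ^^ Suc j"]) (auto simp: fun_eq_iff algebra_simps)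
  also have "\<dots> = (deriv ^^ Suc j) \<phi> 0 + (deriv ^^ Suc j) (\<lambda>z. a * ((z - 0) * \<phi> z)) 0"
    by (rule higher_deriv_add[of _ UNIV]) (use assms in \<open>auto intro!: holomorphic_intros\<close>)
  also have "(deriv ^^ Suc j) (\<lambda>z. a * ((z - 0) * \<phi> z)) 0 = a * (deriv ^^ Suc j) (\<lambda>z. (z - 0) * \<phi> z) 0"
    by (rule higher_deriv_cmult[of _ UNIV]) (use assms in \<open>auto intro!: holomorphic_intros\<close>)
  also have "(deriv ^^ Suc j) (\<lambda>z. (z - 0) * \<phi> z) 0 = of_nat (Suc j) * (deriv ^^ j) \<phi> 0"
    by (rule higher_deriv_linear_factor[of _ UNIV]) (use assms in auto)
  finally show "tc (\<lambda>z. (1 + a * z) * \<phi> z) (Suc j) = tc \<phi> (Suc j) + a * tc \<phi> j"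
    by (simp add: tc_def divide_simps del: funpow.simps of_nat_Suc)
qed

text \<open>An invariant for adjoining one zero at a time to both products. Submultiplicativity is
  the inequality e_(i+j) \<le> e_i e_j for elementary symmetric functions of non-negative numbers;
  it later separates the two indices in the coefficient of order j + m.\<close>

definition coef_dom :: "(complex \<Rightarrow> complex) \<Rightarrow> (complex \<Rightarrow> complex) \<Rightarrow> bool" where
  "coef_dom \<phi> g \<longleftrightarrow> \<phi> holomorphic_on UNIV \<and> g holomorphic_on UNIV \<and> tc g 0 = 1 \<and>
     (\<forall>j. Im (tc g j) = 0 \<and> 0 \<le> Re (tc g j) \<and> norm (tc \<phi> j) \<le> Re (tc g j)) \<and>
     (\<forall>i j. Re (tc g (i + j)) \<le> Re (tc g i) * Re (tc g j))"

lemma coef_dom_step: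
  assumes "coef_dom \<phi> g" "l \<noteq> 0"
  shows "coef_dom (\<lambda>z. (1 - z / l) * \<phi> z) (\<lambda>z. (1 + z / of_real (norm l)) * g z)"
proof -
  define a where "a = 1 / norm l"
  have a: "a \<ge> 0" by (simp add: a_def)
  have eq: "(\<lambda>z. (1 - z / l) * \<phi> z) = (\<lambda>z. (1 + (- 1 / l) * z) * \<phi> z)"
      "(\<lambda>z. (1 + z / of_real (norm l)) * g z) = (\<lambda>z. (1 + of_real a * z) * g z)"
    by (simp_all add: a_def fun_eq_iff)
  have hol: "\<phi> holomorphic_on UNIV" "g holomorphic_on UNIV"
    using assms by (auto simp: coef_dom_def)
  define p where "p = (\<lambda>j. Re (tc g j))"
  have p: "p 0 = 1" "\<And>j. p j \<ge> 0" "\<And>i j. p (i + j) \<le> p i * p j"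
      "\<And>j. norm (tc \<phi> j) \<le> p j" "\<And>j. Im (tc g j) = 0" "tc g 0 = 1"
    using assms by (auto simp: coef_dom_def p_def)
  define p' where "p' = (\<lambda>j. Re (tc (\<lambda>z. (1 + of_real a * z) * g z) j))"
  have p'0: "p' 0 = 1" using tc_mult_linear(1)[OF hol(2)] p by (simp add: p'_def)
  have p'S: "p' (Suc j) = p (Suc j) + a * p j" for j
    using tc_mult_linear(2)[OF hol(2), of "of_real a" j] by (simp add: p'_def p_def)
  have p'_ge: "p j \<le> p' j" for j
    by (cases j) (use p'0 p'S p a in auto)
  have p'_nonneg: "0 \<le> p' j" for j using p(2)[of j] p'_ge[of j] by linarith
  \<comment> \<open>Only the first index is expanded by the recurrence; the factor
    \<open>p j\<close> is enlarged to \<open>p' j\<close> at the end.\<close>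
  have sub: "p' (i + j) \<le> p' i * p' j" for i j
  proof (cases i)
    case 0
    thus ?thesis using p'0 by simp
  next
    case (Suc k)
    have "p' (i + j) = p (Suc k + j) + a * p (k + j)" using p'S Suc by simp
    also have "\<dots> \<le> p (Suc k) * p j + a * (p k * p j)"
      using p(3)[of "Suc k" j] p(3)[of k j] a by (intro add_mono mult_left_mono) auto
    also have "\<dots> = p' i * p j" by (simp add: Suc p'S algebra_simps)
    also have "\<dots> \<le> p' i * p' j" using p'_ge p'_nonneg by (intro mult_left_mono) auto
    finally show ?thesis .
  qed
  have bd: "norm (tc (\<lambda>z. (1 + (- 1 / l) * z) * \<phi> z) j) \<le> p' j" for j
  proof (cases j)
    case 0
    thus ?thesis using tc_mult_linear(1)[OF hol(1)] p(1,4) p'0 by (metis)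
  next
    case (Suc k)
    have "norm (tc \<phi> (Suc k) + (- 1 / l) * tc \<phi> k) \<le> norm (tc \<phi> (Suc k)) + norm ((- 1 / l) * tc \<phi> k)"
      by (rule norm_triangle_ineq)
    also have "\<dots> = norm (tc \<phi> (Suc k)) + a * norm (tc \<phi> k)"
      by (simp add: norm_mult norm_divide a_def)
    also have "\<dots> \<le> p (Suc k) + a * p k" using p a by (intro add_mono mult_left_mono) auto
    finally show ?thesis using tc_mult_linear(2)[OF hol(1), of "- 1 / l" k] Suc p'S by simp
  qed
  have im: "Im (tc (\<lambda>z. (1 + of_real a * z) * g z) j) = 0" for j
    by (cases j) (use tc_mult_linear[OF hol(2), of "of_real a"] p in auto)
  have "tc (\<lambda>z. (1 + of_real a * z) * g z) 0 = 1"
    using tc_mult_linear(1)[OF hol(2)] p by simp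
  thus ?thesis
    unfolding eq coef_dom_def using im sub bd p'_nonneg hol
    by (auto simp: p'_def intro!: holomorphic_intros)
qed

lemma coef_dom_power:
  assumes "coef_dom \<phi> g" "l \<noteq> 0"
  shows "coef_dom (\<lambda>z. (1 - z / l) ^ m * \<phi> z) (\<lambda>z. (1 + z / of_real (norm l)) ^ m * g z)"
proof (induction m)
  case (Suc m)
  from coef_dom_step[OF Suc.IH assms(2)] show ?case by (simp add: mult_ac)
qed (use assms in simp)

lemma zero_seq_norm:
  assumes "zero_seq lam mu"
  shows "zero_seq (\<lambda>n. - complex_of_real (norm (lam n))) mu"
  using assms by (simp add: zero_seq_def)

lemma coef_dom_one: "coef_dom (\<lambda>z. 1) (\<lambda>z. 1)"
  by (auto simp: coef_dom_def tc_def)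

context zero_seq
begin

text \<open>All conditions of \<open>coef_dom\<close> are closed under limits of Taylor
  coefficients, so they pass from the finite products to the infinite ones.\<close>

lemma coef_dom_F_G: "coef_dom (F_fun lam mu) (G_fun lam mu)"
proof -
  interpret G: zero_seq "\<lambda>n. - complex_of_real (norm (lam n))" mu
    by (rule zero_seq_norm) unfold_locales
  define P where "P = (\<lambda>N z. \<Prod>n<N. (1 - z / lam n) ^ mu n)"
  define Q where "Q = (\<lambda>N z. \<Prod>n<N. (1 + z / complex_of_real (norm (lam n))) ^ mu n)"
  have dom: "coef_dom (P N) (Q N)" for N
  proof (induction N)
    case 0
    thus ?case by (simp add: P_def Q_def coef_dom_one)
  next
    case (Suc N)
    from coef_dom_power[OF Suc.IH nz[of N], of "mu N"] show ?case
      by (simp add: P_def Q_def mult_ac)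
  qed
  have limP: "(\<lambda>N. tc (P N) j) \<longlonglongrightarrow> tc (F_fun lam mu) j" for j
  proof -
    have "uniform_limit (ball 0 1) P (F_fun lam mu) sequentially"
      unfolding P_def F_fun_eq_zprod
      using uniform_limit_on_subset[OF zprod_uniform_limit[where T = UNIV and R = 1] ball_subset_cball] by simp
    from higher_deriv_complex_uniform_limit[OF this, of 0 j] show ?thesis
      unfolding tc_def using dom by (intro tendsto_divide tendsto_const)
        (auto simp: coef_dom_def intro: holomorphic_on_subset always_eventually)
  qed
  have limQ: "(\<lambda>N. tc (Q N) j) \<longlonglongrightarrow> tc (G_fun lam mu) j" for j
  proof -
    have "uniform_limit (ball 0 1) Q (G_fun lam mu) sequentially"
      unfolding Q_def G_fun_eq_F_fun F_fun_eq_zprod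
      using uniform_limit_on_subset[OF G.zprod_uniform_limit[where T = UNIV and R = 1] ball_subset_cball] by simp
    from higher_deriv_complex_uniform_limit[OF this, of 0 j] show ?thesis
      unfolding tc_def using dom by (intro tendsto_divide tendsto_const)
        (auto simp: coef_dom_def intro: holomorphic_on_subset always_eventually)
  qed
  note limR = tendsto_Re[OF limQ]
  show ?thesis unfolding coef_dom_def
  proof (intro conjI allI)
    show "F_fun lam mu holomorphic_on UNIV" unfolding F_fun_eq_zprod by (rule zprod_holomorphic)
    show "G_fun lam mu holomorphic_on UNIV"
      unfolding G_fun_eq_F_fun F_fun_eq_zprod by (rule G.zprod_holomorphic)
    show "tc (G_fun lam mu) 0 = 1"
      unfolding G_fun_eq_F_fun F_fun_eq_zprod by (simp add: tc_def)
    fix i j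
    show "Im (tc (G_fun lam mu) j) = 0"
      using tendsto_Im[OF limQ, of j] dom by (intro LIMSEQ_unique[OF tendsto_Im[OF limQ]]) (simp add: coef_dom_def)
    show "0 \<le> Re (tc (G_fun lam mu) j)"
      by (rule LIMSEQ_le_const[OF limR]) (use dom in \<open>auto simp: coef_dom_def\<close>)
    show "norm (tc (F_fun lam mu) j) \<le> Re (tc (G_fun lam mu) j)"
      by (rule LIMSEQ_le[OF tendsto_norm[OF limP] limR]) (use dom in \<open>auto simp: coef_dom_def\<close>)
    show "Re (tc (G_fun lam mu) (i + j)) \<le> Re (tc (G_fun lam mu) i) * Re (tc (G_fun lam mu) j)"
      by (rule LIMSEQ_le[OF limR tendsto_mult[OF limR limR]]) (use dom in \<open>auto simp: coef_dom_def\<close>)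
  qed
qed

abbreviation G :: "nat \<Rightarrow> real" where "G \<equiv> G_coef lam mu"
abbreviation Fc :: "nat \<Rightarrow> complex" where "Fc \<equiv> F_coef lam mu"
abbreviation FF :: "complex \<Rightarrow> complex" where "FF \<equiv> F_fun lam mu"

lemma G_nonneg: "G j \<ge> 0" and F_coef_le: "norm (Fc j) \<le> G j"
  and G_submult: "G (i + j) \<le> G i * G j" and G_0: "G 0 = 1"
  using coef_dom_F_G by (auto simp: coef_dom_def F_coef_eq_tc G_coef_eq_tc)

lemma FF_holomorphic: "FF holomorphic_on S"
  unfolding F_fun_eq_zprod by (rule zprod_holomorphic)

lemma FF_eq_0_iff: "FF z = 0 \<longleftrightarrow> z \<in> range lam"
  unfolding F_fun_eq_zprod zprod_eq_0_iff by auto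

text \<open>Exponential type zero read off from the coefficients. Cauchy's inequality is used at the
  radius R = j / e that minimises exp (e R) / R ^ j; there exp (e R) = exp j, which explains e =
  \<epsilon> / exp 1, and j! \<le> j ^ j does the rest.\<close>

lemma G_growth:
  assumes "\<epsilon> > 0"
  obtains K where "K > 0" "\<And>j. G j * fact j \<le> K * \<epsilon> ^ j"
proof -
  interpret G: zero_seq "\<lambda>n. - complex_of_real (norm (lam n))" mu
    by (rule zero_seq_norm) unfold_locales
  have G: "G_fun lam mu = zprod (\<lambda>n. - complex_of_real (norm (lam n))) mu UNIV"
    by (simp add: G_fun_eq_F_fun F_fun_eq_zprod)
  define e where "e = \<epsilon> / exp 1"
  have e: "e > 0" using assms by (simp add: e_def)
  obtain K where K: "K > 0" "\<And>z. norm (G_fun lam mu z) \<le> K * exp (e * norm z)"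
    using G.zprod_upper[OF e] G by metis
  show thesis
  proof (rule that[of K])
    fix j
    show "G j * fact j \<le> K * \<epsilon> ^ j"
    proof (cases "j = 0")
      case True
      have "1 \<le> K" using K(2)[of 0] by (simp add: G)
      thus ?thesis using True by (simp add: G_0)
    next
      case False
      define R where "R = real j / e"
      have R: "R > 0" using False e by (simp add: R_def)
      have "norm ((deriv ^^ j) (G_fun lam mu) 0) \<le> fact j * (K * exp (e * R)) / R ^ j"
        by (rule Cauchy_inequality) (use R K in \<open>auto simp: G intro!: G.zprod_holomorphic holomorphic_on_imp_continuous_on\<close>)
      also have "\<dots> = K * \<epsilon> ^ j * (fact j / real j ^ j)"
        using e False by (simp add: R_def e_def power_divide exp_of_nat_mult[symmetric] divide_simps)
      also have "\<dots> \<le> K * \<epsilon> ^ j * 1"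
        using False assms K(1) fact_le_power[of j, where 'a = real]
        by (intro mult_left_mono) (auto simp: divide_simps)
      finally have *: "norm ((deriv ^^ j) (G_fun lam mu) 0) \<le> K * \<epsilon> ^ j" by simp
      have "G j * fact j = Re ((deriv ^^ j) (G_fun lam mu) 0)"
        unfolding G_coef_def by (subst Re_divide_of_nat) simp
      also have "\<dots> \<le> norm ((deriv ^^ j) (G_fun lam mu) 0)" by (rule complex_Re_le_cmod)
      finally show ?thesis using * by linarith
    qed
  qed (use K in auto)
qed

text \<open>Finiteness for every r > 0, however small, lets F(D) act by Cauchy estimates on
  functions that are holomorphic only near the real interval.\<close>

lemma G_fact_summable:
  assumes "r > 0"
  shows "summable (\<lambda>j. G j * fact j / r ^ j)"
proof -
  obtain K where K: "K > 0" "\<And>j. G j * fact j \<le> K * (r/2) ^ j"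
    using G_growth[of "r/2"] assms by auto
  show ?thesis
  proof (rule summable_comparison_test')
    show "summable (\<lambda>j. K * (1/2) ^ j :: real)" by (intro summable_mult summable_geometric) auto
    fix j :: nat
    have "G j * fact j / r ^ j \<le> K * (r/2) ^ j / r ^ j"
      using K(2)[of j] assms by (intro divide_right_mono) auto
    also have "\<dots> = K * (1/2) ^ j" using assms by (simp add: power_divide)
    finally show "norm (G j * fact j / r ^ j) \<le> K * (1/2) ^ j" using G_nonneg assms by simp
  qed
qed

lemma G_bound:
  assumes "\<epsilon> > 0"
  obtains K where "K > 0" "\<And>R. R \<ge> 0 \<Longrightarrow> summable (\<lambda>j. G j * R ^ j)"
    "\<And>R. R \<ge> 0 \<Longrightarrow> (\<Sum>j. G j * R ^ j) \<le> K * exp (\<epsilon> * R)"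
proof -
  obtain K where K: "K > 0" "\<And>j. G j * fact j \<le> K * \<epsilon> ^ j"
    using G_growth[OF assms] by auto
  have s: "(\<lambda>j. K * ((\<epsilon> * R) ^ j / fact j)) sums (K * exp (\<epsilon> * R))" for R :: real
    using sums_mult[OF exp_converges[of "\<epsilon> * R"], of K] by (simp add: scaleR_conv_of_real divide_inverse mult_ac)
  have le: "G j * R ^ j \<le> K * ((\<epsilon> * R) ^ j / fact j)" if "R \<ge> 0" for j R
  proof -
    have "G j \<le> K * \<epsilon> ^ j / fact j" using K(2)[of j] by (simp add: field_simps)
    from mult_right_mono[OF this, of "R ^ j"] that show ?thesis by (simp add: power_mult_distrib)
  qed
  have summ: "summable (\<lambda>j. G j * R ^ j)" if "R \<ge> 0" for R
    by (rule summable_comparison_test'[OF sums_summable[OF s[of R]]]) (use le that G_nonneg in auto)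
  show thesis
  proof (rule that[OF K(1) summ])
    show "(\<Sum>j. G j * R ^ j) \<le> K * exp (\<epsilon> * R)" if "R \<ge> 0" for R
      using suminf_le[OF le[OF that] summ[OF that] sums_summable[OF s[of R]]] sums_unique[OF s[of R]] by simp
  qed
qed

section \<open>Division by products over locally finite sets of zeros\<close>

lemma finite_lam_ball: "finite {n. norm (lam n) \<le> R}"
proof -
  have "(\<lambda>n. dens n) \<longlonglongrightarrow> 0" by (rule summable_LIMSEQ_zero[OF summ])
  moreover have "1 / max R 1 > 0" by simp
  ultimately have "\<forall>\<^sub>F n in sequentially. dens n < 1 / max R 1" by (rule order_tendstoD)
  then obtain N where N: "\<And>n. n \<ge> N \<Longrightarrow> dens n < 1 / max R 1" by (auto simp: eventually_sequentially)
  have "{n. norm (lam n) \<le> R} \<subseteq> {..<N}"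
  proof (rule subsetI, rule ccontr)
    fix n assume n: "n \<in> {n. norm (lam n) \<le> R}" "n \<notin> {..<N}"
    have "1 / max R 1 \<le> 1 / norm (lam n)" using n nz[of n] by (intro divide_left_mono) auto
    also have "\<dots> \<le> dens n" using mu_pos[of n] by (intro divide_right_mono) auto
    finally show False using N[of n] n by auto
  qed
  thus ?thesis by (rule finite_subset) auto
qed

text \<open>Dividing by the factor of one zero does not disturb multiplicities elsewhere, because
  that factor is invertible near every other zero; injectivity makes the zeros distinct.\<close>

lemma divide_finite:
  assumes "finite S" "inj_on lam S" "\<phi> holomorphic_on UNIV" "\<And>n. n \<in> S \<Longrightarrow> vanishes (mu n) \<phi> (lam n)"
  shows "\<exists>\<psi>. \<psi> holomorphic_on UNIV \<and> (\<forall>z. \<phi> z = zprod lam mu S z * \<psi> z)"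
  using assms
proof (induction S arbitrary: \<phi> rule: finite_induct)
  case empty
  thus ?case by (auto simp: zprod_finite)
next
  case (insert n S)
  obtain \<psi>0 where \<psi>0: "\<psi>0 holomorphic_on UNIV" "\<And>z. \<phi> z = (z - lam n) ^ mu n * \<psi>0 z"
    using vanishes_imp_factor[of \<phi> UNIV "lam n" "mu n"] insert.prems by auto
  define \<psi>1 where "\<psi>1 = (\<lambda>z. (- lam n) ^ mu n * \<psi>0 z)"
  have hol: "\<psi>1 holomorphic_on UNIV" unfolding \<psi>1_def using \<psi>0 by (intro holomorphic_intros)
  have eq: "\<phi> z = (1 - z / lam n) ^ mu n * \<psi>1 z" for z
  proof -
    have "z - lam n = (1 - z / lam n) * (- lam n)" using nz[of n] by (simp add: field_simps)
    thus ?thesis using \<psi>0(2)[of z] by (simp add: \<psi>1_def power_mult_distrib[symmetric])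
  qed
  have "vanishes (mu m) \<psi>1 (lam m)" if m: "m \<in> S" for m
  proof -
    have ne: "lam m \<noteq> lam n" using insert m by (auto simp: inj_on_def)
    have ne1: "1 - z / lam n \<noteq> 0" if "z \<noteq> lam n" for z using that nz[of n] by (simp add: field_simps)
    have "vanishes (mu m) (\<lambda>z. \<phi> z * (1 / (1 - z / lam n) ^ mu n)) (lam m)"
      by (rule vanishes_mult[of _ "- {lam n}"])
         (use insert.prems m ne ne1 nz[of n] in \<open>auto intro!: holomorphic_intros intro: holomorphic_on_subset\<close>)
    moreover have "\<forall>\<^sub>F z in nhds (lam m). \<phi> z * (1 / (1 - z / lam n) ^ mu n) = \<psi>1 z"
    proof (rule eventually_mono[OF eventually_nhds_in_open[of "- {lam n}"]])
      show "\<phi> z * (1 / (1 - z / lam n) ^ mu n) = \<psi>1 z" if "z \<in> - {lam n}" for z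
        using ne1[of z] that by (subst eq) auto
    qed (use ne in auto)
    ultimately show ?thesis by (simp add: vanishes_cong)
  qed
  from insert.IH[OF _ hol this] insert.prems obtain \<psi> where
    \<psi>: "\<psi> holomorphic_on UNIV" "\<And>z. \<psi>1 z = zprod lam mu S z * \<psi> z" by auto
  have "\<phi> z = zprod lam mu (insert n S) z * \<psi> z" for z
    using eq[of z] \<psi>(2)[of z] insert.hyps by (simp add: zprod_finite mult_ac)
  thus ?case using \<psi> by blast
qed

text \<open>Zeros in the inner disc are divided out by the maximum principle on the outer circle, where each
  factor is bounded below; no minimum modulus theorem is needed.\<close>

definition quotient_bound :: "real \<Rightarrow> real \<Rightarrow> real \<Rightarrow> bool" where
  "quotient_bound L \<epsilon> K \<longleftrightarrow> (\<forall>w r T \<Psi> M. r > 0 \<longrightarrow> norm w \<le> L * r \<longrightarrow> \<Psi> holomorphic_on UNIV \<longrightarrow>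
    (\<forall>n\<in>T. lam n \<in> ball w (2 * r) \<longrightarrow> vanishes (mu n) \<Psi> (lam n)) \<longrightarrow>
    (\<forall>z\<in>sphere w (3 * r). norm (\<Psi> z) \<le> M) \<longrightarrow>
    (\<exists>q. q holomorphic_on ball w (2 * r) \<and> (\<forall>z\<in>ball w (2 * r). \<Psi> z = zprod lam mu T z * q z) \<and>
         (\<forall>z\<in>cball w r. norm (q z) \<le> K * exp (\<epsilon> * r) * M)))"

text \<open>Three radii keep a distance r: zeros of \<open>T\<close> within 2 r of \<open>w\<close>
  stay r away from the circle of radius 3 r, the others stay r away from the disc of radius r. So
  \<open>zprod_lower\<close> applies to both partial products, on the circle for the division and on
  the small disc for the remaining factor.\<close>

lemma ex_quotient_bound:
  assumes "inj lam" "\<epsilon> > 0" "L \<ge> 1"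
  shows "\<exists>K>0. quotient_bound L \<epsilon> K"
proof -
  \<comment> \<open>Within 3 r of \<open>w\<close> one has |z| \<le> (L + 3) r, so each use of the
    lower bound costs exp (\<epsilon> r / 2). It is used twice, for \<open>S\<close> and for
    \<open>T - S\<close>.\<close>
  define \<delta> where "\<delta> = \<epsilon> / (2 * (L + 3))"
  \<comment> \<open>The value of |z - lam n| / |lam n| in the worst case: distance r and |lam n| = 4
    (L + 2) r.\<close>
  define c where "c = 1 / (4 * (L + 2))"
  have pos: "\<delta> > 0" "c > 0" using assms by (auto simp: \<delta>_def c_def)
  obtain k where k: "k > 0"
    "\<And>T z. (\<And>n. n \<in> T \<Longrightarrow> norm (lam n) \<le> 4 * norm z \<Longrightarrow> norm (1 - z / lam n) \<ge> c) \<Longrightarrow>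
        k * exp (- \<delta> * norm z) \<le> norm (zprod lam mu T z)"
    using zprod_lower[OF pos] by metis
  define K where "K = 1 / k / k"
  have fac: "norm (1 - z / lam n) \<ge> c"
    if "norm (z - lam n) \<ge> r" "norm (lam n) \<le> 4 * (L + 2) * r" "r > 0" for z n r
  proof -
    have "c = r / (4 * (L + 2) * r)" using that by (simp add: c_def)
    also have "\<dots> \<le> norm (z - lam n) / norm (lam n)"
      using that nz[of n] by (intro frac_le) auto
    also have "\<dots> = norm (1 - z / lam n)"
    proof -
      have "1 - z / lam n = - ((z - lam n) / lam n)" using nz[of n] by (simp add: field_simps)
      thus ?thesis by (simp add: norm_divide)
    qed
    finally show ?thesis .
  qed
  show ?thesis unfolding quotient_bound_def
  proof (intro exI[of _ K] conjI allI impI)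
    show "K > 0" using k by (simp add: K_def)
    fix w r T \<Psi> M
    assume r: "r > 0" and w: "norm w \<le> L * r" and hol: "\<Psi> holomorphic_on UNIV"
      and van: "\<forall>n\<in>T. lam n \<in> ball w (2 * r) \<longrightarrow> vanishes (mu n) \<Psi> (lam n)"
      and M: "\<forall>z\<in>sphere w (3 * r). norm (\<Psi> z) \<le> M"
    define S where "S = {n\<in>T. lam n \<in> ball w (2 * r)}"
    have Slam: "norm (lam n) \<le> (L + 2) * r" if "n \<in> S" for n
      using that w norm_triangle_sub[of "lam n" w]
      by (auto simp: S_def dist_norm norm_minus_commute algebra_simps)
    have "finite S"
      by (rule finite_subset[OF _ finite_lam_ball[of "(L + 2) * r"]]) (use Slam in auto)
    then obtain \<psi> where \<psi>: "\<psi> holomorphic_on UNIV" "\<And>z. \<Psi> z = zprod lam mu S z * \<psi> z"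
      using divide_finite[of S \<Psi>] van hol assms(1) by (auto simp: S_def inj_on_def inj_def)
    have znorm: "norm z \<le> (L + 3) * r" if "norm (z - w) \<le> 3 * r" for z
      using that w norm_triangle_sub[of z w] by (simp add: algebra_simps)
    have ex: "exp (- \<delta> * norm z) \<ge> exp (- (\<epsilon> * r / 2))" if "norm (z - w) \<le> 3 * r" for z
    proof -
      have "\<delta> * norm z \<le> \<delta> * ((L + 3) * r)" using znorm[OF that] pos by (intro mult_left_mono) auto
      also have "\<dots> = \<epsilon> * r / 2" using assms by (simp add: \<delta>_def field_simps)
      finally show ?thesis by simp
    qed
    have lowS: "k * exp (- (\<epsilon> * r / 2)) \<le> norm (zprod lam mu S z)" if z: "norm (z - w) = 3 * r" for z
    proof -
      have "k * exp (- \<delta> * norm z) \<le> norm (zprod lam mu S z)"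
      proof (rule k(2))
        fix n assume n: "n \<in> S"
        have "norm (lam n - w) \<le> 2 * r" using n by (simp add: S_def dist_norm norm_minus_commute)
        hence "norm (z - lam n) \<ge> r" using z norm_triangle_ineq[of "z - lam n" "lam n - w"] by simp
        moreover have "(L + 2) * r \<le> 4 * (L + 2) * r" using assms(3) r by (intro mult_right_mono) auto
        hence "norm (lam n) \<le> 4 * (L + 2) * r" using Slam[OF n] by linarith
        ultimately show "norm (1 - z / lam n) \<ge> c" using fac r by blast
      qed
      moreover have "k * exp (- (\<epsilon> * r / 2)) \<le> k * exp (- \<delta> * norm z)"
        using ex[of z] z k(1) by (intro mult_left_mono) auto
      ultimately show ?thesis by linarith
    qed
    have lowT: "k * exp (- (\<epsilon> * r / 2)) \<le> norm (zprod lam mu (T - S) z)" if z: "norm (z - w) \<le> r" for z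
    proof -
      have "k * exp (- \<delta> * norm z) \<le> norm (zprod lam mu (T - S) z)"
      proof (rule k(2))
        fix n assume n: "n \<in> T - S" "norm (lam n) \<le> 4 * norm z"
        have "norm (lam n - w) \<ge> 2 * r" using n by (auto simp: S_def dist_norm norm_minus_commute)
        hence "norm (z - lam n) \<ge> r"
          using z norm_triangle_ineq[of "lam n - z" "z - w"] by (simp add: norm_minus_commute)
        moreover have "norm z \<le> (L + 1) * r" using z w norm_triangle_sub[of z w] by (simp add: algebra_simps)
        hence "norm (lam n) \<le> 4 * (L + 2) * r" using n r by (simp add: algebra_simps)
        ultimately show "norm (1 - z / lam n) \<ge> c" using fac r by blast
      qed
      moreover have "k * exp (- (\<epsilon> * r / 2)) \<le> k * exp (- \<delta> * norm z)"
        using ex[of z] z r k(1) by (intro mult_left_mono) auto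
      ultimately show ?thesis by linarith
    qed
    define e where "e = exp (\<epsilon> * r / 2)"
    have e: "e > 0" "exp (- (\<epsilon> * r / 2)) = 1 / e" by (auto simp: e_def exp_minus field_simps)
    have \<psi>M: "norm (\<psi> z) \<le> M * e / k" if "z \<in> cball w (3 * r)" for z
    proof (rule maximum_modulus_frontier[of \<psi> "cball w (3 * r)"])
      fix u assume "u \<in> frontier (cball w (3 * r))"
      hence u: "u \<in> sphere w (3 * r)" using r by (simp add: frontier_cball)
      hence "norm (\<Psi> u) \<le> M" using M by blast
      hence "norm (zprod lam mu S u) * norm (\<psi> u) \<le> M" using \<psi>(2) by (simp add: norm_mult)
      moreover have "k / e \<le> norm (zprod lam mu S u)"
        using lowS[of u] u e by (simp add: dist_norm norm_minus_commute)
      ultimately have "k / e * norm (\<psi> u) \<le> M" by (smt (verit) mult_right_mono norm_ge_zero)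
      thus "norm (\<psi> u) \<le> M * e / k" using e k(1) by (simp add: field_simps)
    qed (use that \<psi> in \<open>auto intro: holomorphic_on_subset holomorphic_on_imp_continuous_on\<close>)
    define q where "q = (\<lambda>z. \<psi> z / zprod lam mu (T - S) z)"
    have nz': "zprod lam mu (T - S) z \<noteq> 0" if "z \<in> ball w (2 * r)" for z
      using that by (auto simp: zprod_eq_0_iff S_def)
    have "q holomorphic_on ball w (2 * r)"
      unfolding q_def using nz' by (intro holomorphic_on_divide zprod_holomorphic holomorphic_on_subset[OF \<psi>(1)]) auto
    moreover have "\<Psi> z = zprod lam mu T z * q z" if "z \<in> ball w (2 * r)" for z
      using zprod_split[of S "T - S" z] nz'[OF that] \<psi>(2)[of z] by (simp add: q_def S_def Un_absorb1 Collect_restrict)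
    moreover have "norm (q z) \<le> K * exp (\<epsilon> * r) * M" if z: "z \<in> cball w r" for z
    proof -
      have 1: "norm (\<psi> z) \<le> M * e / k" using \<psi>M[of z] z r by auto
      have 2: "k / e \<le> norm (zprod lam mu (T - S) z)"
        using lowT[of z] z e by (simp add: dist_norm norm_minus_commute)
      have "norm (q z) \<le> (M * e / k) / (k / e)"
        unfolding q_def norm_divide using 1 2 e k(1) by (intro frac_le) (auto intro: order_trans[OF norm_ge_zero])
      also have "\<dots> = K * (e * e) * M" using k(1) by (simp add: K_def)
      also have "e * e = exp (\<epsilon> * r)" by (simp add: e_def exp_add[symmetric])
      finally show ?thesis .
    qed
    ultimately show "\<exists>q. q holomorphic_on ball w (2 * r) \<and> (\<forall>z\<in>ball w (2 * r). \<Psi> z = zprod lam mu T z * q z) \<and>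
         (\<forall>z\<in>cball w r. norm (q z) \<le> K * exp (\<epsilon> * r) * M)" by blast
  qed
qed

end

section \<open>Operators of infinite order on exponential polynomials and on discs\<close>

lemma tc_higher_deriv_sums:
  assumes "a holomorphic_on UNIV"
  shows "(\<lambda>j. tc a j * (fact k * of_nat (j choose k) * l ^ (j - k))) sums (deriv ^^ k) a l"
proof -
  have "(\<lambda>j. (deriv ^^ j) ((deriv ^^ k) a) 0 / fact j * (l - 0) ^ j) sums (deriv ^^ k) a l"
    by (rule holomorphic_power_series[of _ _ "norm l + 1"])
       (use assms in \<open>auto intro!: holomorphic_higher_deriv intro: holomorphic_on_subset\<close>)
  moreover have "(deriv ^^ j) ((deriv ^^ k) a) 0 / fact j * (l - 0) ^ j =
      tc a (j + k) * (fact k * of_nat ((j + k) choose k) * l ^ (j + k - k))" for j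
  proof -
    have "of_nat ((j + k) choose k) = (fact (j + k) / (fact k * fact j) :: complex)"
      by (subst binomial_fact) auto
    thus ?thesis by (simp add: tc_def funpow_add divide_simps mult_ac)
  qed
  ultimately have "(\<lambda>j. tc a (j + k) * (fact k * of_nat ((j + k) choose k) * l ^ (j + k - k))) sums (deriv ^^ k) a l"
    by simp
  thus ?thesis
    by (subst (asm) sums_zero_iff_shift) auto
qed

lemma higher_deriv_power_at: "(deriv ^^ i) (\<lambda>z. (z - x) ^ k) x = (if i = k then fact k else 0)" for x :: complex
proof -
  have "(deriv ^^ i) (\<lambda>z. (z - x) ^ k) x = pochhammer (of_nat (Suc k - i)) i * (x - x) ^ (k - i)"
    by (rule higher_deriv_power)
  also have "\<dots> = (if i = k then fact k else 0)"
    by (cases i k rule: linorder_cases) (auto simp: pochhammer_fact[symmetric] pochhammer_0_left)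
  finally show ?thesis .
qed

lemma higher_deriv_exp_shift: "(deriv ^^ i) (\<lambda>z. exp (l * (z - x))) = (\<lambda>z. l ^ i * exp (l * (z - x)))" for l x :: complex
proof (induction i)
  case (Suc i)
  have "deriv (\<lambda>z. l ^ i * exp (l * (z - x))) z = l ^ Suc i * exp (l * (z - x))" for z
    by (rule DERIV_imp_deriv) (auto intro!: derivative_eq_intros)
  thus ?case by (simp add: Suc fun_eq_iff)
qed simp

lemma higher_deriv_exp_poly:
  "(deriv ^^ j) (\<lambda>z. (z - x) ^ k * exp (l * (z - x))) x = fact k * of_nat (j choose k) * l ^ (j - k)" for l x :: complex
proof -
  have "(deriv ^^ j) (\<lambda>z. (z - x) ^ k * exp (l * (z - x))) x =
     (\<Sum>i = 0..j. of_nat (j choose i) * (deriv ^^ i) (\<lambda>z. (z - x) ^ k) x * (deriv ^^ (j - i)) (\<lambda>z. exp (l * (z - x))) x)"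
    by (rule higher_deriv_mult[of _ UNIV]) (auto intro!: holomorphic_intros)
  also have "\<dots> = (\<Sum>i = 0..j. if i = k then fact k * of_nat (j choose k) * l ^ (j - k) else 0)"
    by (rule sum.cong) (auto simp: higher_deriv_power_at higher_deriv_exp_shift)
  also have "\<dots> = fact k * of_nat (j choose k) * l ^ (j - k)" by auto
  finally show ?thesis .
qed

text \<open>An operator with symbol \<open>a\<close> multiplies exp (l z) by a(l); differentiating k
  times in l produces the monomial on one side and the k-th derivative of the symbol on the other.
  Centring at \<open>x\<close> reduces this to the Taylor series of that derivative.\<close>

lemma op_exp_poly:
  assumes "a holomorphic_on UNIV"
  shows "(\<lambda>j. tc a j * (deriv ^^ j) (\<lambda>z. (z - x) ^ k * exp (l * (z - x))) x) sums (deriv ^^ k) a l"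
  unfolding higher_deriv_exp_poly by (rule tc_higher_deriv_sums[OF assms])

text \<open>Cauchy's inequality on a disc of fixed radius: only the supremum of \<open>H\<close> on
  that disc enters, and the constant is finite for every r when the coefficients are dominated by
  \<open>G_coef\<close>.\<close>

lemma op_bound:
  fixes a :: "nat \<Rightarrow> complex"
  assumes "H holomorphic_on S" "open S" "cball x r \<subseteq> S" "r > 0" "\<And>z. z \<in> cball x r \<Longrightarrow> norm (H z) \<le> M"
    and summ: "summable (\<lambda>j. norm (a j) * fact j / r ^ j)"
  shows "norm ((deriv ^^ j) H x) \<le> fact j * M / r ^ j"
    and "summable (\<lambda>j. norm (a j * (deriv ^^ j) H x))"
    and "norm (\<Sum>j. a j * (deriv ^^ j) H x) \<le> M * (\<Sum>j. norm (a j) * fact j / r ^ j)"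
proof -
  show *: "norm ((deriv ^^ j) H x) \<le> fact j * M / r ^ j" for j
  proof (rule Cauchy_inequality)
    show "continuous_on (cball x r) H"
      using assms by (meson holomorphic_on_imp_continuous_on holomorphic_on_subset)
    show "H holomorphic_on ball x r"
      using assms by (meson ball_subset_cball holomorphic_on_subset)
  qed (use assms in \<open>auto simp: dist_norm\<close>)
  have le: "norm (a j * (deriv ^^ j) H x) \<le> M * (norm (a j) * fact j / r ^ j)" for j
    using mult_left_mono[OF *[of j], of "norm (a j)"] by (simp add: norm_mult mult_ac)
  have s: "summable (\<lambda>j. M * (norm (a j) * fact j / r ^ j))" by (rule summable_mult[OF summ])
  show sn: "summable (\<lambda>j. norm (a j * (deriv ^^ j) H x))"
    by (rule summable_comparison_test'[OF s]) (use le in auto)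
  have "norm (\<Sum>j. a j * (deriv ^^ j) H x) \<le> (\<Sum>j. norm (a j * (deriv ^^ j) H x))"
    by (rule summable_norm[OF sn])
  also have "\<dots> \<le> (\<Sum>j. M * (norm (a j) * fact j / r ^ j))" by (rule suminf_le[OF le sn s])
  also have "\<dots> = M * (\<Sum>j. norm (a j) * fact j / r ^ j)" by (rule suminf_mult[OF summ])
  finally show "norm (\<Sum>j. a j * (deriv ^^ j) H x) \<le> M * (\<Sum>j. norm (a j) * fact j / r ^ j)" .
qed

subsection \<open>Exponential series are solutions\<close>

lemma vderivs_Suc: "vderivs (Suc k) f x = vector_derivative (vderivs k f) (at x)"
  by (simp add: vderivs_def)

lemma vderivs_0 [simp]: "vderivs 0 f = f"
  by (simp add: vderivs_def)

lemma vderivs_holomorphic: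
  assumes H: "H holomorphic_on S" "open S" and I: "open I" "\<And>x. x \<in> I \<Longrightarrow> complex_of_real x \<in> S"
    and f: "\<And>x. x \<in> I \<Longrightarrow> f x = H (of_real x)"
  shows "x \<in> I \<Longrightarrow> vderivs k f x = (deriv ^^ k) H (of_real x)"
    and "x \<in> I \<Longrightarrow> (vderivs k f has_vector_derivative (deriv ^^ Suc k) H (of_real x)) (at x)"
proof -
  have D: "(g has_vector_derivative (deriv ^^ Suc k) H (of_real x)) (at x)"
    if "x \<in> I" "\<And>x. x \<in> I \<Longrightarrow> g x = (deriv ^^ k) H (of_real x)" for g k x
  proof (rule has_vector_derivative_transform_within_open[OF _ I(1) \<open>x \<in> I\<close>])
    show "((\<lambda>x. (deriv ^^ k) H (of_real x)) has_vector_derivative (deriv ^^ Suc k) H (of_real x)) (at x)"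
      by (rule has_vector_derivative_real_field)
         (use has_field_derivative_higher_deriv[OF H I(2)[OF that(1)]] in auto)
  qed (use that in auto)
  have *: "\<forall>x\<in>I. vderivs k f x = (deriv ^^ k) H (of_real x)" for k
  proof (induction k)
    case (Suc k)
    show ?case
    proof
      fix x assume x: "x \<in> I"
      have "(vderivs k f has_vector_derivative (deriv ^^ Suc k) H (of_real x)) (at x)"
        using Suc x by (intro D) auto
      thus "vderivs (Suc k) f x = (deriv ^^ Suc k) H (of_real x)"
        unfolding vderivs_Suc by (rule vector_derivative_at)
    qed
  qed (use f in auto)
  show "x \<in> I \<Longrightarrow> vderivs k f x = (deriv ^^ k) H (of_real x)" using * by blast
  show "x \<in> I \<Longrightarrow> (vderivs k f has_vector_derivative (deriv ^^ Suc k) H (of_real x)) (at x)"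
    by (rule D) (use * in auto)
qed

lemma higher_deriv_sum:
  assumes "finite A" "\<And>i. i \<in> A \<Longrightarrow> f i holomorphic_on S" "open S" "x \<in> S"
  shows "(deriv ^^ j) (\<lambda>z. \<Sum>i\<in>A. f i z) x = (\<Sum>i\<in>A. (deriv ^^ j) (f i) x)"
  using assms
proof (induction A rule: finite_induct)
  case (insert i A)
  have "(deriv ^^ j) (\<lambda>z. f i z + (\<Sum>i\<in>A. f i z)) x = (deriv ^^ j) (f i) x + (deriv ^^ j) (\<lambda>z. \<Sum>i\<in>A. f i z) x"
    by (rule higher_deriv_add[of _ S]) (use insert in \<open>auto intro!: holomorphic_intros\<close>)
  thus ?case using insert by simp
qed auto

lemma op_exp_poly_sum:
  assumes "a holomorphic_on UNIV"
  shows "(\<lambda>j. tc a j * (deriv ^^ j) (\<lambda>z. \<Sum>k<m. B k * ((z - x) ^ k * exp (l * (z - x)))) x) sums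
           (\<Sum>k<m. B k * (deriv ^^ k) a l)"
proof -
  have "(\<lambda>j. \<Sum>k<m. B k * (tc a j * (deriv ^^ j) (\<lambda>z. (z - x) ^ k * exp (l * (z - x))) x)) sums
           (\<Sum>k<m. B k * (deriv ^^ k) a l)"
    by (intro sums_sum sums_mult op_exp_poly assms)
  moreover have "(deriv ^^ j) (\<lambda>z. \<Sum>k<m. B k * ((z - x) ^ k * exp (l * (z - x)))) x =
      (\<Sum>k<m. B k * (deriv ^^ j) (\<lambda>z. (z - x) ^ k * exp (l * (z - x))) x)" for j
  proof -
    have "(deriv ^^ j) (\<lambda>z. \<Sum>k<m. B k * ((z - x) ^ k * exp (l * (z - x)))) x =
        (\<Sum>k<m. (deriv ^^ j) (\<lambda>z. B k * ((z - x) ^ k * exp (l * (z - x)))) x)"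
      by (rule higher_deriv_sum[of _ _ UNIV]) (auto intro!: holomorphic_intros)
    also have "\<dots> = (\<Sum>k<m. B k * (deriv ^^ j) (\<lambda>z. (z - x) ^ k * exp (l * (z - x))) x)"
      by (intro sum.cong refl higher_deriv_cmult[of _ UNIV]) (auto intro!: holomorphic_intros)
    finally show ?thesis .
  qed
  ultimately show ?thesis by (simp add: sum_distrib_left mult_ac)
qed

section \<open>Polynomials bounded on an interval, and the Baire argument\<close>

text \<open>The series is given in powers of z, whereas the operator formula at \<open>x\<close>
  needs powers of z - x. That the degree stays below \<open>m\<close> is essential: only derivatives
  of the symbol of order below the multiplicity vanish.\<close>

lemma poly_recenter: "\<exists>p. \<forall>z. (\<Sum>k<m. c k * z ^ k) = (\<Sum>k<m. p k * (z - x) ^ k)" for x :: complex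
proof (induction m)
  case (Suc m)
  then obtain p where p: "\<And>z. (\<Sum>k<m. c k * z ^ k) = (\<Sum>k<m. p k * (z - x) ^ k)" by blast
  define q where "q = (\<lambda>k. (if k < m then p k else 0) + c m * (of_nat (m choose k) * x ^ (m - k)))"
  have "(\<Sum>k<Suc m. c k * z ^ k) = (\<Sum>k<Suc m. q k * (z - x) ^ k)" for z
  proof -
    have "z ^ m = ((z - x) + x) ^ m" by simp
    also have "\<dots> = (\<Sum>k<Suc m. of_nat (m choose k) * (z - x) ^ k * x ^ (m - k))"
      unfolding binomial_ring by (simp only: lessThan_Suc_atMost)
    finally have "c m * z ^ m = (\<Sum>k<Suc m. c m * (of_nat (m choose k) * x ^ (m - k)) * (z - x) ^ k)"
      by (simp only: sum_distrib_left mult_ac)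
    moreover have "(\<Sum>k<m. p k * (z - x) ^ k) = (\<Sum>k<Suc m. (if k < m then p k else 0) * (z - x) ^ k)"
      by simp
    ultimately show ?thesis
      using p[of z] unfolding q_def distrib_right sum.distrib by simp
  qed
  thus ?case by blast
qed simp

text \<open>Bernstein--Walsh: after the Joukowski substitution, \<open>u\<^sup>m P(e + d (u + 1/u))\<close> is a polynomial in \<open>u\<close>
  bounded by \<open>M\<close> on the unit circle.\<close>

lemma poly_growth:
  fixes c :: "nat \<Rightarrow> complex" and a b M :: real
  assumes ab: "a < b" and M: "\<And>x. x \<in> {a..b} \<Longrightarrow> norm (\<Sum>k<m. c k * of_real x ^ k) \<le> M"
  shows "norm (\<Sum>k<m. c k * z ^ k) \<le> M * (1 + 4 * norm (z - of_real ((a + b) / 2)) / (b - a)) ^ m"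
proof -
  \<comment> \<open>On the unit circle u + 1/u = 2 Re u ranges over [-2, 2], so the scale (b - a) /
    4 maps the circle onto [a, b].\<close>
  define e d where "e = complex_of_real ((a + b) / 2)" and "d = complex_of_real ((b - a) / 4)"
  have d0: "d \<noteq> 0" using ab by (simp add: d_def)
  define Q where "Q = (\<lambda>u. \<Sum>k<m. c k * u ^ (m - k) * (e * u + d * (u ^ 2 + 1)) ^ k)"
  have Q: "Q u = u ^ m * (\<Sum>k<m. c k * (e + d * (u + 1 / u)) ^ k)" if "u \<noteq> 0" for u
  proof -
    have "e * u + d * (u ^ 2 + 1) = u * (e + d * (u + 1 / u))"
      using that by (simp add: field_simps power2_eq_square)
    hence "Q u = (\<Sum>k<m. u ^ m * (c k * (e + d * (u + 1 / u)) ^ k))"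
      unfolding Q_def using that
      by (intro sum.cong) (auto simp: power_mult_distrib power_diff divide_simps)
    thus ?thesis by (simp add: sum_distrib_left)
  qed
  have sph: "norm (Q u) \<le> M" if "norm u = 1" for u
  proof -
    have u0: "u \<noteq> 0" using that by auto
    have "u * cnj u = 1" using that by (simp add: complex_norm_square[symmetric])
    hence "1 / u = cnj u" using u0 by (simp add: field_simps)
    hence "u + 1 / u = of_real (2 * Re u)" by (simp add: complex_eq_iff)
    hence eq: "e + d * (u + 1 / u) = of_real ((a + b) / 2 + (b - a) / 2 * Re u)"
      by (simp add: e_def d_def)
    have "\<bar>Re u\<bar> \<le> 1" using abs_Re_le_cmod[of u] that by simp
    hence "\<bar>(b - a) / 2 * Re u\<bar> \<le> (b - a) / 2 * 1"
      unfolding abs_mult using ab by (intro mult_mono) auto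
    hence "(a + b) / 2 + (b - a) / 2 * Re u \<in> {a..b}" by (auto simp: abs_le_iff field_simps)
    from M[OF this] show ?thesis using that by (simp add: Q[OF u0] eq norm_mult norm_power)
  qed
  have ball: "norm (Q u) \<le> M" if "norm u \<le> 1" for u
  proof (rule maximum_modulus_frontier[of Q "cball 0 1"])
    show "Q holomorphic_on interior (cball 0 1)" unfolding Q_def by (intro holomorphic_intros)
    show "continuous_on (closure (cball 0 1)) Q" unfolding Q_def by (intro continuous_intros)
  qed (use sph that in \<open>auto simp: frontier_cball\<close>)
  define w where "w = (z - e) / d"
  \<comment> \<open>The roots of u^2 - w u + 1 = 0 are inverse to each other, so one lies in the
    closed unit disc; its inverse is w - u, of modulus at most |w| + 1.\<close>
  obtain u where u: "norm u \<le> 1" "u * (w - u) = 1"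
  proof -
    define u where "u = (w + csqrt (w\<^sup>2 - 4)) / 2"
    have eq: "u * (w - u) = 1"
    proof -
      have "u * (w - u) = (w\<^sup>2 - (csqrt (w\<^sup>2 - 4))\<^sup>2) / 4"
        by (simp add: u_def field_simps power2_eq_square)
      thus ?thesis by simp
    qed
    show thesis
    proof (cases "norm u \<le> 1")
      case True
      thus ?thesis using that eq by blast
    next
      case False
      have "norm u * norm (w - u) = 1" using eq by (metis norm_mult norm_one)
      hence "norm (w - u) = 1 / norm u" using False by (metis mult_zero_left nonzero_mult_div_cancel_left zero_neq_one)
      hence "norm (w - u) \<le> 1" using False by (simp add: divide_le_eq_1)
      thus ?thesis using that[of "w - u"] eq by (simp add: mult.commute)
    qed
  qed
  have u0: "u \<noteq> 0" using u by auto
  have iu: "1 / u = w - u" using u u0 by (simp add: field_simps)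
  have z: "e + d * (u + 1 / u) = z" using d0 by (simp add: iu w_def)
  have nd: "norm d = (b - a) / 4" unfolding d_def norm_of_real using ab by simp
  have "norm (1 / u) \<le> norm w + 1" using iu u(1) norm_triangle_ineq4[of w u] by simp
  also have "norm w = 4 * norm (z - of_real ((a + b) / 2)) / (b - a)"
    unfolding e_def[symmetric] by (simp add: w_def norm_divide nd)
  finally have iu': "norm (1 / u) \<le> 1 + 4 * norm (z - of_real ((a + b) / 2)) / (b - a)" by simp
  have M0: "M \<ge> 0" using order_trans[OF norm_ge_zero ball[of 0]] by simp
  have "norm (\<Sum>k<m. c k * z ^ k) = norm (Q u * (1 / u) ^ m)"
    using Q[OF u0] u0 by (simp add: z power_divide)
  also have "\<dots> = norm (Q u) * norm (1 / u) ^ m" by (simp add: norm_mult norm_power)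
  also have "\<dots> \<le> M * (1 + 4 * norm (z - of_real ((a + b) / 2)) / (b - a)) ^ m"
    using ball[OF u(1)] iu' M0 by (intro mult_mono power_mono) auto
  finally show ?thesis .
qed

lemma Baire_bounded_interval:
  fixes t :: "nat \<Rightarrow> real \<Rightarrow> complex"
  assumes ab: "a < b" and cont: "\<And>n. continuous_on {a..b} (t n)"
    and bdd: "\<And>x. x \<in> {a..b} \<Longrightarrow> \<exists>M. \<forall>n. norm (t n x) \<le> M"
  obtains a' b' M where "a \<le> a'" "a' < b'" "b' \<le> b" "\<And>n x. x \<in> {a'..b'} \<Longrightarrow> norm (t n x) \<le> M"
proof (rule ccontr)
  assume no: "\<not> thesis"
  define E where "E = (\<lambda>M::nat. \<Inter>n. {x\<in>{a..b}. norm (t n x) \<le> real M})"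
  have closed: "closedin (top_of_set {a..b}) (E M)" for M
    unfolding E_def
  proof (rule closedin_Inter)
    fix T assume "T \<in> range (\<lambda>n. {x \<in> {a..b}. cmod (t n x) \<le> real M})"
    then obtain n where T: "T = {x \<in> {a..b}. cmod (t n x) \<le> real M}" by auto
    have "closedin (top_of_set {a..b}) ({a..b} \<inter> (\<lambda>x. norm (t n x)) -` {..real M})"
      by (intro continuous_closedin_preimage continuous_intros cont)
    thus "closedin (top_of_set {a..b}) T" by (simp add: T vimage_def Int_def)
  qed auto
  have dense: "{a..b} \<subseteq> closure ({a..b} - E M)" for M
  proof
    fix x assume x: "x \<in> {a..b}"
    show "x \<in> closure ({a..b} - E M)"
      unfolding closure_approachable
    proof (intro allI impI)
      fix e :: real assume e: "e > 0"
      define p q where "p = max a (x - e/2)" and "q = min b (x + e/2)"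
      have pq: "a \<le> p" "p < q" "q \<le> b" using x e ab by (auto simp: p_def q_def)
      have "\<not> (\<forall>n x. x \<in> {p..q} \<longrightarrow> norm (t n x) \<le> real M)"
        using no that[OF pq, of "real M"] by blast
      then obtain n y where y: "y \<in> {p..q}" "norm (t n y) > real M" by (auto simp: not_le)
      hence "y \<notin> E M" by (auto simp: E_def not_le)
      hence "y \<in> {a..b} - E M" using y(1) pq by auto
      moreover have "dist y x < e" using y(1) e by (auto simp: p_def q_def dist_real_def)
      ultimately show "\<exists>y\<in>{a..b} - E M. dist y x < e" by blast
    qed
  qed
  have "{a..b} \<subseteq> closure (\<Inter>(range (\<lambda>M. {a..b} - E M)))"
  proof (rule Baire)
    fix T assume "T \<in> range (\<lambda>M. {a..b} - E M)"
    thus "openin (top_of_set {a..b}) T \<and> {a..b} \<subseteq> closure T"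
      using dense closed by (auto intro!: openin_diff)
  qed auto
  moreover have "\<Inter>(range (\<lambda>M. {a..b} - E M)) = {}"
  proof (rule equals0I)
    fix x assume x: "x \<in> \<Inter>(range (\<lambda>M. {a..b} - E M))"
    then obtain M where M: "\<And>n. norm (t n x) \<le> M" using bdd[of x] by auto
    obtain N where "M \<le> real N" using real_arch_simple by blast
    hence "norm (t n x) \<le> real N" for n using M[of n] by linarith
    hence "x \<in> E N" using x by (auto simp: E_def)
    thus False using x by auto
  qed
  ultimately have "{a..b} \<subseteq> closure {}" by (simp only:)
  thus False using ab by auto
qed

section \<open>Exponential series with exponents in a sector\<close>

text \<open>The bound on arguments in quantitative form: \<open>\<kappa>\<close> will be 1 / cos of
  the supremum of the |Arg (lam n)|.\<close>

locale sector_seq = zero_seq +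
  fixes \<kappa> :: real
  assumes inj_lam: "inj lam" and \<kappa>_pos: "\<kappa> > 0" and sector: "\<And>n. norm (lam n) \<le> \<kappa> * Re (lam n)"
begin

lemma Re_lam_ge: "norm (lam n) / \<kappa> \<le> Re (lam n)"
  using sector[of n] \<kappa>_pos by (simp add: field_simps)

lemma Re_lam_pos: "Re (lam n) > 0"
  using Re_lam_ge[of n] nz[of n] \<kappa>_pos by (meson divide_pos_pos less_le_trans zero_less_norm_iff)

text \<open>Summability of mu n / |lam n| makes the multiplicities o(|lam n|), so a fixed base to
  the power \<open>mu n\<close> is subexponential; the finitely many exceptional indices go into
  \<open>K\<close>.\<close>

lemma power_mu_le:
  assumes "C \<ge> 1" "\<epsilon> > 0"
  obtains K where "K \<ge> 1" "\<And>n. C ^ mu n \<le> K * exp (\<epsilon> * norm (lam n))"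
proof -
  have "(\<lambda>n. dens n * ln C) \<longlonglongrightarrow> 0 * ln C"
    by (intro tendsto_intros summable_LIMSEQ_zero[OF summ])
  hence "\<forall>\<^sub>F n in sequentially. dens n * ln C < \<epsilon>" using assms by (intro order_tendstoD) auto
  then obtain N where N: "\<And>n. n \<ge> N \<Longrightarrow> dens n * ln C < \<epsilon>" by (auto simp: eventually_sequentially)
  define K where "K = C ^ (\<Sum>n<N. mu n)"
  have K: "K \<ge> 1" using assms by (simp add: K_def)
  show thesis
  proof (rule that[OF K])
    fix n
    show "C ^ mu n \<le> K * exp (\<epsilon> * norm (lam n))"
    proof (cases "n < N")
      case True
      have "C ^ mu n \<le> K"
        unfolding K_def using assms True by (intro power_increasing member_le_sum) auto
      also have "\<dots> \<le> K * exp (\<epsilon> * norm (lam n))" using K assms by simp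
      finally show ?thesis .
    next
      case False
      hence "real (mu n) * ln C \<le> \<epsilon> * norm (lam n)" using N[of n] nz[of n] by (simp add: field_simps)
      hence "exp (real (mu n) * ln C) \<le> 1 * exp (\<epsilon> * norm (lam n))" by simp
      also have "\<dots> \<le> K * exp (\<epsilon> * norm (lam n))" using K by (intro mult_right_mono) auto
      finally show ?thesis using assms by (simp add: exp_of_nat_mult)
    qed
  qed
qed

lemma exp_lam_summable:
  assumes "\<eta> > 0"
  shows "summable (\<lambda>n. exp (- (\<eta> * norm (lam n))))"
proof (rule summable_comparison_test')
  show "summable (\<lambda>n. 1 / \<eta> * dens n)" by (rule summable_mult[OF summ])
  fix n :: nat
  have p: "\<eta> * norm (lam n) > 0" using assms nz[of n] by simp
  have "exp (- (\<eta> * norm (lam n))) = 1 / exp (\<eta> * norm (lam n))" by (simp add: exp_minus field_simps)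
  also have "\<dots> \<le> 1 / (\<eta> * norm (lam n))"
  proof (rule divide_left_mono)
    show "\<eta> * norm (lam n) \<le> exp (\<eta> * norm (lam n))"
      using exp_ge_add_one_self[of "\<eta> * norm (lam n)"] by linarith
  qed (use p in auto)
  also have "\<dots> = 1 / \<eta> * (1 / norm (lam n))" by simp
  also have "\<dots> \<le> 1 / \<eta> * dens n"
    using assms mu_pos[of n] by (intro mult_left_mono divide_right_mono) auto
  finally show "norm (exp (- (\<eta> * norm (lam n)))) \<le> 1 / \<eta> * dens n" by simp
qed

definition eterm :: "(nat \<Rightarrow> nat \<Rightarrow> complex) \<Rightarrow> nat \<Rightarrow> complex \<Rightarrow> complex" where
  "eterm c n z = (\<Sum>k<mu n. c n k * z ^ k) * exp (lam n * z)"

lemma eterm_holomorphic: "eterm c n holomorphic_on S"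
  unfolding eterm_def by (intro holomorphic_intros)

lemma W_set_iff:
  "f \<in> W_set lam mu \<gamma> \<beta> \<longleftrightarrow> (\<exists>c. \<forall>x\<in>{\<gamma><..<\<beta>}. (\<lambda>n. eterm c n (of_real x)) sums f x)"
  by (simp add: W_set_def eterm_def)

text \<open>Pointwise convergence bounds the terms uniformly on some interval right of
  \<open>b\<close>. \<open>poly_growth\<close> carries the bound on the polynomial factors to the
  plane at the subexponential cost \<open>C ^ mu n\<close>, and the exponentials decay leftwards
  because Re (lam n) is comparable to |lam n|. Only |z| \<le> R limits the real part from
  below.\<close>

lemma eterm_bound:
  assumes "\<gamma> < \<beta>" and conv: "\<And>x. x \<in> {\<gamma><..<\<beta>} \<Longrightarrow> summable (\<lambda>n. eterm c n (of_real x))"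
    and "b < \<beta>"
  obtains \<tau> where "\<tau> > 0" "\<And>R. \<exists>m. summable m \<and>
    (\<forall>n z. Re z \<le> b \<longrightarrow> \<bar>Im z\<bar> \<le> \<tau> \<longrightarrow> norm z \<le> R \<longrightarrow> norm (eterm c n z) \<le> m n)"
proof -
  \<comment> \<open>\<open>b\<close> may lie left of \<gamma>, while the interval for the Baire
    argument must lie inside (\<gamma>, \<beta>).\<close>
  define a0 where "a0 = max b \<gamma>"
  define p where "p = (a0 + \<beta>) / 2"
  define q where "q = (p + \<beta>) / 2"
  have pq: "\<gamma> < p" "b < p" "p < q" "q < \<beta>" using assms by (auto simp: p_def q_def a0_def)
  define t where "t = (\<lambda>n x. eterm c n (complex_of_real x))"
  obtain a' b' M where ab: "p \<le> a'" "a' < b'" "b' \<le> q"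
    and M: "\<And>n x. x \<in> {a'..b'} \<Longrightarrow> norm (t n x) \<le> M"
  proof (rule Baire_bounded_interval[of p q t])
    show "continuous_on {p..q} (t n)" for n
      unfolding t_def eterm_def by (intro continuous_intros)
    fix x assume x: "x \<in> {p..q}"
    have "summable (\<lambda>n. t n x)" unfolding t_def by (rule conv) (use x pq in auto)
    hence "Bseq (\<lambda>n. t n x)" using summable_LIMSEQ_zero convergent_def convergent_imp_Bseq by blast
    thus "\<exists>M. \<forall>n. norm (t n x) \<le> M" by (auto simp: Bseq_def)
  qed (use pq in auto)
  define \<delta> where "\<delta> = p - b"
  have \<delta>: "\<delta> > 0" using pq by (simp add: \<delta>_def)
  \<comment> \<open>Moving left by at least \<delta> gains exp (- \<delta> |lam n| / \<kappa>). Half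
    of the exponent pays for the imaginary part, a quarter (\<open>\<eta>\<close> below) for the
    polynomial factor, and a quarter remains for summability.\<close>
  define \<tau> where "\<tau> = \<delta> / (2 * \<kappa>)"
  have M0: "M \<ge> 0" using M[of a' 0] ab by (auto intro: order_trans[OF norm_ge_zero])
  show thesis
  proof (rule that[of \<tau>])
    show "\<tau> > 0" using \<delta> \<kappa>_pos by (simp add: \<tau>_def)
    fix R :: real
    define C where "C = 1 + 4 * (\<bar>R\<bar> + \<bar>(a' + b') / 2\<bar>) / (b' - a')"
    have C: "C \<ge> 1" using ab by (simp add: C_def)
    define \<eta> where "\<eta> = \<delta> / (4 * \<kappa>)"
    have \<eta>: "\<eta> > 0" using \<delta> \<kappa>_pos by (simp add: \<eta>_def)
    obtain K where K: "K \<ge> 1" "\<And>n. C ^ mu n \<le> K * exp (\<eta> * norm (lam n))"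
      using power_mu_le[OF C \<eta>] by blast
    define m where "m = (\<lambda>n. M * K * exp (- (\<eta> * norm (lam n))))"
    have "norm (eterm c n z) \<le> m n" if z: "Re z \<le> b" "\<bar>Im z\<bar> \<le> \<tau>" "norm z \<le> R" for n z
    proof -
      let ?r = "Re (lam n)"
      have "norm (\<Sum>k<mu n. c n k * z ^ k) \<le> (M * exp (- ?r * a')) *
          (1 + 4 * norm (z - of_real ((a' + b') / 2)) / (b' - a')) ^ mu n"
      proof (rule poly_growth[OF ab(2)])
        fix x assume x: "x \<in> {a'..b'}"
        have "norm (\<Sum>k<mu n. c n k * of_real x ^ k) = norm (t n x) * exp (- ?r * x)"
          by (simp add: t_def eterm_def norm_mult exp_minus field_simps)
        also have "\<dots> \<le> M * exp (- ?r * a')"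
          using M[OF x, of n] M0 x Re_lam_pos[of n] by (intro mult_mono) auto
        finally show "norm (\<Sum>k<mu n. c n k * of_real x ^ k) \<le> M * exp (- ?r * a')" .
      qed
      also have "\<dots> \<le> (M * exp (- ?r * a')) * C ^ mu n"
      proof -
        have "norm (z - of_real ((a' + b') / 2)) \<le> \<bar>R\<bar> + \<bar>(a' + b') / 2\<bar>"
          using norm_triangle_ineq4[of z "of_real ((a' + b') / 2)"] z(3) unfolding norm_of_real by linarith
        hence "1 + 4 * norm (z - of_real ((a' + b') / 2)) / (b' - a') \<le> C"
          unfolding C_def using ab by (intro add_left_mono divide_right_mono mult_left_mono) auto
        thus ?thesis using M0 ab by (intro mult_left_mono power_mono) auto
      qed
      also have "\<dots> \<le> (M * exp (- ?r * a')) * (K * exp (\<eta> * norm (lam n)))"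
        using K(2)[of n] M0 by (intro mult_left_mono) auto
      finally have P: "norm (\<Sum>k<mu n. c n k * z ^ k) \<le> (M * exp (- ?r * a')) * (K * exp (\<eta> * norm (lam n)))" .
      have "norm (exp (lam n * z)) = exp (?r * Re z - Im (lam n) * Im z)" by simp
      also have "?r * Re z \<le> ?r * b" using z Re_lam_pos[of n] by (intro mult_left_mono) auto
      also have "- (Im (lam n) * Im z) \<le> norm (lam n) * \<tau>"
      proof -
        have "- (Im (lam n) * Im z) \<le> \<bar>Im (lam n)\<bar> * \<bar>Im z\<bar>" by (simp add: abs_mult[symmetric])
        also have "\<dots> \<le> norm (lam n) * \<tau>"
          using z abs_Im_le_cmod[of "lam n"] by (intro mult_mono) auto
        finally show ?thesis .
      qed
      hence "exp (?r * b - Im (lam n) * Im z) \<le> exp (?r * b + norm (lam n) * \<tau>)" by simp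
      finally have E: "norm (exp (lam n * z)) \<le> exp (?r * b + norm (lam n) * \<tau>)" by simp
      have "norm (eterm c n z) \<le> (M * exp (- ?r * a')) * (K * exp (\<eta> * norm (lam n))) * exp (?r * b + norm (lam n) * \<tau>)"
        unfolding eterm_def norm_mult using P E M0 K(1) by (intro mult_mono) auto
      also have "\<dots> = M * K * exp (- ?r * a' + \<eta> * norm (lam n) + (?r * b + norm (lam n) * \<tau>))"
        by (simp only: exp_add mult_ac)
      also have "\<dots> \<le> M * K * exp (- (\<eta> * norm (lam n)))"
      proof (intro mult_left_mono, subst exp_le_cancel_iff)
        have "norm (lam n) / \<kappa> * \<delta> \<le> ?r * (a' - b)"
          using Re_lam_ge[of n] Re_lam_pos[of n] ab \<delta> by (intro mult_mono) (auto simp: \<delta>_def)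
        moreover have "norm (lam n) / \<kappa> * \<delta> = \<eta> * norm (lam n) + norm (lam n) * \<tau> + \<eta> * norm (lam n)"
          using \<kappa>_pos by (simp add: \<eta>_def \<tau>_def field_simps)
        ultimately show "- ?r * a' + \<eta> * norm (lam n) + (?r * b + norm (lam n) * \<tau>) \<le> - (\<eta> * norm (lam n))"
          by (simp add: algebra_simps)
      qed (use M0 K in auto)
      finally show ?thesis by (simp add: m_def)
    qed
    moreover have "summable m" unfolding m_def by (intro summable_mult exp_lam_summable \<eta>)
    ultimately show "\<exists>m. summable m \<and>
      (\<forall>n z. Re z \<le> b \<longrightarrow> \<bar>Im z\<bar> \<le> \<tau> \<longrightarrow> norm z \<le> R \<longrightarrow> norm (eterm c n z) \<le> m n)" by blast
  qed
qed

lemma W_local: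
  assumes "\<gamma> < \<beta>" and conv: "\<And>x. x \<in> {\<gamma><..<\<beta>} \<Longrightarrow> summable (\<lambda>n. eterm c n (of_real x))"
    and "b < \<beta>"
  obtains S r m where "open S" "r > 0" "summable m"
    "\<And>n z. z \<in> S \<Longrightarrow> norm (eterm c n z) \<le> m n"
    "\<And>x. x \<in> {\<gamma><..<b} \<Longrightarrow> cball (complex_of_real x) r \<subseteq> S"
    "(\<lambda>z. \<Sum>n. eterm c n z) holomorphic_on S"
    "uniform_limit S (\<lambda>N z. \<Sum>n<N. eterm c n z) (\<lambda>z. \<Sum>n. eterm c n z) sequentially"
proof -
  define b' where "b' = (b + \<beta>) / 2"
  have b': "b < b'" "b' < \<beta>" using assms by (auto simp: b'_def)
  obtain \<tau> where \<tau>: "\<tau> > 0" "\<And>R. \<exists>m. summable m \<and>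
    (\<forall>n z. Re z \<le> b' \<longrightarrow> \<bar>Im z\<bar> \<le> \<tau> \<longrightarrow> norm z \<le> R \<longrightarrow> norm (eterm c n z) \<le> m n)"
    using eterm_bound[OF assms(1,2) b'(2)] by metis
  \<comment> \<open>The rectangle extends past \<gamma> on the left, where the series still
    converges, so a disc of one radius \<open>r\<close> fits around every x up to \<open>b\<close>;
    room is lost only on the right.\<close>
  define S where "S = {z. \<gamma> - 1 < Re z} \<inter> {z. Re z < b'} \<inter> {z. - \<tau> < Im z} \<inter> {z. Im z < \<tau>}"
  obtain m where m: "summable m" "\<And>n z. Re z \<le> b' \<Longrightarrow> \<bar>Im z\<bar> \<le> \<tau> \<Longrightarrow>
      norm z \<le> \<bar>\<gamma> - 1\<bar> + \<bar>b'\<bar> + \<tau> \<Longrightarrow> norm (eterm c n z) \<le> m n"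
    using \<tau>(2)[of "\<bar>\<gamma> - 1\<bar> + \<bar>b'\<bar> + \<tau>"] by blast
  define r where "r = min (\<tau> / 2) (min ((b' - b) / 2) (1/2))"
  have "r \<le> \<tau> / 2" "r \<le> (b' - b) / 2" "r \<le> 1/2" unfolding r_def by linarith+
  hence r: "r > 0" "r < \<tau>" "r < b' - b" "r < 1" using \<tau>(1) b' by (auto simp: r_def)
  have S: "open S" unfolding S_def
    by (intro open_Int open_halfspace_Re_gt open_halfspace_Re_lt open_halfspace_Im_gt open_halfspace_Im_lt)
  have mS: "norm (eterm c n z) \<le> m n" if "z \<in> S" for n z
  proof (rule m(2))
    have "norm z \<le> \<bar>Re z\<bar> + \<bar>Im z\<bar>" by (rule cmod_le)
    thus "norm z \<le> \<bar>\<gamma> - 1\<bar> + \<bar>b'\<bar> + \<tau>" using that by (auto simp: S_def)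
  qed (use that in \<open>auto simp: S_def\<close>)
  have ul: "uniform_limit S (\<lambda>N z. \<Sum>n<N. eterm c n z) (\<lambda>z. \<Sum>n. eterm c n z) sequentially"
    by (rule Weierstrass_m_test[OF mS m(1)])
  show thesis
  proof (rule that[OF S r(1) m(1) mS _ _ ul])
    fix x assume x: "x \<in> {\<gamma><..<b}"
    show "cball (complex_of_real x) r \<subseteq> S"
    proof
      fix z assume z: "z \<in> cball (complex_of_real x) r"
      have "\<bar>Re z - x\<bar> \<le> r" "\<bar>Im z\<bar> \<le> r"
        using abs_Re_le_cmod[of "z - of_real x"] abs_Im_le_cmod[of "z - of_real x"] z
        by (auto simp: dist_norm norm_minus_commute)
      thus "z \<in> S" using x r by (auto simp: S_def abs_le_iff)
    qed
  next
    show "(\<lambda>z. \<Sum>n. eterm c n z) holomorphic_on S"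
    proof (rule holomorphic_uniform_sequence[OF S])
      show "(\<lambda>z. \<Sum>n<N. eterm c n z) holomorphic_on S" for N
        by (intro holomorphic_on_sum eterm_holomorphic)
      fix z assume "z \<in> S"
      then obtain d where d: "d > 0" "cball z d \<subseteq> S" using S open_contains_cball by blast
      thus "\<exists>d>0. cball z d \<subseteq> S \<and> uniform_limit (cball z d) (\<lambda>N z. \<Sum>n<N. eterm c n z) (\<lambda>z. \<Sum>n. eterm c n z) sequentially"
        using uniform_limit_on_subset[OF ul] by blast
    qed
  qed auto
qed

lemma eterm_recenter:
  obtains B where "\<And>z. eterm c n z = (\<Sum>k<mu n. B k * ((z - x) ^ k * exp (lam n * (z - x))))"
proof -
  obtain p where p: "\<And>z. (\<Sum>k<mu n. c n k * z ^ k) = (\<Sum>k<mu n. p k * (z - x) ^ k)"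
    using poly_recenter[where c = "c n" and m = "mu n" and x = x] by blast
  show thesis
  proof (rule that[of "\<lambda>k. p k * exp (lam n * x)"])
    fix z
    have "exp (lam n * z) = exp (lam n * x) * exp (lam n * (z - x))"
      by (simp add: exp_add[symmetric] algebra_simps)
    hence "eterm c n z = (\<Sum>k<mu n. p k * (z - x) ^ k) * (exp (lam n * x) * exp (lam n * (z - x)))"
      by (simp only: eterm_def p)
    thus "eterm c n z = (\<Sum>k<mu n. p k * exp (lam n * x) * ((z - x) ^ k * exp (lam n * (z - x))))"
      by (simp add: sum_distrib_right sum_distrib_left mult_ac)
  qed
qed

text \<open>By the operator formula only derivatives of \<open>FF\<close> at \<open>lam n\<close> of
  order below \<open>mu n\<close> occur, and these vanish.\<close>

lemma F_op_eterm: "(\<lambda>j. Fc j * (deriv ^^ j) (eterm c n) x) sums 0"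
proof -
  obtain B where B: "\<And>z. eterm c n z = (\<Sum>k<mu n. B k * ((z - x) ^ k * exp (lam n * (z - x))))"
    using eterm_recenter[of c n x] by blast
  have "(\<lambda>j. tc FF j * (deriv ^^ j) (\<lambda>z. \<Sum>k<mu n. B k * ((z - x) ^ k * exp (lam n * (z - x)))) x) sums
           (\<Sum>k<mu n. B k * (deriv ^^ k) FF (lam n))"
    by (rule op_exp_poly_sum[OF FF_holomorphic])
  moreover have "(\<Sum>k<mu n. B k * (deriv ^^ k) FF (lam n)) = 0"
    using zprod_vanishes[of n UNIV] by (intro sum.neutral) (auto simp: F_fun_eq_zprod vanishes_def)
  moreover have "eterm c n = (\<lambda>z. \<Sum>k<mu n. B k * ((z - x) ^ k * exp (lam n * (z - x))))"
    using B by blast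
  ultimately show ?thesis by (simp only: F_coef_eq_tc)
qed

lemma F_summable:
  assumes "r > 0"
  shows "summable (\<lambda>j. norm (Fc j) * fact j / r ^ j)"
  by (rule summable_comparison_test'[OF G_fact_summable[OF assms]])
     (use assms F_coef_le in \<open>auto intro!: divide_right_mono mult_right_mono\<close>)

text \<open>The remainder after N terms is bounded on the disc by a tail of \<open>m\<close>, so
  \<open>op_bound\<close> controls the error. The coefficients are left general: \<open>Fc\<close>
  shows that the sum is annihilated, and \<open>Psi (Suc j) u\<close> computes its
  transform.\<close>

lemma op_eterm_limit:
  fixes a :: "nat \<Rightarrow> complex"
  assumes "open S" "r > 0" "summable m" and mS: "\<And>n z. z \<in> S \<Longrightarrow> norm (eterm c n z) \<le> m n"
    and xS: "cball x r \<subseteq> S"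
    and hol: "(\<lambda>z. \<Sum>n. eterm c n z) holomorphic_on S"
    and a: "summable (\<lambda>j. norm (a j) * fact j / r ^ j)"
    and fin: "\<And>n. (\<lambda>j. a j * (deriv ^^ j) (eterm c n) x) sums l n"
  shows "summable (\<lambda>j. a j * (deriv ^^ j) (\<lambda>z. \<Sum>n. eterm c n z) x)"
    and "norm ((\<Sum>j. a j * (deriv ^^ j) (\<lambda>z. \<Sum>n. eterm c n z) x) - (\<Sum>n<N. l n))
      \<le> (\<Sum>n. m (n + N)) * (\<Sum>j. norm (a j) * fact j / r ^ j)"
proof -
  define H where "H = (\<lambda>z. \<Sum>n. eterm c n z)"
  have x: "x \<in> S" using xS assms(2) by auto
  have m0: "m n \<ge> 0" for n using order_trans[OF norm_ge_zero mS[OF x]] by blast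
  have sm: "summable (\<lambda>n. eterm c n z)" if "z \<in> S" for z
    by (rule summable_comparison_test'[OF assms(3)]) (use mS that in auto)
  have tail: "norm (H z - (\<Sum>n<N. eterm c n z)) \<le> (\<Sum>n. m (n + N))" if z: "z \<in> S" for z N
  proof -
    have s1: "summable (\<lambda>n. m (n + N))" using assms(3) by (rule summable_ignore_initial_segment)
    have s2: "summable (\<lambda>n. norm (eterm c (n + N) z))"
      by (rule summable_comparison_test'[OF s1]) (use mS z in auto)
    have "H z - (\<Sum>n<N. eterm c n z) = (\<Sum>n. eterm c (n + N) z)"
      unfolding H_def using suminf_split_initial_segment[OF sm[OF z], of N] by simp
    also have "norm \<dots> \<le> (\<Sum>n. norm (eterm c (n + N) z))" by (rule summable_norm[OF s2])
    also have "\<dots> \<le> (\<Sum>n. m (n + N))" by (rule suminf_le[OF _ s2 s1]) (use mS z in auto)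
    finally show ?thesis .
  qed
  define HN where "HN = (\<lambda>N z. H z - (\<Sum>n<N. eterm c n z))"
  have holN: "HN N holomorphic_on S" for N
    unfolding HN_def using hol by (intro holomorphic_intros eterm_holomorphic) (auto simp: H_def)
  have tailN: "norm (HN N z) \<le> (\<Sum>n. m (n + N))" if "z \<in> cball x r" for z N
    using tail[of z N] that xS by (auto simp: HN_def)
  note bd = op_bound[OF holN assms(1) xS assms(2) tailN a]
  have dN: "(deriv ^^ j) (HN N) x = (deriv ^^ j) H x - (\<Sum>n<N. (deriv ^^ j) (eterm c n) x)" for N j
  proof -
    have "(deriv ^^ j) (HN N) x = (deriv ^^ j) H x - (deriv ^^ j) (\<lambda>z. \<Sum>n<N. eterm c n z) x"
      unfolding HN_def
      by (rule higher_deriv_diff[of _ S]) (use hol x assms(1) in \<open>auto simp: H_def intro!: holomorphic_intros eterm_holomorphic\<close>)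
    thus ?thesis
      using higher_deriv_sum[of "{..<N}" "eterm c" S x j] x assms(1) by (simp add: eterm_holomorphic)
  qed
  show sH: "summable (\<lambda>j. a j * (deriv ^^ j) (\<lambda>z. \<Sum>n. eterm c n z) x)"
    using summable_norm_cancel[OF bd(2)[of 0]] by (simp add: dN H_def)
  have "(\<lambda>j. a j * (deriv ^^ j) H x - (\<Sum>n<N. a j * (deriv ^^ j) (eterm c n) x)) sums
          ((\<Sum>j. a j * (deriv ^^ j) H x) - (\<Sum>n<N. l n))"
    by (intro sums_diff sums_sum fin) (use sH in \<open>simp add: H_def summable_sums\<close>)
  hence "(\<lambda>j. a j * (deriv ^^ j) (HN N) x) sums ((\<Sum>j. a j * (deriv ^^ j) H x) - (\<Sum>n<N. l n))"
    by (simp add: dN right_diff_distrib sum_distrib_left)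
  thus "norm ((\<Sum>j. a j * (deriv ^^ j) (\<lambda>z. \<Sum>n. eterm c n z) x) - (\<Sum>n<N. l n))
      \<le> (\<Sum>n. m (n + N)) * (\<Sum>j. norm (a j) * fact j / r ^ j)"
    using bd(3)[of N] by (simp add: sums_iff H_def)
qed

lemma W_subset_V:
  assumes "\<gamma> < \<beta>"
  shows "W_set lam mu \<gamma> \<beta> \<subseteq> V_set lam mu \<gamma> \<beta>"
proof
  fix f assume "f \<in> W_set lam mu \<gamma> \<beta>"
  then obtain c where c: "\<And>x. x \<in> {\<gamma><..<\<beta>} \<Longrightarrow> (\<lambda>n. eterm c n (of_real x)) sums f x"
    unfolding W_set_iff by blast
  have conv: "summable (\<lambda>n. eterm c n (of_real x))" if "x \<in> {\<gamma><..<\<beta>}" for x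
    using c[OF that] by (rule sums_summable)
  define H where "H = (\<lambda>z. \<Sum>n. eterm c n z)"
  have fH: "f x = H (of_real x)" if "x \<in> {\<gamma><..<\<beta>}" for x
    using c[OF that] by (simp add: H_def sums_iff)
  have V: "f \<in> class_C \<gamma> \<beta> G"
    unfolding class_C_def smooth_on_real_def
  proof (intro CollectI conjI allI impI ballI)
    fix k x assume x: "x \<in> {\<gamma><..<\<beta>}"
    obtain S r m where S: "open S" "r > 0"
      "\<And>x'. x' \<in> {\<gamma><..<(x+\<beta>)/2} \<Longrightarrow> cball (complex_of_real x') r \<subseteq> S" "H holomorphic_on S"
      by (rule W_local[OF assms conv, of "(x+\<beta>)/2"]) (use x in \<open>auto simp: H_def\<close>)
    have "(vderivs k f has_vector_derivative (deriv ^^ Suc k) H (of_real x)) (at x)"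
    proof (rule vderivs_holomorphic(2)[OF S(4) S(1) open_greaterThanLessThan[of \<gamma> "(x+\<beta>)/2"]])
      show "complex_of_real x' \<in> S" if "x' \<in> {\<gamma><..<(x+\<beta>)/2}" for x' using S(3)[OF that] S(2) by auto
      show "f x' = H (of_real x')" if "x' \<in> {\<gamma><..<(x+\<beta>)/2}" for x' using that x by (intro fH) auto
    qed (use x in auto)
    thus "vderivs k f differentiable at x" by (rule differentiableI_vector)
  next
    fix \<epsilon> :: real assume e: "\<epsilon> > 0"
    obtain S r m where S: "open S" "r > 0" "summable m"
      "\<And>x'. x' \<in> {\<gamma><..<\<beta>-\<epsilon>} \<Longrightarrow> cball (complex_of_real x') r \<subseteq> S" "H holomorphic_on S"
      "\<And>n z. z \<in> S \<Longrightarrow> norm (eterm c n z) \<le> m n"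
      by (rule W_local[OF assms conv, of "\<beta>-\<epsilon>"]) (use e in \<open>auto simp: H_def\<close>)
    show "uniformly_convergent_on {\<gamma>+\<epsilon><..<\<beta>-\<epsilon>} (\<lambda>N x. \<Sum>n<N. G n * norm (vderivs n f x))"
    proof (rule Weierstrass_m_test'[where M = "\<lambda>j. suminf m * (G j * fact j / r ^ j)"])
      show "summable (\<lambda>j. suminf m * (G j * fact j / r ^ j))"
        by (intro summable_mult G_fact_summable S)
      fix j x assume "x \<in> {\<gamma>+\<epsilon><..<\<beta>-\<epsilon>}"
      hence x: "x \<in> {\<gamma><..<\<beta>-\<epsilon>}" using e by auto
      have v: "vderivs j f x = (deriv ^^ j) H (of_real x)"
      proof (rule vderivs_holomorphic(1)[OF S(5) S(1) open_greaterThanLessThan[of \<gamma> "\<beta>-\<epsilon>"]])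
        show "complex_of_real x' \<in> S" if "x' \<in> {\<gamma><..<\<beta>-\<epsilon>}" for x' using S(4)[OF that] S(2) by auto
        show "f x' = H (of_real x')" if "x' \<in> {\<gamma><..<\<beta>-\<epsilon>}" for x' using that e by (intro fH) auto
      qed (use x in auto)
      have Hb: "norm (H z) \<le> suminf m" if "z \<in> cball (of_real x) r" for z
      proof -
        have z: "z \<in> S" using S(4)[OF x] that by auto
        have s: "summable (\<lambda>n. norm (eterm c n z))"
          by (rule summable_comparison_test'[OF S(3)]) (use S(6) z in auto)
        have "norm (H z) \<le> (\<Sum>n. norm (eterm c n z))" unfolding H_def by (rule summable_norm[OF s])
        also have "\<dots> \<le> suminf m" by (rule suminf_le[OF _ s S(3)]) (use S(6) z in auto)
        finally show ?thesis .
      qed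
      have "norm (vderivs j f x) \<le> fact j * suminf m / r ^ j"
        unfolding v using op_bound(1)[OF S(5) S(1) S(4)[OF x] S(2) Hb F_summable[OF S(2)]] by blast
      from mult_left_mono[OF this G_nonneg[of j]]
      show "norm (G j * norm (vderivs j f x)) \<le> suminf m * (G j * fact j / r ^ j)"
        using G_nonneg by (simp add: mult_ac)
    qed
  qed
  have "(\<lambda>j. Fc j * vderivs j f x) sums 0" if x: "x \<in> {\<gamma><..<\<beta>}" for x
  proof -
    define b where "b = (x + \<beta>) / 2"
    have b: "b < \<beta>" "x < b" using x by (auto simp: b_def)
    obtain S r m where S: "open S" "r > 0" "summable m"
      "\<And>x'. x' \<in> {\<gamma><..<b} \<Longrightarrow> cball (complex_of_real x') r \<subseteq> S" "H holomorphic_on S"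
      "\<And>n z. z \<in> S \<Longrightarrow> norm (eterm c n z) \<le> m n"
      by (rule W_local[OF assms conv b(1)]) (use x in \<open>auto simp: H_def\<close>)
    have xb: "x \<in> {\<gamma><..<b}" using x b by auto
    have v: "vderivs j f x = (deriv ^^ j) H (of_real x)" for j
    proof (rule vderivs_holomorphic(1)[OF S(5) S(1) open_greaterThanLessThan[of \<gamma> b]])
      show "complex_of_real x' \<in> S" if "x' \<in> {\<gamma><..<b}" for x' using S(4)[OF that] S(2) by auto
      show "f x' = H (of_real x')" if "x' \<in> {\<gamma><..<b}" for x' using that b by (intro fH) auto
    qed (use xb in auto)
    note lim = op_eterm_limit[OF S(1,2,3) S(6) S(4)[OF xb] S(5)[unfolded H_def] F_summable[OF S(2)] F_op_eterm]
    define C where "C = (\<Sum>j. norm (Fc j) * fact j / r ^ j)"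
    have "norm (\<Sum>j. Fc j * (deriv ^^ j) H (of_real x)) \<le> (\<Sum>n. m (n + N)) * C" for N
      using lim(2)[where N = N] by (simp add: H_def C_def)
    moreover have "(\<lambda>N. (\<Sum>n. m (n + N)) * C) \<longlonglongrightarrow> 0 * C"
      by (intro tendsto_intros suminf_exist_split2 S)
    ultimately have "norm (\<Sum>j. Fc j * (deriv ^^ j) H (of_real x)) \<le> 0 * C"
      by (intro LIMSEQ_le_const) auto
    thus ?thesis using lim(1) by (simp add: v sums_iff H_def)
  qed
  with V show "f \<in> V_set lam mu \<gamma> \<beta>" by (auto simp: V_set_def)
qed

end

subsection \<open>The transform \<open>\<Phi>\<close>\<close>

text \<open>\<open>class_C\<close> provides uniform convergence of a majorant series rather than
  numerical majorants, so the Cauchy criterion is transferred in place of an M-test. The index shift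
  fits the differentiated series, whose j-th term contains the derivative of order
  \<open>Suc j\<close>.\<close>

lemma uniformly_convergent_dominated_Suc:
  fixes a :: "nat \<Rightarrow> 'a \<Rightarrow> real" and b :: "nat \<Rightarrow> 'a \<Rightarrow> 'b :: banach"
  assumes conv: "uniformly_convergent_on S (\<lambda>N x. \<Sum>n<N. a n x)"
    and le: "\<And>n x. x \<in> S \<Longrightarrow> norm (b n x) \<le> C * a (Suc n) x" and C: "C > 0"
  shows "uniformly_convergent_on S (\<lambda>N x. \<Sum>n<N. b n x)"
proof (rule Cauchy_uniformly_convergent, rule uniformly_Cauchy_onI')
  fix e :: real assume e: "e > 0"
  have "uniformly_Cauchy_on S (\<lambda>N x. \<Sum>n<N. a n x)"
    using conv by (simp add: uniformly_convergent_eq_Cauchy)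
  then obtain M where M: "\<And>x m n. x \<in> S \<Longrightarrow> m \<ge> M \<Longrightarrow> n \<ge> M \<Longrightarrow> dist (\<Sum>k<m. a k x) (\<Sum>k<n. a k x) < e / C"
    using e C unfolding uniformly_Cauchy_on_def by (meson divide_pos_pos)
  show "\<exists>M. \<forall>x\<in>S. \<forall>m\<ge>M. \<forall>n>m. dist (\<Sum>k<m. b k x) (\<Sum>k<n. b k x) < e"
  proof (intro exI[of _ M] ballI allI impI)
    fix x m n assume x: "x \<in> S" and mn: "M \<le> m" "m < n"
    have split: "(\<Sum>k<n. g k) = (\<Sum>k<m. g k) + (\<Sum>k=m..<n. g k)" for g :: "nat \<Rightarrow> 'c::comm_monoid_add"
      using sum.atLeastLessThan_concat[of 0 m n g] mn by (simp add: atLeast0LessThan)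
    have "dist (\<Sum>k<m. b k x) (\<Sum>k<n. b k x) = norm (\<Sum>k=m..<n. b k x)"
      by (simp add: dist_norm split)
    also have "\<dots> \<le> (\<Sum>k=m..<n. C * a (Suc k) x)" by (rule sum_norm_le) (use le x in auto)
    also have "\<dots> = C * (\<Sum>k=m..<n. a (Suc k) x)" by (simp add: sum_distrib_left)
    also have "(\<Sum>k=m..<n. a (Suc k) x) = (\<Sum>k=Suc m..<Suc n. a k x)"
      by (rule sum.shift_bounds_Suc_ivl[symmetric])
    also have "\<dots> = (\<Sum>k<Suc n. a k x) - (\<Sum>k<Suc m. a k x)"
      using sum.atLeastLessThan_concat[of 0 "Suc m" "Suc n" "\<lambda>k. a k x"] mn by (simp add: atLeast0LessThan)
    also have "\<dots> \<le> dist (\<Sum>k<Suc m. a k x) (\<Sum>k<Suc n. a k x)" by (simp add: dist_real_def)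
    also have "C * dist (\<Sum>k<Suc m. a k x) (\<Sum>k<Suc n. a k x) < e"
      using M[OF x, of "Suc m" "Suc n"] mn C by (simp add: field_simps)
    finally show "dist (\<Sum>k<m. b k x) (\<Sum>k<n. b k x) < e" using C by simp
  qed
qed

lemma has_vector_derivative_series:
  fixes f :: "nat \<Rightarrow> real \<Rightarrow> 'b::banach"
  assumes "convex S" and f': "\<And>n x. x \<in> S \<Longrightarrow> (f n has_vector_derivative f' n x) (at x within S)"
    and conv: "uniformly_convergent_on S (\<lambda>n x. \<Sum>i<n. f' i x)"
    and x0: "x0 \<in> S" "summable (\<lambda>n. f n x0)" and x: "x \<in> interior S"
  shows "((\<lambda>x. \<Sum>n. f n x) has_vector_derivative (\<Sum>n. f' n x)) (at x)"
proof -
  have lim: "uniform_limit S (\<lambda>n x. \<Sum>i<n. f' i x) (\<lambda>x. \<Sum>n. f' n x) sequentially"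
    using conv by (simp add: uniformly_convergent_uniform_limit_iff suminf_eq_lim)
  obtain l where l: "(\<lambda>n. f n x0) sums l" using x0(2) by (auto simp: summable_def)
  have "\<exists>g. \<forall>x\<in>S. (\<lambda>n. f n x) sums (g x) \<and> (g has_derivative (\<lambda>h. h *\<^sub>R (\<Sum>n. f' n x))) (at x within S)"
  proof (rule has_derivative_series[OF assms(1), where f = f and x = x0 and l = l
        and f' = "\<lambda>n x h. h *\<^sub>R f' n x" and g' = "\<lambda>x h. h *\<^sub>R (\<Sum>n. f' n x)"])
    show "(f n has_derivative (\<lambda>h. h *\<^sub>R f' n x)) (at x within S)" if "x \<in> S" for n x
      using f'[OF that] by (simp add: has_vector_derivative_def)
    fix e :: real assume "e > 0"
    then have "\<forall>\<^sub>F n in sequentially. \<forall>x\<in>S. dist (\<Sum>i<n. f' i x) (\<Sum>n. f' n x) < e"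
      using lim by (simp add: uniform_limit_iff)
    thus "\<forall>\<^sub>F n in sequentially. \<forall>x\<in>S. \<forall>h. norm ((\<Sum>i<n. h *\<^sub>R f' i x) - h *\<^sub>R (\<Sum>n. f' n x)) \<le> e * norm h"
    proof eventually_elim
      case (elim n)
      show ?case
      proof (intro ballI allI)
        fix x and h :: real assume "x \<in> S"
        have "norm ((\<Sum>i<n. h *\<^sub>R f' i x) - h *\<^sub>R (\<Sum>n. f' n x)) = \<bar>h\<bar> * dist (\<Sum>i<n. f' i x) (\<Sum>n. f' n x)"
          by (simp add: dist_norm scaleR_sum_right[symmetric] scaleR_diff_right[symmetric])
        also have "\<dots> \<le> \<bar>h\<bar> * e" using elim \<open>x \<in> S\<close> by (intro mult_left_mono) (auto intro: less_imp_le)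
        finally show "norm ((\<Sum>i<n. h *\<^sub>R f' i x) - h *\<^sub>R (\<Sum>n. f' n x)) \<le> e * norm h" by (simp add: mult.commute)
      qed
    qed
  qed (use x0 l in auto)
  then obtain g where g0: "\<forall>x\<in>S. (\<lambda>n. f n x) sums (g x) \<and>
      (g has_derivative (\<lambda>h. h *\<^sub>R (\<Sum>n. f' n x))) (at x within S)" ..
  note g = conjunct1[OF g0[unfolded ball_conj_distrib]] conjunct2[OF g0[unfolded ball_conj_distrib]]
  have xS: "x \<in> S" using x interior_subset by blast
  have "(g has_vector_derivative (\<Sum>n. f' n x)) (at x)"
    unfolding has_vector_derivative_def using bspec[OF g(2) xS] at_within_interior[OF x] by simp
  thus ?thesis
  proof (rule has_vector_derivative_transform_within_open[OF _ open_interior x])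
    show "g y = (\<Sum>n. f n y)" if "y \<in> interior S" for y
      using bspec[OF g(1), of y] that interior_subset[of S] by (auto simp: sums_iff)
  qed
qed

lemma vector_mean_value_bound:
  fixes w :: "real \<Rightarrow> complex"
  assumes "\<And>t. t \<in> closed_segment x y \<Longrightarrow> (w has_vector_derivative w' t) (at t)"
    and "\<And>t. t \<in> closed_segment x y \<Longrightarrow> norm (w' t) \<le> B"
  shows "norm (w x - w y) \<le> B * \<bar>x - y\<bar>"
proof -
  have "norm (w x - w y) \<le> B * norm (x - y)"
  proof (rule differentiable_bound[of "closed_segment x y" w "\<lambda>t h. h *\<^sub>R w' t"])
    show "(w has_derivative (\<lambda>h. h *\<^sub>R w' t)) (at t within closed_segment x y)" if "t \<in> closed_segment x y" for t
      using assms(1)[OF that] has_vector_derivative_at_within has_vector_derivative_def by blast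
    show "onorm (\<lambda>h. h *\<^sub>R w' t) \<le> B" if "t \<in> closed_segment x y" for t
    proof (rule onorm_le)
      show "norm (h *\<^sub>R w' t) \<le> B * norm h" for h
        using mult_right_mono[OF assms(2)[OF that], of "norm h"] by (simp add: mult.commute)
    qed
  qed auto
  thus ?thesis by simp
qed

context sector_seq
begin

text \<open>\<open>Psi j\<close> is the \<open>j\<close>-fold backward shift of the power series of \<open>FF\<close>, so that \<open>PhiD\<close> below, applied to
  the derivatives of \<open>f\<close> at \<open>x\<close>, is \<open>((F(u) - F(D)) / (u - D)) f(x)\<close>.\<close>

definition Psi :: "nat \<Rightarrow> complex \<Rightarrow> complex" where
  "Psi j u = (\<Sum>m. Fc (j + m) * u ^ m)"

definition KG :: "real \<Rightarrow> real" where
  "KG R = (\<Sum>m. G m * R ^ m)"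

lemma KG_summable: "R \<ge> 0 \<Longrightarrow> summable (\<lambda>m. G m * R ^ m)"
  by (rule G_bound[of 1]) auto

lemma KG_bound:
  assumes "\<epsilon> > 0"
  obtains K where "K > 0" "\<And>R. R \<ge> 0 \<Longrightarrow> KG R \<le> K * exp (\<epsilon> * R)"
  using G_bound[OF assms] unfolding KG_def by metis

lemma KG_mono: "0 \<le> R \<Longrightarrow> R \<le> R' \<Longrightarrow> KG R \<le> KG R'"
  unfolding KG_def by (intro suminf_le KG_summable) (auto intro!: mult_left_mono power_mono G_nonneg)

lemma KG_nonneg: "0 \<le> R \<Longrightarrow> 0 \<le> KG R"
  unfolding KG_def by (intro suminf_nonneg KG_summable) (auto intro!: G_nonneg mult_nonneg_nonneg)

lemma KG_pos: "0 \<le> R \<Longrightarrow> 0 < KG R"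
  using KG_mono[of 0 R] by (simp add: KG_def G_0)

text \<open>Submultiplicativity separates the indices: one factor is \<open>G j\<close>, the weight
  of \<open>class_C\<close>, and the other depends only on m and |u|.\<close>

lemma Psi_term_le: "norm (Fc (j + m) * u ^ m) \<le> G j * (G m * norm u ^ m)"
proof -
  have "norm (Fc (j + m)) \<le> G j * G m" using F_coef_le[of "j + m"] G_submult[of j m] by linarith
  from mult_right_mono[OF this, of "norm u ^ m"] show ?thesis by (simp add: norm_mult norm_power mult_ac)
qed

lemma Psi_summable: "summable (\<lambda>m. Fc (j + m) * u ^ m)"
  by (rule summable_comparison_test'[OF summable_mult[OF KG_summable[of "norm u"]]]) (use Psi_term_le in auto)

lemma Psi_bound: "norm (Psi j u) \<le> G j * KG (norm u)"
proof -
  have s: "summable (\<lambda>m. G j * (G m * norm u ^ m))" by (intro summable_mult KG_summable) auto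
  have sn: "summable (\<lambda>m. norm (Fc (j + m) * u ^ m))"
    by (rule summable_comparison_test'[OF s]) (use Psi_term_le in auto)
  have "norm (Psi j u) \<le> (\<Sum>m. norm (Fc (j + m) * u ^ m))" unfolding Psi_def by (rule summable_norm[OF sn])
  also have "\<dots> \<le> (\<Sum>m. G j * (G m * norm u ^ m))" by (rule suminf_le[OF Psi_term_le sn s])
  also have "\<dots> = G j * KG (norm u)" unfolding KG_def by (rule suminf_mult[OF KG_summable]) auto
  finally show ?thesis .
qed

lemma Psi_Suc_bound: "norm (Psi (Suc j) u) \<le> G j * (G 1 * KG (norm u))"
proof -
  have "norm (Psi (Suc j) u) \<le> G (Suc j) * KG (norm u)" by (rule Psi_bound)
  also have "\<dots> \<le> (G j * G 1) * KG (norm u)"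
    using G_submult[of j 1] by (intro mult_right_mono KG_nonneg) auto
  finally show ?thesis by (simp add: mult_ac)
qed

lemma Psi_rec: "Psi j u = Fc j + u * Psi (Suc j) u"
proof -
  have "Psi j u = Fc j + (\<Sum>m. Fc (j + Suc m) * u ^ Suc m)"
    unfolding Psi_def using suminf_split_head[OF Psi_summable[of j u]] by simp
  also have "(\<Sum>m. Fc (j + Suc m) * u ^ Suc m) = (\<Sum>m. u * (Fc (Suc j + m) * u ^ m))"
    by (intro arg_cong[where f = suminf]) (auto simp: fun_eq_iff)
  also have "\<dots> = u * Psi (Suc j) u" unfolding Psi_def by (rule suminf_mult[OF Psi_summable])
  finally show ?thesis .
qed

lemma Psi_0: "Psi 0 u = FF u"
proof -
  have "(\<lambda>n. (deriv ^^ n) FF 0 / fact n * (u - 0) ^ n) sums FF u"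
    by (rule holomorphic_power_series[of _ _ "norm u + 1"]) (auto intro: FF_holomorphic)
  thus ?thesis by (simp add: Psi_def sums_iff F_coef_def)
qed

lemma Psi_holomorphic: "Psi j holomorphic_on S"
proof -
  have "Psi j holomorphic_on ball 0 R" for R
    by (rule power_series_holomorphic[where a = "\<lambda>m. Fc (j + m)"])
       (use Psi_summable in \<open>auto simp: Psi_def summable_sums\<close>)
  hence "Psi j field_differentiable at z" for z
    using holomorphic_on_imp_differentiable_at[of "Psi j" "ball 0 (norm z + 1)" z] by auto
  thus ?thesis by (simp add: holomorphic_on_def field_differentiable_at_within)
qed

text \<open>It takes a jet \<open>d\<close> instead of a function, so that it serves the real
  derivatives of a smooth \<open>f\<close> as well as the complex derivatives of a residue.\<close>

definition PhiD :: "(nat \<Rightarrow> complex) \<Rightarrow> complex \<Rightarrow> complex" where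
  "PhiD d u = (\<Sum>j. d j * Psi (Suc j) u)"

lemma PhiD_term:
  assumes "norm u \<le> R"
  shows "norm (d j * Psi (Suc j) u) \<le> G j * norm (d j) * (G 1 * KG R)"
proof -
  have "norm (Psi (Suc j) u) \<le> G j * (G 1 * KG R)"
    using Psi_Suc_bound[of j u] mult_left_mono[OF KG_mono[OF _ assms], of "G j * G 1"] G_nonneg
    by (simp add: mult_ac)
  from mult_left_mono[OF this, of "norm (d j)"] show ?thesis by (simp add: norm_mult mult_ac)
qed

lemma PhiD:
  assumes d: "summable (\<lambda>j. G j * norm (d j))"
  shows "summable (\<lambda>j. d j * Psi (Suc j) u)"
    and "norm (PhiD d u) \<le> (\<Sum>j. G j * norm (d j)) * (G 1 * KG (norm u))"
    and "PhiD d holomorphic_on S"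
proof -
  have s: "summable (\<lambda>j. G j * norm (d j) * (G 1 * KG R))" for R by (rule summable_mult2[OF d])
  have sn: "summable (\<lambda>j. norm (d j * Psi (Suc j) u))"
    by (rule summable_comparison_test'[OF s[of "norm u"]]) (use PhiD_term[of u "norm u" d] in auto)
  show "summable (\<lambda>j. d j * Psi (Suc j) u)" using sn by (rule summable_norm_cancel)
  have "norm (PhiD d u) \<le> (\<Sum>j. norm (d j * Psi (Suc j) u))" unfolding PhiD_def by (rule summable_norm[OF sn])
  also have "\<dots> \<le> (\<Sum>j. G j * norm (d j) * (G 1 * KG (norm u)))"
    by (rule suminf_le[OF _ sn s]) (rule PhiD_term, simp)
  also have "\<dots> = (\<Sum>j. G j * norm (d j)) * (G 1 * KG (norm u))" by (rule suminf_mult2[OF d, symmetric])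
  finally show "norm (PhiD d u) \<le> (\<Sum>j. G j * norm (d j)) * (G 1 * KG (norm u))" .
  have "PhiD d holomorphic_on UNIV"
  proof (rule holomorphic_uniform_sequence[OF open_UNIV])
    show "(\<lambda>u. \<Sum>j<N. d j * Psi (Suc j) u) holomorphic_on UNIV" for N
      by (intro holomorphic_intros Psi_holomorphic)
    fix x :: complex
    have "uniform_limit (cball x 1) (\<lambda>N u. \<Sum>j<N. d j * Psi (Suc j) u) (PhiD d) sequentially"
      unfolding PhiD_def
    proof (rule Weierstrass_m_test[OF _ s[of "norm x + 1"]])
      fix j u assume "u \<in> cball x 1"
      hence "norm u \<le> norm x + 1"
        using norm_triangle_sub[of u x] by (auto simp: dist_norm norm_minus_commute)
      thus "norm (d j * Psi (Suc j) u) \<le> G j * norm (d j) * (G 1 * KG (norm x + 1))"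
        by (rule PhiD_term)
    qed
    thus "\<exists>d'>0. cball x d' \<subseteq> UNIV \<and> uniform_limit (cball x d') (\<lambda>N u. \<Sum>j<N. d j * Psi (Suc j) u) (PhiD d) sequentially"
      by (intro exI[of _ 1]) auto
  qed
  thus "PhiD d holomorphic_on S" by (rule holomorphic_on_subset) auto
qed

abbreviation Phi :: "(real \<Rightarrow> complex) \<Rightarrow> complex \<Rightarrow> real \<Rightarrow> complex" where
  "Phi f u x \<equiv> PhiD (\<lambda>j. vderivs j f x) u"

lemma class_C_summable:
  assumes "f \<in> class_C \<gamma> \<beta> G" "x \<in> {\<gamma><..<\<beta>}"
  shows "summable (\<lambda>j. G j * norm (vderivs j f x))"
proof -
  define e where "e = min (x - \<gamma>) (\<beta> - x) / 2"
  have e: "e > 0" "x \<in> {\<gamma>+e<..<\<beta>-e}" using assms(2) by (auto simp: e_def min_def field_simps)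
  have "uniformly_convergent_on {\<gamma>+e<..<\<beta>-e} (\<lambda>N x. \<Sum>n<N. G n * norm (vderivs n f x))"
    using assms(1) e by (auto simp: class_C_def)
  from uniformly_convergent_imp_convergent[OF this e(2)] show ?thesis
    by (simp add: summable_iff_convergent)
qed

lemma class_C_deriv:
  assumes "f \<in> class_C \<gamma> \<beta> G" "x \<in> {\<gamma><..<\<beta>}"
  shows "(vderivs k f has_vector_derivative vderivs (Suc k) f x) (at x)"
  unfolding vderivs_Suc
  by (rule vector_derivative_works[THEN iffD1]) (use assms in \<open>auto simp: class_C_def smooth_on_real_def\<close>)

text \<open>Termwise differentiation gives the sum of f^(j+1) Psi_(j+1). Splitting Psi_(j+1) =
  Fc_(j+1) + u Psi_(j+2), the first part sums to - Fc_0 f because F(D) f = 0, the second to u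
  (\<Phi> - f Psi_1), and Fc_0 + u Psi_1 = F(u).\<close>

lemma Phi_ODE:
  assumes f: "f \<in> V_set lam mu \<gamma> \<beta>" and x: "x \<in> {\<gamma><..<\<beta>}"
  shows "((\<lambda>x. Phi f u x) has_vector_derivative (u * Phi f u x - FF u * f x)) (at x)"
proof -
  have C: "f \<in> class_C \<gamma> \<beta> G" and F0: "(\<lambda>n. Fc n * vderivs n f x) sums 0"
    using f x by (auto simp: V_set_def)
  define e where "e = min (x - \<gamma>) (\<beta> - x) / 2"
  have e: "e > 0" "x \<in> {\<gamma>+e<..<\<beta>-e}" using x by (auto simp: e_def min_def field_simps)
  let ?S = "{\<gamma>+e<..<\<beta>-e}"
  have unif: "uniformly_convergent_on ?S (\<lambda>N x. \<Sum>n<N. G n * norm (vderivs n f x))"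
    using C e by (auto simp: class_C_def)
  note sC = class_C_summable[OF C x]
  have D1: "((\<lambda>x. vderivs j f x * Psi (Suc j) u) has_vector_derivative vderivs (Suc j) f y * Psi (Suc j) u) (at y within ?S)"
    if "y \<in> ?S" for j y
  proof -
    have "(vderivs j f has_vector_derivative vderivs (Suc j) f y) (at y)"
      using that e(1) by (intro class_C_deriv[OF C]) auto
    from has_vector_derivative_mult_left[OF this] show ?thesis
      by (rule has_vector_derivative_at_within)
  qed
  have D2: "uniformly_convergent_on ?S (\<lambda>n x. \<Sum>i<n. vderivs (Suc i) f x * Psi (Suc i) u)"
  proof (rule uniformly_convergent_dominated_Suc[OF unif, where C = "KG (norm u)"])
    show "norm (vderivs (Suc n) f x * Psi (Suc n) u) \<le> KG (norm u) * (G (Suc n) * norm (vderivs (Suc n) f x))" for n x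
      using mult_right_mono[OF Psi_bound[of "Suc n" u], of "norm (vderivs (Suc n) f x)"]
      by (simp add: norm_mult mult_ac)
  qed (simp add: KG_pos)
  have D: "((\<lambda>x. \<Sum>j. vderivs j f x * Psi (Suc j) u) has_vector_derivative
      (\<Sum>j. vderivs (Suc j) f x * Psi (Suc j) u)) (at x)"
    by (rule has_vector_derivative_series[of ?S "\<lambda>j x. vderivs j f x * Psi (Suc j) u"
        "\<lambda>j x. vderivs (Suc j) f x * Psi (Suc j) u" x x, OF _ D1 D2 e(2) PhiD(1)[OF sC]])
       (use e in auto)
  define p where "p = (\<lambda>j. vderivs j f x * Psi (Suc j) u)"
  have sp: "p sums Phi f u x" unfolding p_def PhiD_def by (rule summable_sums[OF PhiD(1)[OF sC]])
  have "(\<lambda>j. Fc (Suc j) * vderivs (Suc j) f x) sums (0 - Fc 0 * f x)"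
    using F0 sums_Suc_iff[of "\<lambda>j. Fc j * vderivs j f x" "0 - Fc 0 * f x"] by simp
  moreover have "(\<lambda>j. u * p (Suc j)) sums (u * (Phi f u x - p 0))"
    using sp sums_Suc_iff[of p "Phi f u x - p 0"] by (intro sums_mult) simp
  ultimately have "(\<lambda>j. Fc (Suc j) * vderivs (Suc j) f x + u * p (Suc j)) sums
      ((0 - Fc 0 * f x) + u * (Phi f u x - p 0))"
    by (rule sums_add)
  moreover have "Fc (Suc j) * vderivs (Suc j) f x + u * p (Suc j) = vderivs (Suc j) f x * Psi (Suc j) u" for j
    by (subst Psi_rec[of "Suc j"]) (simp add: p_def algebra_simps)
  moreover have "(0 - Fc 0 * f x) + u * (Phi f u x - p 0) = u * Phi f u x - FF u * f x"
    using Psi_rec[of 0 u] by (simp add: p_def Psi_0 algebra_simps)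
  ultimately have "(\<Sum>j. vderivs (Suc j) f x * Psi (Suc j) u) = u * Phi f u x - FF u * f x"
    by (simp add: sums_iff)
  thus ?thesis using D by (simp add: PhiD_def)
qed

text \<open>Multiplication by exp (u (p - t)) cancels the homogeneous term of the differential
  equation, so the derivative is - FF(u) (f - g) exp (u (p - t)) and carries the factor
  \<open>FF u\<close>. The pair serves the uniqueness argument; a single solution is the case of
  \<open>g\<close> zero.\<close>

lemma Phi_difference_bound:
  assumes f: "f \<in> V_set lam mu \<gamma> \<beta>" and g: "g \<in> V_set lam mu \<gamma> \<beta>" and xy: "x \<in> {\<gamma><..<\<beta>}" "y \<in> {\<gamma><..<\<beta>}"
    and B: "\<And>t. t \<in> closed_segment x y \<Longrightarrow> norm (f t - g t) \<le> B"
    and E: "\<And>t. t \<in> closed_segment x y \<Longrightarrow> norm (exp (u * of_real (p - t))) \<le> E"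
  shows "norm ((Phi f u x - Phi g u x) * exp (u * of_real (p - x)) - (Phi f u y - Phi g u y) * exp (u * of_real (p - y)))
    \<le> (norm (FF u) * B * E) * \<bar>x - y\<bar>"
proof (rule vector_mean_value_bound[where w = "\<lambda>t. (Phi f u t - Phi g u t) * exp (u * of_real (p - t))"
      and x = x and y = y and w' = "\<lambda>t. - (FF u * (f t - g t)) * exp (u * of_real (p - t))"])
  fix t assume t: "t \<in> closed_segment x y"
  have "closed_segment x y \<subseteq> {\<gamma><..<\<beta>}" using xy by (auto simp: closed_segment_eq_real_ivl)
  hence t': "t \<in> {\<gamma><..<\<beta>}" using t by blast
  have E': "((\<lambda>t. exp (u * of_real (p - t))) has_vector_derivative (- u * exp (u * of_real (p - t)))) (at t)"
  proof -
    have "((\<lambda>z. exp (u * (of_real p - z))) has_field_derivative (- u * exp (u * (of_real p - of_real t)))) (at (of_real t))"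
      by (auto intro!: derivative_eq_intros)
    from has_vector_derivative_real_field[OF this] show ?thesis by simp
  qed
  note d = has_vector_derivative_mult[OF has_vector_derivative_diff[OF Phi_ODE[OF f t'] Phi_ODE[OF g t']] E']
  show "((\<lambda>t. (Phi f u t - Phi g u t) * exp (u * of_real (p - t))) has_vector_derivative
       (- (FF u * (f t - g t)) * exp (u * of_real (p - t)))) (at t)"
    by (rule has_vector_derivative_eq_rhs[OF d]) (simp add: algebra_simps)
  show "norm (- (FF u * (f t - g t)) * exp (u * of_real (p - t))) \<le> norm (FF u) * B * E"
    unfolding norm_mult norm_minus_cancel using B[OF t] E[OF t]
    by (intro mult_mono mult_nonneg_nonneg order_trans[OF norm_ge_zero B[OF t]]) auto
qed

lemma vderivs_zero: "vderivs k (\<lambda>x. 0) = (\<lambda>x. 0)"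
proof (induction k)
  case (Suc k)
  have "vderivs (Suc k) (\<lambda>x. 0) x = 0" for x unfolding vderivs_Suc Suc by simp
  thus ?case by (rule ext)
qed simp

lemma V_set_zero: "(\<lambda>x. 0) \<in> V_set lam mu \<gamma> \<beta>"
  by (auto simp: V_set_def class_C_def smooth_on_real_def uniformly_convergent_on_const vderivs_zero)

lemma Phi_zero: "Phi (\<lambda>x. 0) u x = 0"
  by (simp add: PhiD_def vderivs_zero)

lemma V_set_continuous: "f \<in> V_set lam mu \<gamma> \<beta> \<Longrightarrow> continuous_on {\<gamma><..<\<beta>} f"
  using has_vector_derivative_continuous[OF class_C_deriv[of f \<gamma> \<beta> _ 0]]
  by (auto simp: V_set_def continuous_on_eq_continuous_at)

lemma segment_bound:
  fixes \<gamma> \<beta> x y :: real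
  assumes "continuous_on {\<gamma><..<\<beta>} h" "x \<in> {\<gamma><..<\<beta>}" "y \<in> {\<gamma><..<\<beta>}"
  obtains B where "B > 0" "\<And>t. t \<in> closed_segment x y \<Longrightarrow> norm (h t :: complex) \<le> B"
proof -
  have "closed_segment x y \<subseteq> {\<gamma><..<\<beta>}" using assms(2,3) by (auto simp: closed_segment_eq_real_ivl)
  hence "compact (h ` closed_segment x y)"
    using assms(1) by (intro compact_continuous_image) (auto intro: continuous_on_subset)
  then obtain B where "B > 0" "\<forall>z\<in>h ` closed_segment x y. norm z \<le> B"
    using compact_imp_bounded bounded_pos by blast
  thus thesis using that by blast
qed

text \<open>By the mean value inequality, \<open>exp (-u x) * Phi f u x\<close> does not depend on \<open>x\<close> modulo \<open>FF\<close>.\<close>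

lemma Phi_transport_vanishes:
  assumes f: "f \<in> V_set lam mu \<gamma> \<beta>" and xy: "x \<in> {\<gamma><..<\<beta>}" "y \<in> {\<gamma><..<\<beta>}"
  shows "vanishes (mu n) (\<lambda>u. Phi f u x - exp (u * of_real (x - y)) * Phi f u y) (lam n)"
proof -
  obtain B where B: "B > 0" "\<And>t. t \<in> closed_segment x y \<Longrightarrow> norm (f t) \<le> B"
    using segment_bound[OF V_set_continuous[OF f] xy] by blast
  define E where "E = exp ((norm (lam n) + 1) * \<bar>x - y\<bar>)"
  have sC: "summable (\<lambda>j. G j * norm (vderivs j f t))" if "t \<in> {\<gamma><..<\<beta>}" for t
    using f that by (intro class_C_summable) (auto simp: V_set_def)
  show ?thesis
  proof (rule vanishes_dominated[of _ UNIV FF])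
    show "(\<lambda>u. Phi f u x - exp (u * of_real (x - y)) * Phi f u y) holomorphic_on UNIV"
      by (intro holomorphic_intros PhiD(3) sC xy)
    show "vanishes (mu n) FF (lam n)" unfolding F_fun_eq_zprod by (rule zprod_vanishes) auto
    have "norm (Phi f u x - exp (u * of_real (x - y)) * Phi f u y) \<le> (B * E * \<bar>x - y\<bar>) * norm (FF u)"
      if u: "norm (u - lam n) < 1" for u
    proof -
      have un: "norm u \<le> norm (lam n) + 1" using u norm_triangle_sub[of u "lam n"] by simp
      have "norm ((Phi f u x - Phi (\<lambda>x. 0) u x) * exp (u * of_real (x - x)) - (Phi f u y - Phi (\<lambda>x. 0) u y) * exp (u * of_real (x - y)))
        \<le> (norm (FF u) * B * E) * \<bar>x - y\<bar>"
      proof (rule Phi_difference_bound[OF f V_set_zero xy])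
        fix t assume t: "t \<in> closed_segment x y"
        show "norm (f t - 0) \<le> B" using B(2)[OF t] by simp
        have "\<bar>x - t\<bar> \<le> \<bar>x - y\<bar>" using t by (auto simp: closed_segment_eq_real_ivl split: if_splits)
        hence "norm u * \<bar>x - t\<bar> \<le> (norm (lam n) + 1) * \<bar>x - y\<bar>" using un by (intro mult_mono) auto
        moreover have "norm (exp (u * of_real (x - t))) \<le> exp (norm (u * of_real (x - t)))" by (rule norm_exp)
        moreover have "norm (u * of_real (x - t)) = norm u * \<bar>x - t\<bar>" unfolding norm_mult norm_of_real ..
        ultimately show "norm (exp (u * of_real (x - t))) \<le> E" unfolding E_def
          by (metis exp_le_cancel_iff order_trans)
      qed
      thus ?thesis by (simp add: Phi_zero mult_ac)
    qed
    thus "\<forall>\<^sub>F u in nhds (lam n). norm (Phi f u x - exp (u * of_real (x - y)) * Phi f u y) \<le> (B * E * \<bar>x - y\<bar>) * norm (FF u)"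
      unfolding eventually_nhds_metric dist_norm by (intro exI[of _ 1]) auto
  qed (auto intro: FF_holomorphic)
qed

end

subsection \<open>Interpolation and decay of residues\<close>

lemma A0_growth: "F \<in> A0 \<Longrightarrow> \<epsilon> > 0 \<Longrightarrow> \<exists>M. \<forall>z. norm (F z) \<le> M * exp (\<epsilon> * norm z)"
  by (simp add: A0_def)

locale interp_seq = sector_seq +
  assumes interp: "interpolating_variety_A0 lam mu"
begin

text \<open>A local multiplier: it preserves the jet at \<open>lam n\<close> up to order
  \<open>mu n\<close> and supplies the zeros of the product within half the modulus of
  \<open>lam n\<close>, at cost exp (\<epsilon> |lam n|) with constant 1.\<close>

definition separated :: "real \<Rightarrow> nat \<Rightarrow> bool" where
  "separated \<epsilon> n \<longleftrightarrow> (\<exists>\<phi>. \<phi> holomorphic_on UNIV \<and> vanishes (mu n) (\<lambda>z. \<phi> z - 1) (lam n) \<and>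
     (\<forall>m. m \<noteq> n \<longrightarrow> lam m \<in> ball (lam n) (norm (lam n) / 2) \<longrightarrow> vanishes (mu m) \<phi> (lam m)) \<and>
     (\<forall>z\<in>cball (lam n) (norm (lam n) / 2). norm (\<phi> z) \<le> exp (\<epsilon> * norm (lam n))))"

text \<open>Interpolating the indicator of a lacunary sequence of exceptional indices replaces the
  open mapping theorem here.\<close>

lemma eventually_separated:
  assumes e: "\<epsilon> > 0"
  shows "finite {n. \<not> separated \<epsilon> n}"
proof (rule ccontr)
  assume inf: "infinite {n. \<not> separated \<epsilon> n}"
  have next_bad: "\<exists>m. \<not> separated \<epsilon> m \<and> norm (lam m) > R" for R
  proof (rule ccontr)
    assume "\<not> ?thesis"
    hence "{n. \<not> separated \<epsilon> n} \<subseteq> {n. norm (lam n) \<le> R}" by (auto simp: not_less)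
    thus False using inf finite_lam_ball[of R] finite_subset by blast
  qed
  \<comment> \<open>Ratio 4 keeps the other members of the sequence out of the disc of radius |lam
    n| / 2 about each one, so the indicator data are 0 at every neighbour; the lower bound j later
    absorbs the growth constant.\<close>
  have "\<exists>s. \<forall>j. (\<not> separated \<epsilon> (s j) \<and> norm (lam (s j)) > real j) \<and> 4 * norm (lam (s j)) < norm (lam (s (Suc j)))"
  proof (rule dependent_nat_choice)
    show "\<exists>x. \<not> separated \<epsilon> x \<and> real 0 < norm (lam x)" using next_bad[of "real 0"] by blast
    show "\<exists>y. (\<not> separated \<epsilon> y \<and> real (Suc n) < norm (lam y)) \<and> 4 * norm (lam x) < norm (lam y)" for x n
      using next_bad[of "max (real (Suc n)) (4 * norm (lam x))"] by auto
  qed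
  then obtain s where bad: "\<And>j. \<not> separated \<epsilon> (s j)" and big: "\<And>j. norm (lam (s j)) > real j"
    and lac: "\<And>j. 4 * norm (lam (s j)) < norm (lam (s (Suc j)))" by blast
  have incr: "i \<le> j \<Longrightarrow> norm (lam (s i)) \<le> norm (lam (s j))" for i j
  proof (rule lift_Suc_mono_le[of "\<lambda>j. norm (lam (s j))"])
    show "norm (lam (s n)) \<le> norm (lam (s (Suc n)))" for n using lac[of n] norm_ge_zero[of "lam (s n)"] by linarith
  qed
  have lac': "4 * norm (lam (s i)) < norm (lam (s j))" if "i < j" for i j
    using lac[of i] incr[of "Suc i" j] that by simp
  define a :: "nat \<Rightarrow> nat \<Rightarrow> complex" where "a = (\<lambda>n k. if n \<in> range s \<and> k = 0 then 1 else 0)"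
  have "\<forall>\<epsilon>>0. bdd_above (range (\<lambda>n. (\<Sum>k<mu n. norm (a n k)) * exp (- \<epsilon> * norm (lam n))))"
  proof (intro allI impI bdd_aboveI2)
    fix \<epsilon> :: real and n assume "\<epsilon> > 0"
    have "(\<Sum>k<mu n. norm (a n k)) \<le> (\<Sum>k<mu n. if k = 0 then 1 else 0)"
      by (rule sum_mono) (auto simp: a_def)
    also have "\<dots> \<le> 1" by simp
    finally have "(\<Sum>k<mu n. norm (a n k)) * exp (- \<epsilon> * norm (lam n)) \<le> 1 * 1"
      using \<open>\<epsilon> > 0\<close> by (intro mult_mono) auto
    thus "(\<Sum>k<mu n. norm (a n k)) * exp (- \<epsilon> * norm (lam n)) \<le> 1" by simp
  qed
  then obtain f where f: "f \<in> A0" "\<And>n k. k < mu n \<Longrightarrow> (deriv ^^ k) f (lam n) / of_nat (fact k) = a n k"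
    using interp unfolding interpolating_variety_A0_def by blast
  have hol: "f holomorphic_on UNIV" using f by (simp add: A0_def)
  obtain M where M: "\<And>z. norm (f z) \<le> M * exp (\<epsilon> / 4 * norm z)"
    using A0_growth[OF f(1), of "\<epsilon> / 4"] e by auto
  have fd: "(deriv ^^ k) f (lam n) = (if n \<in> range s \<and> k = 0 then 1 else 0)" if "k < mu n" for n k
    using f(2)[OF that] by (auto simp: a_def split: if_splits)
  \<comment> \<open>Since |lam (s j)| > j, the constant is at most exp (\<epsilon> |lam (s j)| / 2).
    The other half of the exponent comes from growth at rate \<epsilon> / 4 with |z| \<le> 2 |lam (s
    j)|.\<close>
  obtain j :: nat where j: "max 1 M \<le> exp (\<epsilon> / 2 * real j)"
  proof -
    obtain j :: nat where "max 1 M * 2 / \<epsilon> \<le> real j" using real_arch_simple by blast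
    hence "max 1 M \<le> \<epsilon> / 2 * real j" using e by (simp add: field_simps)
    also have "\<dots> \<le> exp (\<epsilon> / 2 * real j)" using exp_ge_add_one_self[of "\<epsilon> / 2 * real j"] by linarith
    finally show thesis by (rule that)
  qed
  let ?n = "s j"
  have "separated \<epsilon> ?n"
    unfolding separated_def
  proof (intro exI[of _ f] conjI hol allI impI ballI)
    show "vanishes (mu ?n) (\<lambda>z. f z - 1) (lam ?n)"
      unfolding vanishes_def
    proof (intro allI impI)
      fix k assume k: "k < mu ?n"
      have "(deriv ^^ k) (\<lambda>z. f z - 1) (lam ?n) = (deriv ^^ k) f (lam ?n) - (deriv ^^ k) (\<lambda>z. 1) (lam ?n)"
        by (rule higher_deriv_diff[of _ UNIV]) (use hol in auto)
      thus "(deriv ^^ k) (\<lambda>z. f z - 1) (lam ?n) = 0" using fd[OF k] by simp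
    qed
    fix m assume m: "m \<noteq> ?n" "lam m \<in> ball (lam ?n) (norm (lam ?n) / 2)"
    have "m \<notin> range s"
    proof
      assume "m \<in> range s"
      then obtain i where i: "m = s i" by auto
      have "norm (lam m - lam ?n) < norm (lam ?n) / 2" using m by (simp add: dist_norm norm_minus_commute)
      hence "norm (lam ?n) / 2 < norm (lam m)" "norm (lam m) < 3 / 2 * norm (lam ?n)"
        using norm_triangle_sub[of "lam m" "lam ?n"] norm_triangle_sub[of "lam ?n" "lam m"]
        by (auto simp: norm_minus_commute)
      moreover have "i < j \<or> j < i" using m(1) i by (metis nat_neq_iff)
      ultimately show False using lac'[of i j] lac'[of j i] i norm_ge_zero[of "lam ?n"] by auto
    qed
    thus "vanishes (mu m) f (lam m)" unfolding vanishes_def using fd by auto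
  next
    fix z assume "z \<in> cball (lam ?n) (norm (lam ?n) / 2)"
    hence "norm (z - lam ?n) \<le> norm (lam ?n) / 2" by (simp add: dist_norm norm_minus_commute)
    hence "norm z \<le> 2 * norm (lam ?n)"
      using norm_triangle_sub[of z "lam ?n"] norm_ge_zero[of "lam ?n"] by linarith
    hence ex: "exp (\<epsilon> / 4 * norm z) \<le> exp (\<epsilon> / 2 * norm (lam ?n))" using e by (simp add: field_simps)
    have "norm (f z) \<le> max 1 M * exp (\<epsilon> / 4 * norm z)"
      by (rule order_trans[OF M]) (intro mult_right_mono, auto)
    also have "\<dots> \<le> exp (\<epsilon> / 2 * real j) * exp (\<epsilon> / 2 * norm (lam ?n))"
      using j ex by (intro mult_mono) auto
    also have "\<dots> \<le> exp (\<epsilon> / 2 * norm (lam ?n)) * exp (\<epsilon> / 2 * norm (lam ?n))"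
      using big[of j] e by (intro mult_right_mono) auto
    also have "\<dots> = exp (\<epsilon> * norm (lam ?n))" by (simp add: exp_add[symmetric])
    finally show "norm (f z) \<le> exp (\<epsilon> * norm (lam ?n))" .
  qed
  thus False using bad by blast
qed

section \<open>Residues at a single zero of the product\<close>

definition Fn :: "nat \<Rightarrow> complex \<Rightarrow> complex" where "Fn n = zprod lam mu (- {n})"

lemma Fn_holomorphic: "Fn n holomorphic_on S"
  unfolding Fn_def by (rule zprod_holomorphic)

lemma Fn_nz: "Fn n (lam n) \<noteq> 0"
  unfolding Fn_def using inj_lam by (auto simp: zprod_eq_0_iff inj_def)

lemma FF_eq_Fn: "FF u = (1 - u / lam n) ^ mu n * Fn n u"
  unfolding Fn_def F_fun_eq_zprod using zprod_remove[of n UNIV u] by (simp add: Compl_eq_Diff_UNIV)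

definition reg :: "nat \<Rightarrow> complex set" where "reg n = {u. Fn n u \<noteq> 0}"

lemma open_reg: "open (reg n)" and lam_in_reg: "lam n \<in> reg n"
proof -
  have "continuous_on UNIV (Fn n)" by (intro holomorphic_on_imp_continuous_on Fn_holomorphic)
  thus "open (reg n)" unfolding reg_def by (intro open_Collect_neq continuous_on_const)
  show "lam n \<in> reg n" using Fn_nz by (simp add: reg_def)
qed

text \<open>\<open>FF\<close> is (u - lam n) ^ mu n times Fn n / (- lam n) ^ mu n. Inverting the
  constant and dividing by the factorial in the residue formula for a pole of order
  \<open>mu n\<close> gives this prefactor.\<close>

definition pref :: "nat \<Rightarrow> complex" where "pref n = (- lam n) ^ mu n / fact (mu n - 1)"

text \<open>The residue of \<open>exp (u x) A(u) / FF(u)\<close> at the zero \<open>lam n\<close> of \<open>FF\<close>.\<close>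

definition res :: "nat \<Rightarrow> (complex \<Rightarrow> complex) \<Rightarrow> complex \<Rightarrow> complex" where
  "res n A x = pref n * (deriv ^^ (mu n - 1)) (\<lambda>u. exp (u * x) * (A u / Fn n u)) (lam n)"

lemma quot_holomorphic: "A holomorphic_on UNIV \<Longrightarrow> (\<lambda>u. A u / Fn n u) holomorphic_on reg n"
  by (intro holomorphic_on_divide Fn_holomorphic) (auto intro: holomorphic_on_subset simp: reg_def)

text \<open>Leibniz's rule for exp (u (z - x)) times a function independent of z exhibits an
  exponential polynomial in z of degree below \<open>mu n\<close>. The centre is free: 0 gives the
  coefficients of the series, the evaluation point gives the form required by the operator
  formula.\<close>

lemma res_recenter:
  assumes "A holomorphic_on UNIV"
  shows "res n A z = (\<Sum>k<mu n. (pref n * of_nat ((mu n - 1) choose k) *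
            (deriv ^^ (mu n - 1 - k)) (\<lambda>u. exp (u * x) * (A u / Fn n u)) (lam n)) *
          ((z - x) ^ k * exp (lam n * (z - x))))"
proof -
  define Q where "Q = (\<lambda>u. exp (u * x) * (A u / Fn n u))"
  have hol: "Q holomorphic_on reg n"
    unfolding Q_def by (intro holomorphic_on_mult quot_holomorphic assms) (intro holomorphic_intros)
  have eq: "(\<lambda>u. exp (u * z) * (A u / Fn n u)) = (\<lambda>u. exp ((z - x) * (u - 0)) * Q u)"
  proof
    fix u
    have "exp (u * z) = exp ((z - x) * (u - 0)) * exp (u * x)"
      by (simp add: exp_add[symmetric] algebra_simps)
    thus "exp (u * z) * (A u / Fn n u) = exp ((z - x) * (u - 0)) * Q u" by (simp add: Q_def mult.assoc)
  qed
  have "(deriv ^^ (mu n - 1)) (\<lambda>u. exp ((z - x) * (u - 0)) * Q u) (lam n) =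
      (\<Sum>k = 0..mu n - 1. of_nat ((mu n - 1) choose k) * (deriv ^^ k) (\<lambda>u. exp ((z - x) * (u - 0))) (lam n) *
          (deriv ^^ (mu n - 1 - k)) Q (lam n))"
    by (rule higher_deriv_mult[OF _ hol open_reg lam_in_reg]) (intro holomorphic_intros)
  also have "{0..mu n - 1} = {..<mu n}" using mu_pos[of n] by auto
  finally show ?thesis
    unfolding res_def eq higher_deriv_exp_shift Q_def[symmetric]
    by (simp add: sum_distrib_left mult_ac)
qed

text \<open>A residue at \<open>lam n\<close> sees the numerator only modulo (u - lam n) ^ mu n, so
  a numerator may be exchanged for one congruent to it modulo \<open>FF\<close>.\<close>

lemma res_cong:
  assumes "A holomorphic_on UNIV" "A' holomorphic_on UNIV" "vanishes (mu n) (\<lambda>u. A u - A' u) (lam n)"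
  shows "res n A x = res n A' x"
proof -
  have "vanishes (mu n) (\<lambda>u. (A u - A' u) * (exp (u * x) / Fn n u)) (lam n)"
    using assms by (intro vanishes_mult[OF _ _ open_reg lam_in_reg] quot_holomorphic holomorphic_intros)
      (auto intro: holomorphic_on_subset)
  hence "vanishes (mu n) (\<lambda>u. exp (u * x) * (A u / Fn n u) - exp (u * x) * (A' u / Fn n u)) (lam n)"
    by (simp add: diff_divide_distrib algebra_simps)
  hence "(deriv ^^ (mu n - 1)) (\<lambda>u. exp (u * x) * (A u / Fn n u)) (lam n) =
      (deriv ^^ (mu n - 1)) (\<lambda>u. exp (u * x) * (A' u / Fn n u)) (lam n)"
    using mu_pos[of n] assms
    by (intro vanishes_deriv_eq[OF _ _ open_reg lam_in_reg] holomorphic_on_mult quot_holomorphic)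
       (auto intro!: holomorphic_intros)
  thus ?thesis by (simp add: res_def)
qed

text \<open>Division by \<open>Fn n\<close> may be regular only on a tiny disc about
  \<open>lam n\<close>. The multiplier from \<open>separated\<close> cancels the neighbouring zeros
  without changing the relevant jet, so Cauchy's inequality applies at a radius proportional to |lam
  n|. All losses are subexponential, while exp (- \<sigma> u) gains a fixed rate because Re u stays
  comparable to |lam n|.\<close>

lemma res_decay:
  assumes \<Phi>: "\<Phi> \<in> A0" and \<sigma>: "\<sigma> > 0"
  shows "summable (\<lambda>n. res n \<Phi> (- of_real \<sigma>))"
proof -
  have hol: "\<Phi> holomorphic_on UNIV" using \<Phi> by (simp add: A0_def)
  \<comment> \<open>On the circle of radius 3 \<rho> |lam n|, the first value keeps Re u \<ge> |lam
    n| / (2 \<kappa>), and the second keeps u inside the disc of radius |lam n| / 2 where the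
    multiplier is bounded.\<close>
  define \<rho> where "\<rho> = min (1 / (6 * \<kappa>)) (1 / 12)"
  have \<rho>: "\<rho> > 0" "3 * \<rho> \<le> 1 / (2 * \<kappa>)" "\<rho> \<le> 1 / 12"
    using \<kappa>_pos by (auto simp: \<rho>_def min_def field_simps)
  define L where "L = 1 / \<rho>"
  have L: "L \<ge> 1" using \<rho> by (simp add: L_def field_simps)
  \<comment> \<open>Six factors exp (\<epsilon> |lam n|) are lost in total. Any \<epsilon> up to
    \<sigma> / (24 \<kappa>) keeps half of the exponent \<sigma> |lam n| / (2 \<kappa>).\<close>
  define \<epsilon> where "\<epsilon> = \<sigma> / (28 * \<kappa>)"
  have \<epsilon>: "\<epsilon> > 0" using \<sigma> \<kappa>_pos by (simp add: \<epsilon>_def)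
  obtain K1' where K1': "\<And>u. norm (\<Phi> u) \<le> K1' * exp (\<epsilon> * norm u)" using A0_growth[OF \<Phi> \<epsilon>] by blast
  define K1 where "K1 = max 1 K1'"
  have K1: "K1 > 0" "norm (\<Phi> u) \<le> K1 * exp (\<epsilon> * norm u)" for u
    using order_trans[OF K1'[of u] mult_right_mono[of K1' K1 "exp (\<epsilon> * norm u)"]] by (auto simp: K1_def)
  obtain K2 where K2: "K2 > 0" and quot: "quotient_bound L \<epsilon> K2"
    using ex_quotient_bound[OF inj_lam \<epsilon> L] by blast
  obtain K3 where K3: "K3 \<ge> 1" "\<And>n. L ^ mu n \<le> K3 * exp (\<epsilon> * norm (lam n))"
    using power_mu_le[OF L \<epsilon>] by blast
  define C where "C = K1 * K2 * K3 / \<epsilon>"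
  define \<eta> where "\<eta> = \<sigma> / (4 * \<kappa>)"
  have \<eta>: "\<eta> > 0" using \<sigma> \<kappa>_pos by (simp add: \<eta>_def)
  have bound: "norm (res n \<Phi> (- of_real \<sigma>)) \<le> C * exp (- (\<eta> * norm (lam n)))" if sep: "separated \<epsilon> n" for n
  proof -
    let ?l = "norm (lam n)"
    have l: "?l > 0" using nz by simp
    define r where "r = \<rho> * ?l"
    have r: "r > 0" "?l = L * r" "3 * r \<le> ?l / 4" using \<rho> l by (auto simp: r_def L_def)
    obtain \<phi> where \<phi>: "\<phi> holomorphic_on UNIV" "vanishes (mu n) (\<lambda>z. \<phi> z - 1) (lam n)"
      "\<And>m. m \<noteq> n \<Longrightarrow> lam m \<in> ball (lam n) (?l / 2) \<Longrightarrow> vanishes (mu m) \<phi> (lam m)"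
      "\<And>z. z \<in> cball (lam n) (?l / 2) \<Longrightarrow> norm (\<phi> z) \<le> exp (\<epsilon> * ?l)"
      using sep unfolding separated_def by blast
    define E where "E = (\<lambda>u. exp (u * (- of_real \<sigma>)) * \<Phi> u)"
    have Ehol: "E holomorphic_on UNIV" unfolding E_def using hol by (intro holomorphic_intros)
    define \<Psi> where "\<Psi> = (\<lambda>u. \<phi> u * E u)"
    have \<Psi>hol: "\<Psi> holomorphic_on UNIV" unfolding \<Psi>_def using Ehol \<phi>(1) by (intro holomorphic_intros)
    define M where "M = K1 * exp (3 * \<epsilon> * ?l - \<sigma> * ?l / (2 * \<kappa>))"
    have \<Psi>M: "norm (\<Psi> u) \<le> M" if u: "u \<in> sphere (lam n) (3 * r)" for u
    proof -
      have d: "norm (u - lam n) = 3 * r" using u by (simp add: dist_norm norm_minus_commute)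
      have 1: "norm (\<phi> u) \<le> exp (\<epsilon> * ?l)"
        using u r by (intro \<phi>(4)) auto
      have "norm u \<le> ?l + 3 * r" using norm_triangle_sub[of u "lam n"] d by simp
      hence "norm u \<le> 2 * ?l" using r l by linarith
      hence "exp (\<epsilon> * norm u) \<le> exp (2 * \<epsilon> * ?l)" using \<epsilon> by simp
      hence 2: "norm (\<Phi> u) \<le> K1 * exp (2 * \<epsilon> * ?l)"
        using K1(1) by (intro order_trans[OF K1(2)[of u]] mult_left_mono) auto
      have "?l / (2 * \<kappa>) \<le> Re u"
      proof -
        have "\<bar>Re u - Re (lam n)\<bar> \<le> 3 * r" using abs_Re_le_cmod[of "u - lam n"] d by simp
        hence "Re u \<ge> ?l / \<kappa> - 3 * r" using Re_lam_ge[of n] by linarith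
        moreover have "3 * r \<le> 1 / (2 * \<kappa>) * ?l"
          using mult_right_mono[OF \<rho>(2), of ?l] by (simp add: r_def)
        moreover have "?l / \<kappa> - 1 / (2 * \<kappa>) * ?l = ?l / (2 * \<kappa>)" using \<kappa>_pos by (simp add: field_simps)
        ultimately show ?thesis by linarith
      qed
      hence "\<sigma> * (?l / (2 * \<kappa>)) \<le> \<sigma> * Re u" using \<sigma> by (intro mult_left_mono) auto
      hence 3: "norm (exp (u * (- of_real \<sigma>))) \<le> exp (- (\<sigma> * ?l / (2 * \<kappa>)))" by (simp add: mult.commute)
      have "norm (\<Psi> u) \<le> exp (\<epsilon> * ?l) * (exp (- (\<sigma> * ?l / (2 * \<kappa>))) * (K1 * exp (2 * \<epsilon> * ?l)))"
        unfolding \<Psi>_def E_def norm_mult using 1 2 3 K1(1) by (intro mult_mono) auto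
      also have "\<dots> = K1 * exp (\<epsilon> * ?l + (- (\<sigma> * ?l / (2 * \<kappa>))) + 2 * \<epsilon> * ?l)"
        by (simp only: exp_add mult_ac)
      also have "\<epsilon> * ?l + (- (\<sigma> * ?l / (2 * \<kappa>))) + 2 * \<epsilon> * ?l = 3 * \<epsilon> * ?l - \<sigma> * ?l / (2 * \<kappa>)" by simp
      finally show ?thesis by (simp add: M_def)
    qed
    have van: "vanishes (mu m) \<Psi> (lam m)" if m: "m \<in> - {n}" "lam m \<in> ball (lam n) (2 * r)" for m
    proof -
      have "2 * r \<le> ?l / 2" using r l by linarith
      hence "lam m \<in> ball (lam n) (?l / 2)" using m(2) unfolding mem_ball by linarith
      thus ?thesis
        unfolding \<Psi>_def using m(1) \<phi>(1) Ehol by (intro vanishes_mult[of _ UNIV] \<phi>(3)) auto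
    qed
    have "\<exists>q. q holomorphic_on ball (lam n) (2 * r) \<and>
        (\<forall>z\<in>ball (lam n) (2 * r). \<Psi> z = zprod lam mu (- {n}) z * q z) \<and>
         (\<forall>z\<in>cball (lam n) r. norm (q z) \<le> K2 * exp (\<epsilon> * r) * M)"
      using van \<Psi>M r by (intro quot[unfolded quotient_bound_def, rule_format] \<Psi>hol) auto
    then obtain q where q: "q holomorphic_on ball (lam n) (2 * r)"
      "\<And>z. z \<in> ball (lam n) (2 * r) \<Longrightarrow> \<Psi> z = Fn n z * q z"
      "\<And>z. z \<in> cball (lam n) r \<Longrightarrow> norm (q z) \<le> K2 * exp (\<epsilon> * r) * M"
      unfolding Fn_def by blast
    let ?S = "reg n \<inter> ball (lam n) (2 * r)"
    have S: "open ?S" "lam n \<in> ?S" using open_reg lam_in_reg r by auto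
    have holE: "(\<lambda>u. E u / Fn n u) holomorphic_on ?S"
      by (rule holomorphic_on_subset[OF quot_holomorphic[OF Ehol]]) auto
    \<comment> \<open>\<open>q\<close> extends \<phi> E / Fn to the whole disc, and \<phi> is 1 to
      order \<open>mu n\<close> at \<open>lam n\<close>; so replacing E / Fn by the well bounded
      \<open>q\<close> leaves the derivative of order \<open>mu n - 1\<close> unchanged.\<close>
    have "vanishes (mu n) (\<lambda>u. (\<phi> u - 1) * (E u / Fn n u)) (lam n)"
      by (rule vanishes_mult[OF _ holE S \<phi>(2)]) (use \<phi>(1) in \<open>auto intro!: holomorphic_intros intro: holomorphic_on_subset\<close>)
    moreover have "\<forall>\<^sub>F u in nhds (lam n). (\<phi> u - 1) * (E u / Fn n u) = q u - E u / Fn n u"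
    proof (rule eventually_mono[OF eventually_nhds_in_open[OF S]])
      fix u assume u: "u \<in> ?S"
      have "q u = \<phi> u * E u / Fn n u" using q(2)[of u] u by (auto simp: \<Psi>_def reg_def field_simps)
      thus "(\<phi> u - 1) * (E u / Fn n u) = q u - E u / Fn n u"
        by (simp add: left_diff_distrib diff_divide_distrib)
    qed
    ultimately have "vanishes (mu n) (\<lambda>u. q u - E u / Fn n u) (lam n)" by (simp add: vanishes_cong)
    hence "(deriv ^^ (mu n - 1)) q (lam n) = (deriv ^^ (mu n - 1)) (\<lambda>u. E u / Fn n u) (lam n)"
      using mu_pos[of n] q(1) holE
      by (intro vanishes_deriv_eq[OF _ holE S]) (auto intro: holomorphic_on_subset)
    hence "res n \<Phi> (- of_real \<sigma>) = pref n * (deriv ^^ (mu n - 1)) q (lam n)"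
      by (simp add: res_def E_def)
    moreover have "norm ((deriv ^^ (mu n - 1)) q (lam n)) \<le> fact (mu n - 1) * (K2 * exp (\<epsilon> * r) * M) / r ^ (mu n - 1)"
    proof (rule Cauchy_inequality)
      have sub: "cball (lam n) r \<subseteq> ball (lam n) (2 * r)" using r by auto
      show "continuous_on (cball (lam n) r) q"
        using q(1) sub by (meson holomorphic_on_imp_continuous_on holomorphic_on_subset)
      show "q holomorphic_on ball (lam n) r"
        using q(1) sub by (meson ball_subset_cball holomorphic_on_subset)
      show "norm (q x) \<le> K2 * exp (\<epsilon> * r) * M" if "norm (lam n - x) = r" for x
        using q(3)[of x] that by (simp add: dist_norm)
    qed (use r in auto)
    ultimately have "norm (res n \<Phi> (- of_real \<sigma>)) \<le>
        norm (pref n) * (fact (mu n - 1) * (K2 * exp (\<epsilon> * r) * M) / r ^ (mu n - 1))"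
      by (simp only: norm_mult mult_left_mono norm_ge_zero)
    also have "\<dots> = ?l ^ mu n / r ^ (mu n - 1) * (K2 * exp (\<epsilon> * r) * M)"
      by (simp add: pref_def norm_divide norm_power)
    also have "?l ^ mu n / r ^ (mu n - 1) = ?l * L ^ (mu n - 1)"
    proof -
      have "?l ^ mu n = ?l * (L * r) ^ (mu n - 1)" using mu_pos[of n] r(2) by (metis power_eq_if not_gr_zero)
      thus ?thesis using r(1) by (simp add: power_mult_distrib)
    qed
    also have "?l * L ^ (mu n - 1) * (K2 * exp (\<epsilon> * r) * M) \<le>
        (exp (\<epsilon> * ?l) / \<epsilon>) * (K3 * exp (\<epsilon> * ?l)) * (K2 * exp (\<epsilon> * ?l) * M)"
    proof (intro mult_mono)
      have "\<epsilon> * ?l \<le> exp (\<epsilon> * ?l)" using exp_ge_add_one_self[of "\<epsilon> * ?l"] by linarith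
      thus "?l \<le> exp (\<epsilon> * ?l) / \<epsilon>" using \<epsilon> by (simp add: field_simps)
      have "L ^ (mu n - 1) \<le> L ^ mu n" using L by (intro power_increasing) auto
      thus "L ^ (mu n - 1) \<le> K3 * exp (\<epsilon> * ?l)" using K3(2)[of n] by linarith
      show "exp (\<epsilon> * r) \<le> exp (\<epsilon> * ?l)" using r l \<epsilon> by simp
    qed (use K1 K2 K3 \<epsilon> L l in \<open>auto simp: M_def\<close>)
    also have "\<dots> = C * exp (\<epsilon> * ?l + \<epsilon> * ?l + \<epsilon> * ?l + (3 * \<epsilon> * ?l - \<sigma> * ?l / (2 * \<kappa>)))"
      by (simp only: C_def M_def exp_add mult_ac times_divide_eq_right times_divide_eq_left)
    also have "\<dots> \<le> C * exp (- (\<eta> * ?l))"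
    proof (intro mult_left_mono, subst exp_le_cancel_iff)
      have "\<epsilon> * ?l + \<epsilon> * ?l + \<epsilon> * ?l + (3 * \<epsilon> * ?l - \<sigma> * ?l / (2 * \<kappa>)) = (6 * \<epsilon> - \<sigma> / (2 * \<kappa>)) * ?l"
        by (simp add: algebra_simps)
      also have "\<dots> \<le> - \<eta> * ?l"
        using \<sigma> \<kappa>_pos by (intro mult_right_mono) (auto simp: \<epsilon>_def \<eta>_def field_simps)
      finally show "\<epsilon> * ?l + \<epsilon> * ?l + \<epsilon> * ?l + (3 * \<epsilon> * ?l - \<sigma> * ?l / (2 * \<kappa>)) \<le> - (\<eta> * ?l)" by simp
    qed (use K1 K2 K3 \<epsilon> in \<open>auto simp: C_def\<close>)
    finally show ?thesis .
  qed
  have "\<forall>\<^sub>F n in sequentially. norm (res n \<Phi> (- of_real \<sigma>)) \<le> C * exp (- (\<eta> * norm (lam n)))"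
  proof -
    have "\<forall>\<^sub>F n in cofinite. separated \<epsilon> n"
      using eventually_separated[OF \<epsilon>] by (simp add: eventually_cofinite)
    thus ?thesis using bound by (auto simp: cofinite_eq_sequentially elim: eventually_mono)
  qed
  thus ?thesis
    by (rule summable_comparison_test_ev) (intro summable_mult exp_lam_summable \<eta>)
qed

end

subsection \<open>The transform of a residue\<close>

lemma tc_affine:
  assumes "\<phi> holomorphic_on UNIV"
  shows "tc (\<lambda>z. c + a * \<phi> z) j = (if j = 0 then c else 0) + a * tc \<phi> j"
proof -
  have "(deriv ^^ j) (\<lambda>z. c + a * \<phi> z) 0 = (deriv ^^ j) (\<lambda>z. c) 0 + (deriv ^^ j) (\<lambda>z. a * \<phi> z) 0"
    by (rule higher_deriv_add[of _ UNIV]) (use assms in \<open>auto intro!: holomorphic_intros\<close>)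
  also have "(deriv ^^ j) (\<lambda>z. a * \<phi> z) 0 = a * (deriv ^^ j) \<phi> 0"
    by (rule higher_deriv_cmult[of _ UNIV]) (use assms in auto)
  finally show ?thesis by (simp add: tc_def add_divide_distrib)
qed

lemma higher_deriv_Cauchy_kernel:
  fixes u \<zeta> :: complex
  assumes "\<zeta> \<noteq> u"
  shows "(deriv ^^ k) (\<lambda>\<zeta>. 1 / (u - \<zeta>)) \<zeta> = fact k / (u - \<zeta>) ^ Suc k"
  using assms
proof (induction k arbitrary: \<zeta>)
  case (Suc k)
  have "(deriv ^^ Suc k) (\<lambda>\<zeta>. 1 / (u - \<zeta>)) \<zeta> = deriv ((deriv ^^ k) (\<lambda>\<zeta>. 1 / (u - \<zeta>))) \<zeta>" by simp
  also have "\<dots> = deriv (\<lambda>\<zeta>. fact k / (u - \<zeta>) ^ Suc k) \<zeta>"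
  proof (rule deriv_cong_ev)
    show "\<forall>\<^sub>F z in nhds \<zeta>. (deriv ^^ k) (\<lambda>\<zeta>. 1 / (u - \<zeta>)) z = fact k / (u - z) ^ Suc k"
      by (rule eventually_mono[OF eventually_nhds_in_open[of "- {u}"]]) (use Suc in auto)
  qed simp
  also have "\<dots> = fact (Suc k) / (u - \<zeta>) ^ Suc (Suc k)"
    by (rule DERIV_imp_deriv, insert Suc.prems, auto intro!: derivative_eq_intros simp: divide_simps simp del: of_nat_Suc)
       (cases k; auto simp: algebra_simps)
  finally show ?case .
qed simp

context interp_seq
begin

text \<open>The symbol of (F(u) - F(D)) / (u - D): for u \<noteq> 0 its Taylor coefficients in
  \<zeta> are the \<open>Psi (Suc j) u\<close>, which links \<open>PhiD\<close> to the operator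
  formula on exponential polynomials.\<close>

definition kern :: "complex \<Rightarrow> complex \<Rightarrow> complex" where
  "kern u \<zeta> = (if \<zeta> = u then deriv FF u else (FF \<zeta> - FF u) / (\<zeta> - u))"

lemma kern_holomorphic: "kern u holomorphic_on UNIV"
  unfolding kern_def by (rule pole_lemma_open) (auto intro: FF_holomorphic)

text \<open>Both sides obey the recurrence obtained by comparing coefficients in FF(\<zeta>) = FF(u)
  + (\<zeta> - u) kern u \<zeta>. Writing \<zeta> - u as - u (1 - \<zeta> / u) brings this into the
  form of \<open>tc_mult_linear\<close>, hence u \<noteq> 0.\<close>

lemma tc_kern:
  assumes u: "u \<noteq> 0"
  shows "tc (kern u) j = Psi (Suc j) u"
proof -
  have eq: "FF = (\<lambda>\<zeta>. FF u + (- u) * ((1 + (- 1 / u) * \<zeta>) * kern u \<zeta>))"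
  proof
    fix \<zeta>
    have "(- u) * ((1 + (- 1 / u) * \<zeta>) * kern u \<zeta>) = (\<zeta> - u) * kern u \<zeta>"
      using u by (simp add: field_simps)
    thus "FF \<zeta> = FF u + (- u) * ((1 + (- 1 / u) * \<zeta>) * kern u \<zeta>)" by (simp add: kern_def)
  qed
  have hol: "(\<lambda>\<zeta>. (1 + (- 1 / u) * \<zeta>) * kern u \<zeta>) holomorphic_on UNIV"
    by (intro holomorphic_intros kern_holomorphic)
  have tc: "Fc j = (if j = 0 then FF u else 0) + (- u) * tc (\<lambda>\<zeta>. (1 + (- 1 / u) * \<zeta>) * kern u \<zeta>) j" for j
    unfolding F_coef_eq_tc by (subst eq) (rule tc_affine[OF hol])
  show ?thesis
  proof (induction j)
    case 0
    have "Fc 0 = FF u - u * tc (kern u) 0"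
      using tc[of 0] unfolding tc_mult_linear(1)[OF kern_holomorphic] by simp
    moreover have "FF u = Fc 0 + u * Psi (Suc 0) u" using Psi_rec[of 0 u] by (simp add: Psi_0)
    ultimately have "u * tc (kern u) 0 = u * Psi (Suc 0) u" by (simp add: algebra_simps)
    thus ?case using u by simp
  next
    case (Suc j)
    have "Fc (Suc j) = (- u) * (tc (kern u) (Suc j) + (- 1 / u) * tc (kern u) j)"
      using tc[of "Suc j"] unfolding tc_mult_linear(2)[OF kern_holomorphic] by simp
    hence "Fc (Suc j) = Psi (Suc j) u - u * tc (kern u) (Suc j)" using u by (simp add: algebra_simps Suc)
    moreover have "Psi (Suc j) u = Fc (Suc j) + u * Psi (Suc (Suc j)) u" by (rule Psi_rec)
    ultimately have "u * tc (kern u) (Suc j) = u * Psi (Suc (Suc j)) u" by (simp add: algebra_simps)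
    thus ?case using u by simp
  qed
qed

lemma res_holomorphic:
  assumes "A holomorphic_on UNIV"
  shows "res n A holomorphic_on S"
proof -
  have "res n A = (\<lambda>z. \<Sum>k<mu n. (pref n * of_nat ((mu n - 1) choose k) *
            (deriv ^^ (mu n - 1 - k)) (\<lambda>u. exp (u * 0) * (A u / Fn n u)) (lam n)) *
          ((z - 0) ^ k * exp (lam n * (z - 0))))"
    using res_recenter[OF assms, of n _ 0] by blast
  moreover have "\<dots> holomorphic_on S" by (intro holomorphic_intros)
  ultimately show ?thesis by simp
qed

lemma res_G_summable:
  assumes "A holomorphic_on UNIV"
  shows "summable (\<lambda>j. G j * norm ((deriv ^^ j) (res n A) x))"
proof -
  have "compact (res n A ` cball x 1)"
    by (intro compact_continuous_image holomorphic_on_imp_continuous_on res_holomorphic assms) auto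
  then obtain M where M: "\<And>z. z \<in> cball x 1 \<Longrightarrow> norm (res n A z) \<le> M"
    using compact_imp_bounded bounded_iff by (metis imageI)
  have "summable (\<lambda>j. norm (of_real (G j) * (deriv ^^ j) (res n A) x))"
    by (rule op_bound(2)[where S = UNIV and r = 1 and M = M, OF res_holomorphic[OF assms]])
       (use M G_fact_summable[of 1] G_nonneg in auto)
  thus ?thesis using G_nonneg by (simp add: norm_mult)
qed

definition resPhi :: "nat \<Rightarrow> (complex \<Rightarrow> complex) \<Rightarrow> complex \<Rightarrow> complex \<Rightarrow> complex" where
  "resPhi n A x u = PhiD (\<lambda>j. (deriv ^^ j) (res n A) x) u"

lemma resPhi_sums:
  assumes "A holomorphic_on UNIV"
  shows "(\<lambda>j. Psi (Suc j) u * (deriv ^^ j) (res n A) x) sums resPhi n A x u"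
  using summable_sums[OF PhiD(1)[OF res_G_summable[OF assms, of n x], of u]]
  by (simp add: resPhi_def PhiD_def mult.commute)

lemma resPhi_holomorphic: "A holomorphic_on UNIV \<Longrightarrow> resPhi n A x holomorphic_on S"
  unfolding resPhi_def[abs_def] by (intro PhiD(3) res_G_summable)

text \<open>The operator acts through its symbol, so the left side is a derivative of
  \<open>kern u \<zeta> * Q \<zeta>\<close> at \<open>lam n\<close>. In kern u \<zeta> = (FF(u) -
  FF(\<zeta>)) / (u - \<zeta>) the part with FF(\<zeta>) vanishes to order \<open>mu n\<close>
  there; what remains is FF(u) times the principal part at \<open>lam n\<close> of exp (u x) A(u) /
  FF(u).\<close>

lemma resPhi_formula:
  fixes n :: nat and A :: "complex \<Rightarrow> complex" and x :: complex
  defines "Q \<equiv> \<lambda>u. exp (u * x) * (A u / Fn n u)"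
  assumes A: "A holomorphic_on UNIV" and u: "u \<noteq> 0" "u \<noteq> lam n"
  shows "resPhi n A x u = pref n * (FF u * (\<Sum>k<mu n. of_nat ((mu n - 1) choose k) *
            (fact k / (u - lam n) ^ Suc k) * (deriv ^^ (mu n - 1 - k)) Q (lam n)))"
proof -
  have Qhol: "Q holomorphic_on reg n"
    unfolding Q_def by (intro holomorphic_on_mult quot_holomorphic A) (intro holomorphic_intros)
  have set: "{0..mu n - 1} = {..<mu n}" using mu_pos[of n] by auto
  define B where "B = (\<lambda>k. pref n * of_nat ((mu n - 1) choose k) * (deriv ^^ (mu n - 1 - k)) Q (lam n))"
  have "res n A = (\<lambda>z. \<Sum>k<mu n. B k * ((z - x) ^ k * exp (lam n * (z - x))))"
    using res_recenter[OF A, of n _ x] unfolding B_def Q_def by blast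
  hence "(\<lambda>j. tc (kern u) j * (deriv ^^ j) (res n A) x) sums (\<Sum>k<mu n. B k * (deriv ^^ k) (kern u) (lam n))"
    using op_exp_poly_sum[OF kern_holomorphic[of u], where m = "mu n" and B = B and x = x and l = "lam n"] by simp
  hence "resPhi n A x u = (\<Sum>k<mu n. B k * (deriv ^^ k) (kern u) (lam n))"
    using resPhi_sums[OF A, of u n x] sums_unique2 by (simp add: tc_kern[OF u(1)])
  also have "\<dots> = pref n * (\<Sum>k<mu n. of_nat ((mu n - 1) choose k) * (deriv ^^ k) (kern u) (lam n) *
        (deriv ^^ (mu n - 1 - k)) Q (lam n))"
    by (simp add: B_def sum_distrib_left mult_ac)
  also have "(\<Sum>k<mu n. of_nat ((mu n - 1) choose k) * (deriv ^^ k) (kern u) (lam n) * (deriv ^^ (mu n - 1 - k)) Q (lam n))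
      = (deriv ^^ (mu n - 1)) (\<lambda>\<zeta>. kern u \<zeta> * Q \<zeta>) (lam n)"
    by (subst higher_deriv_mult[OF _ Qhol open_reg lam_in_reg])
       (rule holomorphic_on_subset[OF kern_holomorphic], simp, simp only: set)
  also have "\<dots> = (deriv ^^ (mu n - 1)) (\<lambda>\<zeta>. FF u * (1 / (u - \<zeta>) * Q \<zeta>)) (lam n)"
  proof (rule vanishes_deriv_eq[where S = "reg n - {u}" and m = "mu n"])
    show hol1: "(\<lambda>\<zeta>. kern u \<zeta> * Q \<zeta>) holomorphic_on reg n - {u}"
      by (intro holomorphic_on_mult holomorphic_on_subset[OF kern_holomorphic] holomorphic_on_subset[OF Qhol]) auto
    have hol2: "(\<lambda>\<zeta>. 1 / (u - \<zeta>) * Q \<zeta>) holomorphic_on reg n - {u}"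
      by (intro holomorphic_intros holomorphic_on_subset[OF Qhol]) auto
    show "(\<lambda>\<zeta>. FF u * (1 / (u - \<zeta>) * Q \<zeta>)) holomorphic_on reg n - {u}"
      by (intro holomorphic_on_mult hol2 holomorphic_on_const)
    show S: "open (reg n - {u})" "lam n \<in> reg n - {u}" using open_reg lam_in_reg u by auto
    have "vanishes (mu n) (\<lambda>\<zeta>. FF \<zeta> * (- (1 / (u - \<zeta>) * Q \<zeta>))) (lam n)"
    proof (rule vanishes_mult[OF _ _ S])
      show "vanishes (mu n) FF (lam n)" unfolding F_fun_eq_zprod by (rule zprod_vanishes) auto
      show "(\<lambda>\<zeta>. - (1 / (u - \<zeta>) * Q \<zeta>)) holomorphic_on reg n - {u}"
        using hol2 by (rule holomorphic_on_minus)
    qed (rule FF_holomorphic)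
    moreover have "\<forall>\<^sub>F \<zeta> in nhds (lam n). FF \<zeta> * (- (1 / (u - \<zeta>) * Q \<zeta>)) = kern u \<zeta> * Q \<zeta> - FF u * (1 / (u - \<zeta>) * Q \<zeta>)"
    proof (rule eventually_mono[OF eventually_nhds_in_open[OF S]])
      fix \<zeta> assume "\<zeta> \<in> reg n - {u}"
      hence ne: "\<zeta> - u \<noteq> 0" "u - \<zeta> \<noteq> 0" by auto
      have "kern u \<zeta> = FF u * (1 / (u - \<zeta>)) - FF \<zeta> * (1 / (u - \<zeta>))"
        using ne by (auto simp: kern_def divide_simps) (auto simp: algebra_simps)
      thus "FF \<zeta> * (- (1 / (u - \<zeta>) * Q \<zeta>)) = kern u \<zeta> * Q \<zeta> - FF u * (1 / (u - \<zeta>) * Q \<zeta>)"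
        by (simp add: left_diff_distrib)
    qed
    ultimately show "vanishes (mu n) (\<lambda>\<zeta>. kern u \<zeta> * Q \<zeta> - FF u * (1 / (u - \<zeta>) * Q \<zeta>)) (lam n)"
      by (simp only: vanishes_cong)
  qed (use mu_pos[of n] in auto)
  also have "\<dots> = FF u * (deriv ^^ (mu n - 1)) (\<lambda>\<zeta>. 1 / (u - \<zeta>) * Q \<zeta>) (lam n)"
    by (rule higher_deriv_cmult[of _ "reg n - {u}"])
       (use open_reg lam_in_reg u in \<open>auto intro!: holomorphic_intros holomorphic_on_subset[OF Qhol]\<close>)
  also have "(deriv ^^ (mu n - 1)) (\<lambda>\<zeta>. 1 / (u - \<zeta>) * Q \<zeta>) (lam n) =
      (\<Sum>k = 0..mu n - 1. of_nat ((mu n - 1) choose k) * (deriv ^^ k) (\<lambda>\<zeta>. 1 / (u - \<zeta>)) (lam n) *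
        (deriv ^^ (mu n - 1 - k)) Q (lam n))"
    by (rule higher_deriv_mult[of _ "reg n - {u}"])
       (use open_reg lam_in_reg u in \<open>auto intro!: holomorphic_intros holomorphic_on_subset[OF Qhol]\<close>)
  finally show ?thesis by (simp only: set higher_deriv_Cauchy_kernel[OF u(2)[symmetric]])
qed

text \<open>By the closed formula the quotient by \<open>FF\<close> has its only pole at
  \<open>lam n\<close>, so the zero of \<open>FF\<close> at \<open>lam m\<close> persists.\<close>

lemma resPhi_vanishes_other:
  assumes A: "A holomorphic_on UNIV" and "m \<noteq> n"
  shows "vanishes (mu m) (resPhi n A x) (lam m)"
proof -
  have ne: "lam m \<noteq> lam n" using inj_lam assms(2) by (auto simp: inj_def)
  define X where "X = (\<lambda>u. pref n * (\<Sum>k<mu n. of_nat ((mu n - 1) choose k) *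
            (fact k / (u - lam n) ^ Suc k) * (deriv ^^ (mu n - 1 - k)) (\<lambda>u. exp (u * x) * (A u / Fn n u)) (lam n)))"
  have "vanishes (mu m) (\<lambda>u. FF u * X u) (lam m)"
  proof (rule vanishes_mult[of _ "- {lam n, 0}"])
    show "vanishes (mu m) FF (lam m)" unfolding F_fun_eq_zprod by (rule zprod_vanishes) auto
    show "X holomorphic_on - {lam n, 0}" unfolding X_def by (intro holomorphic_intros) auto
  qed (use ne nz in \<open>auto intro: FF_holomorphic\<close>)
  moreover have "\<forall>\<^sub>F u in nhds (lam m). FF u * X u = resPhi n A x u"
  proof (rule eventually_mono[OF eventually_nhds_in_open[of "- {lam n, 0}"]])
    show "FF u * X u = resPhi n A x u" if "u \<in> - {lam n, 0}" for u
      using that by (subst resPhi_formula[OF A]) (auto simp: X_def mult_ac)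
  qed (use ne nz in auto)
  ultimately show ?thesis by (simp add: vanishes_cong)
qed

text \<open>Cancelling the pole of the principal part against the zero of \<open>FF\<close> turns
  \<open>resPhi\<close> into \<open>Fn n\<close> times the Taylor polynomial \<open>T\<close> of
  \<open>Q\<close> of degree below \<open>mu n\<close>. The difference is (Q - T) Fn, which vanishes
  to order \<open>mu n\<close>.\<close>

lemma resPhi_vanishes_self:
  assumes A: "A holomorphic_on UNIV"
  shows "vanishes (mu n) (\<lambda>u. exp (u * x) * A u - resPhi n A x u) (lam n)"
proof -
  define Q where "Q = (\<lambda>u. exp (u * x) * (A u / Fn n u))"
  have Qhol: "Q holomorphic_on reg n"
    unfolding Q_def by (intro holomorphic_on_mult quot_holomorphic A) (intro holomorphic_intros)
  let ?m = "mu n"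
  define T where "T = (\<lambda>u. \<Sum>i<?m. (deriv ^^ i) Q (lam n) / fact i * (u - lam n) ^ i)"
  have Thol: "T holomorphic_on S" for S unfolding T_def by (intro holomorphic_intros)
  have TQ: "vanishes ?m (\<lambda>u. Q u - T u) (lam n)"
    unfolding vanishes_def
  proof (intro allI impI)
    fix k assume k: "k < ?m"
    have "(deriv ^^ k) T (lam n) = (\<Sum>i<?m. (deriv ^^ k) (\<lambda>u. (deriv ^^ i) Q (lam n) / fact i * (u - lam n) ^ i) (lam n))"
      unfolding T_def by (rule higher_deriv_sum[of _ _ UNIV]) (auto intro!: holomorphic_intros)
    also have "\<dots> = (\<Sum>i<?m. (deriv ^^ i) Q (lam n) / fact i * (if k = i then fact i else 0))"
    proof (rule sum.cong[OF refl])
      fix i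
      have "(deriv ^^ k) (\<lambda>u. (deriv ^^ i) Q (lam n) / fact i * (u - lam n) ^ i) (lam n) =
          (deriv ^^ i) Q (lam n) / fact i * (deriv ^^ k) (\<lambda>u. (u - lam n) ^ i) (lam n)"
        by (rule higher_deriv_cmult[of _ UNIV]) (auto intro!: holomorphic_intros)
      thus "(deriv ^^ k) (\<lambda>u. (deriv ^^ i) Q (lam n) / fact i * (u - lam n) ^ i) (lam n) =
          (deriv ^^ i) Q (lam n) / fact i * (if k = i then fact i else 0)"
        by (simp only: higher_deriv_power_at)
    qed
    also have "\<dots> = (deriv ^^ k) Q (lam n)"
      using k by (simp add: if_distrib cong: if_cong)
    finally have "(deriv ^^ k) T (lam n) = (deriv ^^ k) Q (lam n)" .
    thus "(deriv ^^ k) (\<lambda>u. Q u - T u) (lam n) = 0"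
      using higher_deriv_diff[OF Qhol Thol open_reg lam_in_reg] by simp
  qed
  have van: "vanishes ?m (\<lambda>u. (Q u - T u) * Fn n u) (lam n)"
    by (rule vanishes_mult[OF _ Fn_holomorphic open_reg lam_in_reg TQ])
       (intro holomorphic_on_diff Qhol Thol)
  have eq: "exp (u * x) * A u - resPhi n A x u = (Q u - T u) * Fn n u"
    if u: "u \<in> reg n" "u \<noteq> 0" "u \<noteq> lam n" for u
  proof -
    have ul: "u - lam n \<noteq> 0" using u by simp
    have "1 - u / lam n = (u - lam n) / (- lam n)" using nz[of n] by (simp add: field_simps)
    hence "FF u * (- lam n) ^ ?m = (((u - lam n) / (- lam n)) ^ ?m * (- lam n) ^ ?m) * Fn n u"
      by (simp only: FF_eq_Fn[of u n] mult_ac)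
    also have "((u - lam n) / (- lam n)) ^ ?m * (- lam n) ^ ?m = (u - lam n) ^ ?m"
      unfolding power_mult_distrib[symmetric] using nz[of n] by simp
    finally have FFu: "FF u * (- lam n) ^ ?m = (u - lam n) ^ ?m * Fn n u" .
    have "resPhi n A x u = (\<Sum>k<?m. (FF u * (- lam n) ^ ?m) * (of_nat ((?m - 1) choose k) / fact (?m - 1) *
            (fact k / (u - lam n) ^ Suc k) * (deriv ^^ (?m - 1 - k)) Q (lam n)))"
      by (subst resPhi_formula[OF A u(2,3)]) (simp add: pref_def Q_def sum_distrib_left mult_ac)
    also have "\<dots> = (\<Sum>k<?m. Fn n u * ((deriv ^^ (?m - Suc k)) Q (lam n) / fact (?m - Suc k) * (u - lam n) ^ (?m - Suc k)))"
    proof (rule sum.cong[OF refl])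
      fix k assume "k \<in> {..<?m}"
      hence k: "k \<le> ?m - 1" "Suc k \<le> ?m" "?m - Suc k = ?m - 1 - k" by auto
      have b: "of_nat ((?m - 1) choose k) / fact (?m - 1) * fact k = (1 / fact (?m - Suc k) :: complex)"
        unfolding k(3) by (subst binomial_fact[OF k(1)]) simp
      have p: "(u - lam n) ^ ?m / (u - lam n) ^ Suc k = (u - lam n) ^ (?m - Suc k)"
        using power_diff[OF ul k(2)] by simp
      have "(FF u * (- lam n) ^ ?m) * (of_nat ((?m - 1) choose k) / fact (?m - 1) *
            (fact k / (u - lam n) ^ Suc k) * (deriv ^^ (?m - 1 - k)) Q (lam n)) =
          Fn n u * ((of_nat ((?m - 1) choose k) / fact (?m - 1) * fact k) * (deriv ^^ (?m - 1 - k)) Q (lam n) *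
            ((u - lam n) ^ ?m / (u - lam n) ^ Suc k))"
        unfolding FFu by (simp only: mult_ac times_divide_eq_right times_divide_eq_left)
      also have "\<dots> = Fn n u * ((deriv ^^ (?m - Suc k)) Q (lam n) / fact (?m - Suc k) * (u - lam n) ^ (?m - Suc k))"
        unfolding b p k(3)[symmetric] by simp
      finally show "(FF u * (- lam n) ^ ?m) * (of_nat ((?m - 1) choose k) / fact (?m - 1) *
            (fact k / (u - lam n) ^ Suc k) * (deriv ^^ (?m - 1 - k)) Q (lam n)) =
          Fn n u * ((deriv ^^ (?m - Suc k)) Q (lam n) / fact (?m - Suc k) * (u - lam n) ^ (?m - Suc k))" .
    qed
    also have "\<dots> = (\<Sum>i<?m. Fn n u * ((deriv ^^ i) Q (lam n) / fact i * (u - lam n) ^ i))"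
      by (rule sum.nat_diff_reindex)
    also have "\<dots> = Fn n u * T u" by (simp add: T_def sum_distrib_left)
    finally show ?thesis using u(1) by (simp add: Q_def reg_def algebra_simps)
  qed
  have hol1: "(\<lambda>u. exp (u * x) * A u - resPhi n A x u) holomorphic_on reg n"
    by (intro holomorphic_intros resPhi_holomorphic A) (rule holomorphic_on_subset[OF A], auto)
  have hol2: "(\<lambda>u. (Q u - T u) * Fn n u) holomorphic_on reg n"
    by (intro holomorphic_on_mult holomorphic_on_diff Qhol Thol Fn_holomorphic)
  let ?S = "reg n - {0}"
  have S: "open ?S" "lam n \<in> ?S" using open_reg lam_in_reg nz[of n] by auto
  \<comment> \<open>The closed formula excludes u = lam n, so equality at this point comes from
    continuity; the other excluded point 0 has been removed from \<open>?S\<close>.\<close>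
  have "exp (lam n * x) * A (lam n) - resPhi n A x (lam n) = (Q (lam n) - T (lam n)) * Fn n (lam n)"
  proof (rule tendsto_unique[of "at (lam n)"])
    show "((\<lambda>u. exp (u * x) * A u - resPhi n A x u) \<longlongrightarrow> exp (lam n * x) * A (lam n) - resPhi n A x (lam n)) (at (lam n))"
      using holomorphic_on_imp_continuous_on[OF hol1] open_reg lam_in_reg
      by (metis (no_types, lifting) continuous_on_eq_continuous_at isCont_def)
    have "((\<lambda>u. (Q u - T u) * Fn n u) \<longlongrightarrow> (Q (lam n) - T (lam n)) * Fn n (lam n)) (at (lam n))"
      using holomorphic_on_imp_continuous_on[OF hol2] open_reg lam_in_reg
      by (metis (no_types, lifting) continuous_on_eq_continuous_at isCont_def)
    moreover have "\<forall>\<^sub>F u in at (lam n). (Q u - T u) * Fn n u = exp (u * x) * A u - resPhi n A x u"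
      using eventually_at_in_open[OF S] by (rule eventually_mono) (use eq in auto)
    ultimately show "((\<lambda>u. exp (u * x) * A u - resPhi n A x u) \<longlongrightarrow> (Q (lam n) - T (lam n)) * Fn n (lam n)) (at (lam n))"
      by (rule Lim_transform_eventually)
  qed simp
  hence "\<forall>\<^sub>F u in nhds (lam n). (Q u - T u) * Fn n u = exp (u * x) * A u - resPhi n A x u"
    using eventually_nhds_in_open[OF S] eq by (auto elim!: eventually_mono) metis
  thus ?thesis using van by (simp add: vanishes_cong)
qed

end

subsection \<open>Solutions are exponential series\<close>

text \<open>The function is damped by exp (i \<delta> u), of modulus exp (- \<delta> Im u), which is
  effective since Im u is comparable to |u| in this sector. The maximum principle on a truncated
  sector is followed by \<delta> \<rightarrow> 0.\<close>

lemma Phragmen_Lindelof_upper: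
  assumes E: "E \<in> A0"
    and bd: "\<And>u. \<bar>Re u\<bar> = Im u \<Longrightarrow> norm (E u) \<le> B"
    and w: "\<bar>Re w\<bar> \<le> Im w"
  shows "norm (E w) \<le> max B 1"
proof -
  have hol: "E holomorphic_on UNIV" using E by (simp add: A0_def)
  \<comment> \<open>Positivity of \<open>C\<close> guarantees a radius at which K exp (- \<delta> R
    / 4) has fallen below it.\<close>
  define C where "C = max B 1"
  have main: "norm (E w * exp (\<i> * of_real \<delta> * w)) \<le> C" if \<delta>: "\<delta> > 0" for \<delta>
  proof -
    obtain K where K: "\<And>u. norm (E u) \<le> K * exp (\<delta> / 4 * norm u)" using A0_growth[OF E, of "\<delta> / 4"] \<delta> by auto
    obtain R where R: "R > norm w" "K * exp (- (\<delta> / 4 * R)) \<le> C" "R > 0"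
    proof -
      have "((\<lambda>R. K * exp (- (\<delta> / 4 * R))) \<longlongrightarrow> K * 0) at_top"
      proof (intro tendsto_intros filterlim_compose[OF exp_at_bot])
        have "filterlim (\<lambda>R. \<delta> / 4 * R) at_top at_top"
          using \<delta> by (intro filterlim_tendsto_pos_mult_at_top[OF tendsto_const] filterlim_ident) auto
        thus "filterlim (\<lambda>R. - (\<delta> / 4 * R)) at_bot at_top" by (simp add: filterlim_uminus_at_top)
      qed
      hence "\<forall>\<^sub>F R in at_top. K * exp (- (\<delta> / 4 * R)) < C"
        by (rule order_tendstoD) (simp add: C_def)
      hence "\<forall>\<^sub>F R in at_top. K * exp (- (\<delta> / 4 * R)) < C \<and> R > norm w \<and> R > 0"
        by (intro eventually_conj eventually_gt_at_top)
      then obtain R where "K * exp (- (\<delta> / 4 * R)) < C \<and> R > norm w \<and> R > 0"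
        using eventually_happens'[OF trivial_limit_at_top_linorder] by blast
      thus thesis using that[of R] by auto
    qed
    define S where "S = {u. \<bar>Re u\<bar> \<le> Im u} \<inter> cball 0 R"
    have closed: "closed S" unfolding S_def
      by (intro closed_Int closed_cball closed_Collect_le continuous_intros)
    have int: "{u. \<bar>Re u\<bar> < Im u} \<inter> ball 0 R \<subseteq> interior S"
      by (intro interior_maximal open_Int open_ball open_Collect_less continuous_intros) (auto simp: S_def)
    show ?thesis
    proof (rule maximum_modulus_frontier[of "\<lambda>u. E u * exp (\<i> * of_real \<delta> * u)" S])
      show "(\<lambda>u. E u * exp (\<i> * of_real \<delta> * u)) holomorphic_on interior S"
        by (intro holomorphic_intros holomorphic_on_subset[OF hol]) auto
      show "continuous_on (closure S) (\<lambda>u. E u * exp (\<i> * of_real \<delta> * u))"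
        by (intro continuous_intros holomorphic_on_imp_continuous_on holomorphic_on_subset[OF hol]) auto
      show "bounded S" unfolding S_def by (intro bounded_Int) auto
      show "w \<in> S" using w R by (auto simp: S_def)
      fix u assume "u \<in> frontier S"
      hence uS: "u \<in> S" "u \<notin> interior S" using closed by (auto simp: frontier_def)
      have nexp: "norm (exp (\<i> * of_real \<delta> * u)) = exp (- (\<delta> * Im u))" by simp
      have Im: "Im u \<ge> 0" "\<bar>Re u\<bar> \<le> Im u" "norm u \<le> R" using uS by (auto simp: S_def)
      consider "\<bar>Re u\<bar> = Im u" | "norm u = R" using uS int Im by force
      thus "norm (E u * exp (\<i> * of_real \<delta> * u)) \<le> C"
      proof cases
        case 1
        have "norm (E u) * exp (- (\<delta> * Im u)) \<le> C * 1"
          using bd[OF 1] Im \<delta> by (intro mult_mono) (auto simp: C_def)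
        thus ?thesis by (simp add: norm_mult nexp)
      next
        case 2
        \<comment> \<open>On the arc the damping exponent is at least \<delta> R / 2, twice the
          growth exponent \<delta> R / 4.\<close>
        have "norm u \<le> 2 * Im u" using cmod_le[of u] Im by linarith
        hence "\<delta> / 2 * R \<le> \<delta> * Im u" using 2 \<delta> by simp
        hence "norm (E u) * exp (- (\<delta> * Im u)) \<le> (K * exp (\<delta> / 4 * R)) * exp (- (\<delta> / 2 * R))"
          using K[of u] 2 order_trans[OF norm_ge_zero K[of 0]] by (intro mult_mono) auto
        also have "\<dots> = K * exp (- (\<delta> / 4 * R))" by (simp add: exp_add[symmetric])
        finally show ?thesis using R by (simp add: norm_mult nexp)
      qed
    qed
  qed
  have "((\<lambda>\<delta>. norm (E w * exp (\<i> * of_real \<delta> * w))) \<longlongrightarrow> norm (E w * exp (\<i> * of_real 0 * w))) (at_right 0)"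
    by (intro tendsto_intros)
  moreover have "\<forall>\<^sub>F \<delta> in at_right 0. norm (E w * exp (\<i> * of_real \<delta> * w)) \<le> C"
    using main by (intro eventually_at_rightI[of 0 1]) auto
  ultimately have "norm (E w * exp (\<i> * of_real 0 * w)) \<le> C"
    by (intro tendsto_upperbound) auto
  thus ?thesis by (simp add: C_def)
qed

text \<open>The bound is given on a double sector around the real axis. The two complementary
  sectors have opening pi / 2, where exponential type zero suffices; the lower one is carried to the
  upper one by u \<mapsto> - u.\<close>

lemma subexponential_Liouville:
  assumes E: "E \<in> A0"
    and bd: "\<And>u. \<bar>Im u\<bar> \<le> \<bar>Re u\<bar> \<Longrightarrow> norm (E u) \<le> B"
  shows "\<exists>e. \<forall>u. E u = e"
proof -
  have hol: "E holomorphic_on UNIV" using E by (simp add: A0_def)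
  have up: "norm (E u) \<le> max B 1" if "\<bar>Re u\<bar> \<le> Im u" for u
    by (rule Phragmen_Lindelof_upper[OF E bd that]) auto
  have down: "norm (E u) \<le> max B 1" if "\<bar>Re u\<bar> \<le> - Im u" for u
  proof -
    have "norm (E (- (- u))) \<le> max B 1"
    proof (rule Phragmen_Lindelof_upper[of "\<lambda>u. E (- u)" B "- u"])
      have "(\<lambda>u. E (- u)) holomorphic_on UNIV"
        using holomorphic_on_compose[OF holomorphic_on_minus[OF holomorphic_on_ident]
            holomorphic_on_subset[OF hol subset_UNIV]] by (simp add: o_def)
      moreover have "\<exists>M. \<forall>z. norm (E (- z)) \<le> M * exp (\<epsilon> * norm z)" if e: "\<epsilon> > 0" for \<epsilon>
      proof -
        obtain M where M: "\<And>z. norm (E z) \<le> M * exp (\<epsilon> * norm z)" using A0_growth[OF E e] by blast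
        have "norm (E (- z)) \<le> M * exp (\<epsilon> * norm z)" for z using M[of "- z"] by simp
        thus ?thesis by blast
      qed
      ultimately show "(\<lambda>u. E (- u)) \<in> A0" by (simp add: A0_def)
    qed (use bd that in auto)
    thus ?thesis by simp
  qed
  have "norm (E u) \<le> max B 1" for u
  proof -
    consider "\<bar>Im u\<bar> \<le> \<bar>Re u\<bar>" | "\<bar>Re u\<bar> \<le> Im u" | "\<bar>Re u\<bar> \<le> - Im u" by linarith
    thus ?thesis by cases (use bd[of u] up[of u] down[of u] in auto)
  qed
  hence "bounded (range E)" by (auto simp: bounded_iff)
  from Liouville_theorem[OF hol this] show ?thesis by (auto simp: constant_on_def)
qed

context interp_seq
begin

lemma FF_eventually_nz: "\<forall>\<^sub>F w in at z. FF w \<noteq> 0"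
proof -
  have "\<not> z islimpt range lam"
  proof
    assume "z islimpt range lam"
    hence "infinite (range lam \<inter> ball z 1)" using islimpt_eq_infinite_ball[of z "range lam"] by auto
    moreover have "range lam \<inter> ball z 1 \<subseteq> lam ` {n. norm (lam n) \<le> norm z + 1}"
    proof
      fix w assume w: "w \<in> range lam \<inter> ball z 1"
      hence "norm w \<le> norm z + 1"
        using norm_triangle_sub[of w z] by (auto simp: dist_norm norm_minus_commute)
      thus "w \<in> lam ` {n. norm (lam n) \<le> norm z + 1}" using w by auto
    qed
    ultimately show False using finite_lam_ball[of "norm z + 1"] finite_surj by blast
  qed
  thus ?thesis by (simp add: islimpt_iff_eventually FF_eq_0_iff)
qed

text \<open>\<open>quotient_bound\<close> at centre 0 yields quotients on growing discs together
  with their size. For r = |u| + 1 the exponents lost are \<epsilon> r / 4 in the division and 3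
  \<epsilon> r / 4 from the growth of \<Phi> on the circle of radius 3 r.\<close>

lemma entire_quotient:
  assumes \<Phi>: "\<Phi> \<in> A0" and van: "\<And>n. vanishes (mu n) \<Phi> (lam n)"
  shows "\<exists>E\<in>A0. \<forall>u. \<Phi> u = FF u * E u"
proof -
  have hol: "\<Phi> holomorphic_on UNIV" using \<Phi> by (simp add: A0_def)
  have quot: "\<exists>K>0. \<forall>r M. r > 0 \<longrightarrow> (\<forall>z\<in>sphere 0 (3 * r). norm (\<Phi> z) \<le> M) \<longrightarrow>
    (\<exists>q. q holomorphic_on ball 0 (2 * r) \<and> (\<forall>z\<in>ball 0 (2 * r). \<Phi> z = FF z * q z) \<and>
         (\<forall>z\<in>cball 0 r. norm (q z) \<le> K * exp (\<epsilon> * r) * M))" if \<epsilon>: "\<epsilon> > 0" for \<epsilon>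
  proof -
    obtain K where K: "K > 0" "quotient_bound 1 \<epsilon> K"
      using ex_quotient_bound[OF inj_lam \<epsilon>, of 1] by auto
    show ?thesis unfolding F_fun_eq_zprod
      by (rule exI[of _ K], intro conjI K(1) allI impI, rule K(2)[unfolded quotient_bound_def, rule_format])
         (use hol van in auto)
  qed
  \<comment> \<open>As a limit, the value at a zero of \<open>FF\<close> does not depend on a choice
    of disc; every local quotient agrees with it by continuity.\<close>
  define E where "E = (\<lambda>z. Lim (at z) (\<lambda>w. \<Phi> w / FF w))"
  have Eq: "E z = q z" if "q holomorphic_on ball 0 R" "\<forall>z\<in>ball 0 R. \<Phi> z = FF z * q z" "z \<in> ball 0 R" for q R z
  proof -
    have "(q \<longlongrightarrow> q z) (at z)"
      using that(1,3) by (metis centre_in_ball continuous_on_eq_continuous_at holomorphic_on_imp_continuous_on isCont_def open_ball)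
    moreover have "\<forall>\<^sub>F w in at z. w \<in> ball 0 R"
      using that(3) by (intro eventually_at_in_open') auto
    hence "\<forall>\<^sub>F w in at z. q w = \<Phi> w / FF w"
      using FF_eventually_nz[of z] by eventually_elim (use that(2) in auto)
    ultimately have "((\<lambda>w. \<Phi> w / FF w) \<longlongrightarrow> q z) (at z)"
      by (rule Lim_transform_eventually)
    thus ?thesis unfolding E_def by (intro tendsto_Lim) auto
  qed
  have bdM: "\<exists>M. \<forall>z\<in>sphere 0 R. norm (\<Phi> z) \<le> M" for R
  proof -
    have "compact (\<Phi> ` sphere 0 R)"
      using hol by (intro compact_continuous_image holomorphic_on_imp_continuous_on) (auto intro: holomorphic_on_subset)
    thus ?thesis using compact_imp_bounded bounded_iff by (metis imageI)
  qed
  have loc: "\<exists>q. q holomorphic_on ball 0 (2 * r) \<and> (\<forall>z\<in>ball 0 (2 * r). \<Phi> z = FF z * q z)" if "r > 0" for r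
    using quot[of 1] bdM[of "3 * r"] that by (metis zero_less_one)
  have Ehol: "E holomorphic_on UNIV"
  proof -
    have "E field_differentiable at z" for z
    proof -
      define r where "r = norm z + 1"
      have "r > 0" "norm z < 2 * r" unfolding r_def by (smt (verit) norm_ge_zero)+
      hence r: "r > 0" "z \<in> ball 0 (2 * r)" by simp_all
      obtain q where q: "q holomorphic_on ball 0 (2 * r)" "\<forall>z\<in>ball 0 (2 * r). \<Phi> z = FF z * q z"
        using loc[OF r(1)] by blast
      have "E holomorphic_on ball 0 (2 * r)"
        by (rule holomorphic_transform[OF q(1)]) (use Eq[OF q] in auto)
      thus ?thesis using r(2) by (rule holomorphic_on_imp_differentiable_at[OF _ open_ball])
    qed
    thus ?thesis by (simp add: holomorphic_on_def field_differentiable_at_within)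
  qed
  have EF: "\<Phi> u = FF u * E u" for u
  proof -
    define r where "r = norm u + 1"
    have "r > 0" "norm u < 2 * r" unfolding r_def by (smt (verit) norm_ge_zero)+
      hence r: "r > 0" "u \<in> ball 0 (2 * r)" by simp_all
    obtain q where q: "q holomorphic_on ball 0 (2 * r)" "\<forall>z\<in>ball 0 (2 * r). \<Phi> z = FF z * q z"
      using loc[OF r(1)] by blast
    show ?thesis using Eq[OF q r(2)] q(2) r(2) by simp
  qed
  have "\<exists>K. \<forall>u. norm (E u) \<le> K * exp (\<epsilon> * norm u)" if \<epsilon>: "\<epsilon> > 0" for \<epsilon>
  proof -
    have e4: "\<epsilon> / 4 > 0" using \<epsilon> by simp
    obtain K where K: "K > 0" "\<forall>r M. r > 0 \<longrightarrow> (\<forall>z\<in>sphere 0 (3 * r). norm (\<Phi> z) \<le> M) \<longrightarrow>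
      (\<exists>q. q holomorphic_on ball 0 (2 * r) \<and> (\<forall>z\<in>ball 0 (2 * r). \<Phi> z = FF z * q z) \<and>
         (\<forall>z\<in>cball 0 r. norm (q z) \<le> K * exp (\<epsilon> / 4 * r) * M))" using quot[OF e4] by blast
    obtain K' where K': "\<And>u. norm (\<Phi> u) \<le> K' * exp (\<epsilon> / 4 * norm u)" using A0_growth[OF \<Phi> e4] by blast
    have "norm (E u) \<le> (K * K' * exp \<epsilon>) * exp (\<epsilon> * norm u)" for u
    proof -
      define r where "r = norm u + 1"
      have "r > 0" "norm u < 2 * r" "norm u \<le> r" unfolding r_def by (smt (verit) norm_ge_zero)+
      hence r: "r > 0" "u \<in> ball 0 (2 * r)" "u \<in> cball 0 r" by simp_all
      have "\<forall>z\<in>sphere 0 (3 * r). norm (\<Phi> z) \<le> K' * exp (\<epsilon> / 4 * (3 * r))"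
        using K' by (metis dist_0_norm mem_sphere)
      then obtain q where q: "q holomorphic_on ball 0 (2 * r)" "\<forall>z\<in>ball 0 (2 * r). \<Phi> z = FF z * q z"
         "\<forall>z\<in>cball 0 r. norm (q z) \<le> K * exp (\<epsilon> / 4 * r) * (K' * exp (\<epsilon> / 4 * (3 * r)))"
        using K(2)[rule_format, OF r(1), of "K' * exp (\<epsilon> / 4 * (3 * r))"] by blast
      have "norm (E u) \<le> K * exp (\<epsilon> / 4 * r) * (K' * exp (\<epsilon> / 4 * (3 * r)))"
        using Eq[OF q(1,2) r(2)] q(3) r(3) by simp
      also have "\<dots> = K * K' * exp (\<epsilon> / 4 * r + \<epsilon> / 4 * (3 * r))" by (simp only: exp_add mult_ac)
      also have "\<epsilon> / 4 * r + \<epsilon> / 4 * (3 * r) = \<epsilon> + \<epsilon> * norm u" by (simp add: r_def field_simps)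
      finally show ?thesis by (simp add: exp_add mult_ac)
    qed
    thus ?thesis by blast
  qed
  hence "E \<in> A0" using Ehol by (simp add: A0_def)
  thus ?thesis using EF by blast
qed

lemma PhiD_in_A0:
  assumes d: "summable (\<lambda>j. G j * norm (d j))"
  shows "PhiD d \<in> A0"
  unfolding A0_def
proof (intro CollectI conjI allI impI PhiD(3)[OF d])
  fix \<epsilon> :: real assume "\<epsilon> > 0"
  then obtain K where K: "K > 0" "\<And>R. R \<ge> 0 \<Longrightarrow> KG R \<le> K * exp (\<epsilon> * R)" using KG_bound by blast
  define c where "c = (\<Sum>j. G j * norm (d j)) * G 1"
  have c: "c \<ge> 0" unfolding c_def
    by (intro mult_nonneg_nonneg suminf_nonneg d G_nonneg) auto
  have "norm (PhiD d u) \<le> c * K * exp (\<epsilon> * norm u)" for u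
  proof -
    have "norm (PhiD d u) \<le> c * KG (norm u)" using PhiD(2)[OF d, of u] by (simp add: c_def mult.assoc)
    also have "\<dots> \<le> c * (K * exp (\<epsilon> * norm u))" using c K(2) by (intro mult_left_mono) auto
    finally show ?thesis by (simp add: mult.assoc)
  qed
  thus "\<exists>M. \<forall>u. norm (PhiD d u) \<le> M * exp (\<epsilon> * norm u)" by blast
qed

text \<open>A solution whose transform \<open>Phi\<close> has the divisor of \<open>FF\<close> vanishes: the quotient is entire, of
  exponential type zero, and bounded off the imaginary direction by transport to the right or left.\<close>

lemma Phi_divisible_imp_eq:
  assumes f: "f \<in> V_set lam mu \<gamma> \<beta>" and g: "g \<in> V_set lam mu \<gamma> \<beta>"
    and van: "\<And>x n. x \<in> {\<gamma><..<\<beta>} \<Longrightarrow> vanishes (mu n) (\<lambda>u. Phi f u x - Phi g u x) (lam n)"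
    and x0: "x0 \<in> {\<gamma><..<\<beta>}"
  shows "f x0 = g x0"
proof -
  let ?I = "{\<gamma><..<\<beta>}"
  define D where "D = (\<lambda>x u. Phi f u x - Phi g u x)"
  have sC: "summable (\<lambda>j. G j * norm (vderivs j f x))" "summable (\<lambda>j. G j * norm (vderivs j g x))" if "x \<in> ?I" for x
    using f g that by (auto simp: V_set_def intro: class_C_summable)
  have D0: "D x \<in> A0" if x: "x \<in> ?I" for x
    unfolding A0_def
  proof (intro CollectI conjI allI impI)
    show "D x holomorphic_on UNIV" unfolding D_def by (intro holomorphic_intros PhiD(3) sC x)
    fix \<epsilon> :: real assume e: "\<epsilon> > 0"
    obtain K1 K2 where K: "\<And>u. norm (Phi f u x) \<le> K1 * exp (\<epsilon> * norm u)" "\<And>u. norm (Phi g u x) \<le> K2 * exp (\<epsilon> * norm u)"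
      using A0_growth[OF PhiD_in_A0[OF sC(1)[OF x]] e] A0_growth[OF PhiD_in_A0[OF sC(2)[OF x]] e] by blast
    have "norm (D x u) \<le> (K1 + K2) * exp (\<epsilon> * norm u)" for u
      unfolding D_def using norm_triangle_ineq4[of "Phi f u x" "Phi g u x"] K[of u] by (simp add: distrib_right)
    thus "\<exists>K. \<forall>u. norm (D x u) \<le> K * exp (\<epsilon> * norm u)" by blast
  qed
  have "\<forall>x\<in>?I. \<exists>E. E \<in> A0 \<and> (\<forall>u. D x u = FF u * E u)"
  proof
    fix x assume x: "x \<in> ?I"
    have "vanishes (mu n) (D x) (lam n)" for n unfolding D_def by (rule van[OF x])
    thus "\<exists>E. E \<in> A0 \<and> (\<forall>u. D x u = FF u * E u)" using entire_quotient[OF D0[OF x]] by blast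
  qed
  from bchoice[OF this] obtain E where E0: "\<forall>x\<in>?I. E x \<in> A0 \<and> (\<forall>u. D x u = FF u * E x u)" ..
  have E: "E x holomorphic_on UNIV" "\<And>u. D x u = FF u * E x u" "E x \<in> A0" if "x \<in> ?I" for x
    using bspec[OF E0 that] by (simp_all add: A0_def)
  \<comment> \<open>The sign \<open>s\<close> selects the half-plane: y lies right of x when Re u >
    0 and left of it when Re u < 0, so exp (u (x - t)) has modulus at most 1 for t between them.
    Division by |FF u| then leaves a constant; zeros of \<open>FF\<close> are reached by
    continuity.\<close>
  have transport: "\<exists>B. \<forall>u. s * Re u > 0 \<longrightarrow> norm (E x u - exp (u * of_real (x - y)) * E y u) \<le> B"
    if xy: "x \<in> ?I" "y \<in> ?I" and s: "s * (y - x) > 0" "\<bar>s\<bar> = 1" for x y s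
  proof -
    have cont: "continuous_on ?I (\<lambda>t. f t - g t)"
      by (intro continuous_on_diff V_set_continuous f g)
    obtain B where B: "B > 0" "\<And>t. t \<in> closed_segment x y \<Longrightarrow> norm (f t - g t) \<le> B"
      using segment_bound[OF cont xy] by blast
    let ?h = "\<lambda>u. E x u - exp (u * of_real (x - y)) * E y u"
    have off: "norm (?h u) \<le> B * \<bar>x - y\<bar>" if u: "s * Re u > 0" "FF u \<noteq> 0" for u
    proof -
      have "norm (D x u * exp (u * of_real (x - x)) - D y u * exp (u * of_real (x - y))) \<le> (norm (FF u) * B * 1) * \<bar>x - y\<bar>"
        unfolding D_def
      proof (rule Phi_difference_bound[OF f g xy B(2)])
        fix t assume t: "t \<in> closed_segment x y"
        have "Re u * (x - t) \<le> 0"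
        proof -
          have "s = 1 \<or> s = - 1" using s(2) by linarith
          thus ?thesis using s(1) u(1) t by (auto simp: closed_segment_eq_real_ivl mult_le_0_iff split: if_splits)
        qed
        thus "norm (exp (u * of_real (x - t))) \<le> 1" by simp
      qed
      also have "D x u * exp (u * of_real (x - x)) - D y u * exp (u * of_real (x - y)) = FF u * ?h u"
        using E(2)[OF xy(1), of u] E(2)[OF xy(2), of u] by (simp add: algebra_simps)
      finally have "norm (FF u) * norm (?h u) \<le> norm (FF u) * (B * \<bar>x - y\<bar>)" by (simp add: norm_mult mult_ac)
      thus ?thesis using u(2) by simp
    qed
    have "norm (?h u) \<le> B * \<bar>x - y\<bar>" if u: "s * Re u > 0" for u
    proof (rule tendsto_upperbound[of "\<lambda>w. norm (?h w)" _ "at u"])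
      have "?h holomorphic_on UNIV" using E(1) xy by (intro holomorphic_intros) auto
      hence "isCont ?h u" by (metis UNIV_I continuous_on_eq_continuous_at holomorphic_on_imp_continuous_on open_UNIV)
      thus "((\<lambda>w. norm (?h w)) \<longlongrightarrow> norm (?h u)) (at u)" by (intro tendsto_norm) (simp add: isCont_def)
      have "open {w. 0 < s * Re w}" by (intro open_Collect_less continuous_intros)
      hence "\<forall>\<^sub>F w in at u. s * Re w > 0" using eventually_at_in_open'[of "{w. 0 < s * Re w}" u] u by simp
      thus "\<forall>\<^sub>F w in at u. norm (?h w) \<le> B * \<bar>x - y\<bar>"
        using FF_eventually_nz[of u] by eventually_elim (use off in auto)
    qed auto
    thus ?thesis by blast
  qed
  have half: "\<exists>B. \<forall>u. s * Re u > 0 \<longrightarrow> \<bar>Im u\<bar> \<le> \<bar>Re u\<bar> \<longrightarrow> norm (E x u) \<le> B"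
    if xy: "x \<in> ?I" "y \<in> ?I" and s: "s * (y - x) > 0" "\<bar>s\<bar> = 1" for x y s
  proof -
    obtain B where B: "\<And>u. s * Re u > 0 \<Longrightarrow> norm (E x u - exp (u * of_real (x - y)) * E y u) \<le> B"
      using transport[OF xy s] by blast
    \<comment> \<open>Type zero of \<open>E y\<close> is used at the rate |y - x| / 2: in the sector
      |u| \<le> 2 |Re u|, so the factor of modulus exp (- |Re u| |y - x|) compensates the
      growth.\<close>
    have "\<bar>y - x\<bar> / 2 > 0" using s by auto
    then obtain K where K: "\<And>u. norm (E y u) \<le> K * exp (\<bar>y - x\<bar> / 2 * norm u)" using A0_growth[OF E(3)[OF xy(2)]] by blast
    have K0: "K \<ge> 0" using order_trans[OF norm_ge_zero K[of 0]] by simp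
    have "norm (E x u) \<le> B + K" if u: "s * Re u > 0" "\<bar>Im u\<bar> \<le> \<bar>Re u\<bar>" for u
    proof -
      have eq: "Re u * (x - y) = - (\<bar>Re u\<bar> * \<bar>y - x\<bar>)"
        using s u(1) by (cases "s = 1") (auto simp: algebra_simps abs_if mult_less_0_iff zero_less_mult_iff split: if_splits)
      have "norm u \<le> 2 * \<bar>Re u\<bar>" using cmod_le[of u] u(2) by linarith
      hence "\<bar>y - x\<bar> / 2 * norm u \<le> \<bar>y - x\<bar> / 2 * (2 * \<bar>Re u\<bar>)" by (intro mult_left_mono) auto
      hence le: "Re u * (x - y) + \<bar>y - x\<bar> / 2 * norm u \<le> 0" unfolding eq by (simp add: mult.commute)
      have "norm (exp (u * of_real (x - y)) * E y u) \<le> exp (Re u * (x - y)) * (K * exp (\<bar>y - x\<bar> / 2 * norm u))"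
        unfolding norm_mult using K[of u] by (intro mult_mono) auto
      also have "\<dots> = K * exp (Re u * (x - y) + \<bar>y - x\<bar> / 2 * norm u)" by (simp only: exp_add mult_ac)
      also have "\<dots> \<le> K * 1" using le K0 by (intro mult_left_mono) auto
      finally have "norm (exp (u * of_real (x - y)) * E y u) \<le> K" by simp
      thus ?thesis using B[OF u(1)] norm_triangle_sub[of "E x u" "exp (u * of_real (x - y)) * E y u"] by linarith
    qed
    thus ?thesis by blast
  qed
  have const: "\<exists>e. \<forall>u. E x u = e" if x: "x \<in> ?I" for x
  proof -
    have yp: "(x + \<beta>) / 2 \<in> ?I" "(x + \<gamma>) / 2 \<in> ?I" using x by auto
    obtain B1 where B1: "\<And>u. Re u > 0 \<Longrightarrow> \<bar>Im u\<bar> \<le> \<bar>Re u\<bar> \<Longrightarrow> norm (E x u) \<le> B1"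
      using half[OF x yp(1), of 1] x by (auto simp: field_simps)
    obtain B2 where B2: "\<And>u. Re u < 0 \<Longrightarrow> \<bar>Im u\<bar> \<le> \<bar>Re u\<bar> \<Longrightarrow> norm (E x u) \<le> B2"
      using half[OF x yp(2), of "-1"] x by (auto simp: field_simps)
    show ?thesis
    proof (rule subexponential_Liouville[OF E(3)[OF x]])
      fix u assume u: "\<bar>Im u\<bar> \<le> \<bar>Re u\<bar>"
      consider "Re u > 0" | "Re u < 0" | "u = 0" using u
        by (cases "Re u" "0::real" rule: linorder_cases) (auto simp: complex_eq_iff)
      thus "norm (E x u) \<le> max (norm (E x 0)) (max B1 B2)"
        by cases (use B1[of u] B2[of u] u in auto)
    qed
  qed
  define e where "e = (\<lambda>x. E x 0)"
  have De: "D x u = FF u * e x" if "x \<in> ?I" for x u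
    using const[OF that] E(2)[OF that, of u] unfolding e_def by metis
  have ode: "(e has_vector_derivative (u * e x - (f x - g x))) (at x)" if x: "x \<in> ?I" and u: "FF u \<noteq> 0" for x u
  proof -
    have "((\<lambda>x. D x u) has_vector_derivative ((u * Phi f u x - FF u * f x) - (u * Phi g u x - FF u * g x))) (at x)"
      unfolding D_def by (rule has_vector_derivative_diff[OF Phi_ODE[OF f x] Phi_ODE[OF g x]])
    hence "((\<lambda>x. D x u / FF u) has_vector_derivative ((u * Phi f u x - FF u * f x) - (u * Phi g u x - FF u * g x)) / FF u) (at x)"
      by (rule has_vector_derivative_divide)
    moreover have "((u * Phi f u x - FF u * f x) - (u * Phi g u x - FF u * g x)) / FF u = u * e x - (f x - g x)"
    proof -
      have "(u * Phi f u x - FF u * f x) - (u * Phi g u x - FF u * g x) = u * D x u - FF u * (f x - g x)"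
        by (simp add: D_def algebra_simps)
      also have "\<dots> = FF u * (u * e x - (f x - g x))" by (simp add: De[OF x] algebra_simps)
      finally show ?thesis using u by simp
    qed
    ultimately have d: "((\<lambda>x. D x u / FF u) has_vector_derivative (u * e x - (f x - g x))) (at x)" by simp
    show ?thesis
      by (rule has_vector_derivative_transform_within_open[OF d open_greaterThanLessThan x])
         (use De u in auto)
  qed
  have F0: "FF 0 \<noteq> 0" using nz by (auto simp: FF_eq_0_iff)
  have F1: "FF (- 1) \<noteq> 0"
  proof
    assume "FF (- 1) = 0"
    then obtain n where "- 1 = lam n" by (auto simp: FF_eq_0_iff)
    thus False using Re_lam_pos[of n] by (metis one_complex.sel(1) uminus_complex.sel(1) neg_0_less_iff_less not_one_less_zero)
  qed
  \<comment> \<open>At u = 0 the derivative of \<open>e\<close> is - (f - g), at u = - 1 it is - e -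
    (f - g); uniqueness of the derivative gives e = 0. The point - 1 is admissible since all zeros
    of \<open>FF\<close> lie in the right half-plane.\<close>
  have e0: "e x = 0" if "x \<in> ?I" for x
    using vector_derivative_unique_at[OF ode[OF that F0] ode[OF that F1]] by simp
  have "((\<lambda>x. 0) has_vector_derivative (0 * e x0 - (f x0 - g x0))) (at x0)"
    by (rule has_vector_derivative_transform_within_open[OF ode[OF x0 F0] open_greaterThanLessThan x0])
       (use e0 in auto)
  from vector_derivative_unique_at[OF this has_vector_derivative_const] show ?thesis by simp
qed

lemma V_subset_W:
  assumes "\<gamma> < \<beta>"
  shows "V_set lam mu \<gamma> \<beta> \<subseteq> W_set lam mu \<gamma> \<beta>"
proof
  fix f assume f: "f \<in> V_set lam mu \<gamma> \<beta>"
  let ?I = "{\<gamma><..<\<beta>}"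
  have sC: "summable (\<lambda>j. G j * norm (vderivs j f x))" if "x \<in> ?I" for x
    using f that by (auto simp: V_set_def intro: class_C_summable)
  define b where "b = (\<gamma> + \<beta>) / 2"
  have b: "b \<in> ?I" using assms by (auto simp: b_def)
  \<comment> \<open>\<Phi> transported from \<open>b\<close> to the origin, which may lie outside
    the interval: modulo \<open>FF\<close>, exp (u x) A(u) represents \<Phi>(u, x) for every x in
    the interval.\<close>
  define A where "A = (\<lambda>u. exp (u * of_real (- b)) * Phi f u b)"
  have Ahol: "A holomorphic_on UNIV" unfolding A_def by (intro holomorphic_intros PhiD(3) sC b)
  have transp: "vanishes (mu n) (\<lambda>u. Phi f u x - exp (u * of_real x) * A u) (lam n)" if x: "x \<in> ?I" for x n
  proof -
    have "exp (u * of_real (x - b)) * Phi f u b = exp (u * of_real x) * A u" for u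
    proof -
      have "exp (u * of_real (x - b)) = exp (u * of_real x) * exp (u * of_real (- b))"
        by (simp add: exp_add[symmetric] algebra_simps)
      thus ?thesis by (simp add: A_def)
    qed
    thus ?thesis using Phi_transport_vanishes[OF f x b, of n] by simp
  qed
  define c where "c = (\<lambda>n k. pref n * of_nat ((mu n - 1) choose k) *
            (deriv ^^ (mu n - 1 - k)) (\<lambda>u. exp (u * 0) * (A u / Fn n u)) (lam n))"
  have eres: "eterm c n = res n A" for n
  proof
    fix z
    have "res n A z = (\<Sum>k<mu n. c n k * ((z - 0) ^ k * exp (lam n * (z - 0))))"
      unfolding c_def by (rule res_recenter[OF Ahol])
    thus "eterm c n z = res n A z" by (simp add: eterm_def sum_distrib_left mult_ac)
  qed
  have conv: "summable (\<lambda>n. eterm c n (of_real x))" if x: "x \<in> ?I" for x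
  proof -
    \<comment> \<open>The residue at x is recomputed from \<Phi> at a point further right, which is
      legitimate because only the numerator modulo \<open>FF\<close> matters; y - x becomes the
      \<sigma> of \<open>res_decay\<close>.\<close>
    define y where "y = (x + \<beta>) / 2"
    have y: "y \<in> ?I" "y - x > 0" using x by (auto simp: y_def)
    have "res n A (of_real x) = res n (\<lambda>u. Phi f u y) (- of_real (y - x))" for n
    proof -
      define A' where "A' = (\<lambda>u. exp (u * of_real (- y)) * Phi f u y)"
      have A'hol: "A' holomorphic_on UNIV" unfolding A'_def by (intro holomorphic_intros PhiD(3) sC y)
      have "vanishes (mu n) (\<lambda>u. (Phi f u y - exp (u * of_real y) * A u) * exp (u * of_real (- y))) (lam n)"
        by (rule vanishes_mult[OF _ _ open_UNIV UNIV_I transp[OF y(1)]])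
           (intro holomorphic_intros PhiD(3) sC y Ahol)+
      moreover have "(Phi f u y - exp (u * of_real y) * A u) * exp (u * of_real (- y)) = A' u - A u" for u
      proof -
        have "exp (u * of_real y) * exp (u * of_real (- y)) = 1" by (simp add: exp_add[symmetric])
        moreover have "(Phi f u y - exp (u * of_real y) * A u) * exp (u * of_real (- y)) =
            A' u - A u * (exp (u * of_real y) * exp (u * of_real (- y)))"
          by (simp only: A'_def left_diff_distrib right_diff_distrib mult_ac)
        ultimately show ?thesis by simp
      qed
      ultimately have "vanishes (mu n) (\<lambda>u. A' u - A u) (lam n)" by simp
      hence "res n A (of_real x) = res n A' (of_real x)" using res_cong[OF A'hol Ahol] by simp
      moreover have "(\<lambda>u. exp (u * of_real x) * (A' u / Fn n u)) = (\<lambda>u. exp (u * (- of_real (y - x))) * (Phi f u y / Fn n u))"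
      proof
        fix u :: complex
        have "exp (u * (- of_real (y - x))) = exp (u * of_real x) * exp (u * of_real (- y))"
          by (simp add: exp_add[symmetric] algebra_simps)
        thus "exp (u * of_real x) * (A' u / Fn n u) = exp (u * (- of_real (y - x))) * (Phi f u y / Fn n u)"
          by (simp add: A'_def)
      qed
      hence "res n A' (of_real x) = res n (\<lambda>u. Phi f u y) (- of_real (y - x))" by (simp only: res_def)
      ultimately show ?thesis by (simp only:)
    qed
    moreover have "summable (\<lambda>n. res n (\<lambda>u. Phi f u y) (- of_real (y - x)))"
      by (rule res_decay[OF PhiD_in_A0[OF sC[OF y(1)]] y(2)])
    ultimately show ?thesis by (simp add: eres)
  qed
  define g where "g = (\<lambda>x. \<Sum>n. eterm c n (complex_of_real x))"
  have gsums: "(\<lambda>n. eterm c n (of_real x)) sums g x" if "x \<in> ?I" for x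
    using conv[OF that] by (simp add: g_def summable_sums)
  have gW: "g \<in> W_set lam mu \<gamma> \<beta>" unfolding W_set_iff using gsums by blast
  hence gV: "g \<in> V_set lam mu \<gamma> \<beta>" using W_subset_V[OF assms] by blast
  \<comment> \<open>The transform of \<open>g\<close> is a locally uniform limit in u of sums of
    transforms of its terms: on |u| \<le> R the error is a tail of \<open>m\<close> times a constant
    depending on R, so jets at \<open>lam n0\<close> pass to the limit.\<close>
  have van: "vanishes (mu n0) (\<lambda>u. Phi f u x - Phi g u x) (lam n0)" if x: "x \<in> ?I" for x n0
  proof -
    define b where "b = (x + \<beta>) / 2"
    have b: "b < \<beta>" "x < b" using x by (auto simp: b_def)
    define H where "H = (\<lambda>z. \<Sum>n. eterm c n z)"
    obtain S r m where S: "open S" "r > 0" "summable m"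
      "\<And>x'. x' \<in> {\<gamma><..<b} \<Longrightarrow> cball (complex_of_real x') r \<subseteq> S" "H holomorphic_on S"
      "\<And>n z. z \<in> S \<Longrightarrow> norm (eterm c n z) \<le> m n"
      by (rule W_local[OF assms conv b(1)]) (auto simp: H_def)
    have xb: "x \<in> {\<gamma><..<b}" using x b by auto
    have v: "vderivs j g x = (deriv ^^ j) H (of_real x)" for j
    proof (rule vderivs_holomorphic(1)[OF S(5) S(1) open_greaterThanLessThan[of \<gamma> b]])
      show "complex_of_real x' \<in> S" if "x' \<in> {\<gamma><..<b}" for x' using S(4)[OF that] S(2) by auto
    qed (use xb in \<open>auto simp: g_def H_def\<close>)
    define l where "l = (\<lambda>n u. resPhi n A (of_real x) u)"
    define C where "C = (\<Sum>j. G j * fact j / r ^ j)"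
    have m0: "m n \<ge> 0" for n
      using order_trans[OF norm_ge_zero S(6)[of "of_real x" n]] S(4)[OF xb] S(2) by (auto simp: subset_iff)
    have approx: "norm (Phi g u x - (\<Sum>n<N. l n u)) \<le> (\<Sum>n. m (n + N)) * (C * (G 1 * KG R))" if u: "norm u \<le> R" for u R N
    proof -
      have le: "norm (Psi (Suc j) u) * fact j / r ^ j \<le> G j * fact j / r ^ j * (G 1 * KG R)" for j
      proof -
        have "norm (Psi (Suc j) u) \<le> G j * (G 1 * KG R)"
          using PhiD_term[OF u, of "\<lambda>_. 1" j] by simp
        hence "norm (Psi (Suc j) u) * (fact j / r ^ j) \<le> G j * (G 1 * KG R) * (fact j / r ^ j)"
          using S(2) by (intro mult_right_mono) auto
        thus ?thesis by (simp add: mult_ac)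
      qed
      have sG: "summable (\<lambda>j. G j * fact j / r ^ j * (G 1 * KG R))"
        by (intro summable_mult2 G_fact_summable S(2))
      have sP: "summable (\<lambda>j. norm (Psi (Suc j) u) * fact j / r ^ j)"
        by (rule summable_comparison_test'[OF sG]) (use le S(2) in auto)
      have sums: "(\<lambda>j. Psi (Suc j) u * (deriv ^^ j) (eterm c n) (of_real x)) sums l n u" for n
        unfolding eres l_def by (rule resPhi_sums[OF Ahol])
      have "Phi g u x = (\<Sum>j. Psi (Suc j) u * (deriv ^^ j) (\<lambda>z. \<Sum>n. eterm c n z) (of_real x))"
        by (simp add: PhiD_def v H_def mult.commute)
      hence "norm (Phi g u x - (\<Sum>n<N. l n u)) \<le> (\<Sum>n. m (n + N)) * (\<Sum>j. norm (Psi (Suc j) u) * fact j / r ^ j)"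
        using op_eterm_limit(2)[OF S(1,2,3) S(6) S(4)[OF xb] S(5)[unfolded H_def] sP sums, where N = N] by simp
      also have "(\<Sum>j. norm (Psi (Suc j) u) * fact j / r ^ j) \<le> (\<Sum>j. G j * fact j / r ^ j * (G 1 * KG R))"
        by (rule suminf_le[OF le sP sG])
      also have "\<dots> = C * (G 1 * KG R)"
        unfolding C_def by (rule suminf_mult2[OF G_fact_summable[OF S(2)], symmetric])
      finally show ?thesis
        using suminf_nonneg[OF summable_ignore_initial_segment[OF S(3), of N]] m0 by (auto simp: mult_left_mono)
    qed
    define R where "R = norm (lam n0) + 1"
    define P where "P = (\<lambda>N u. Phi f u x - (\<Sum>n<N. l n u))"
    have Phol: "P N holomorphic_on S'" for N S'
      unfolding P_def l_def by (intro holomorphic_intros PhiD(3) sC x resPhi_holomorphic Ahol)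
    have ul: "uniform_limit (ball 0 R) P (\<lambda>u. Phi f u x - Phi g u x) sequentially"
      unfolding uniform_limit_iff
    proof (intro allI impI)
      fix e :: real assume e: "e > 0"
      have "(\<lambda>N. (\<Sum>n. m (n + N)) * (C * (G 1 * KG R))) \<longlonglongrightarrow> 0 * (C * (G 1 * KG R))"
        by (intro tendsto_intros suminf_exist_split2 S(3))
      hence "\<forall>\<^sub>F N in sequentially. (\<Sum>n. m (n + N)) * (C * (G 1 * KG R)) < e"
        using e by (intro order_tendstoD) auto
      thus "\<forall>\<^sub>F N in sequentially. \<forall>u\<in>ball 0 R. dist (P N u) (Phi f u x - Phi g u x) < e"
      proof eventually_elim
        case (elim N)
        show ?case
        proof
          fix u :: complex assume "u \<in> ball 0 R"
          hence "norm (Phi g u x - (\<Sum>n<N. l n u)) < e" using approx[of u R N] elim by auto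
          thus "dist (P N u) (Phi f u x - Phi g u x) < e" by (simp add: P_def dist_norm)
        qed
      qed
    qed
    \<comment> \<open>The term \<open>n0\<close> agrees with exp (u x) A(u) at \<open>lam n0\<close>
      to order \<open>mu n0\<close>, and the latter agrees with \<Phi> there, while all other terms
      vanish to that order.\<close>
    have vanN: "vanishes (mu n0) (P N) (lam n0)" if N: "N > n0" for N
    proof -
      have "P N = (\<lambda>u. ((Phi f u x - exp (u * of_real x) * A u) + (exp (u * of_real x) * A u - l n0 u)) -
          (\<Sum>n\<in>{..<N}-{n0}. l n u))"
        using N by (simp add: P_def fun_eq_iff sum.remove[of "{..<N}" n0])
      moreover have "vanishes (mu n0) \<dots> (lam n0)"
      proof (rule vanishes_diff[OF _ _ open_UNIV UNIV_I])
        show "vanishes (mu n0) (\<lambda>u. (Phi f u x - exp (u * of_real x) * A u) + (exp (u * of_real x) * A u - l n0 u)) (lam n0)"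
          unfolding l_def
          by (rule vanishes_add[OF _ _ open_UNIV UNIV_I transp[OF x] resPhi_vanishes_self[OF Ahol]])
             (intro holomorphic_intros PhiD(3) sC x Ahol resPhi_holomorphic)+
        show "vanishes (mu n0) (\<lambda>u. \<Sum>n\<in>{..<N}-{n0}. l n u) (lam n0)"
          unfolding vanishes_def
        proof (intro allI impI)
          fix k assume k: "k < mu n0"
          have "(deriv ^^ k) (\<lambda>u. \<Sum>n\<in>{..<N}-{n0}. l n u) (lam n0) = (\<Sum>n\<in>{..<N}-{n0}. (deriv ^^ k) (l n) (lam n0))"
            by (rule higher_deriv_sum[of _ _ UNIV]) (auto simp: l_def intro: resPhi_holomorphic[OF Ahol])
          also have "\<dots> = 0"
            using resPhi_vanishes_other[OF Ahol, of n0 _ "of_real x"] k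
            by (intro sum.neutral) (auto simp: vanishes_def l_def)
          finally show "(deriv ^^ k) (\<lambda>u. \<Sum>n\<in>{..<N}-{n0}. l n u) (lam n0) = 0" .
        qed
      qed (unfold l_def, (intro holomorphic_intros PhiD(3) sC x Ahol resPhi_holomorphic)+)
      ultimately show ?thesis by simp
    qed
    show ?thesis
      unfolding vanishes_def
    proof (intro allI impI)
      fix k assume k: "k < mu n0"
      have "(\<lambda>N. (deriv ^^ k) (P N) (lam n0)) \<longlonglongrightarrow> (deriv ^^ k) (\<lambda>u. Phi f u x - Phi g u x) (lam n0)"
        by (rule higher_deriv_complex_uniform_limit[OF ul always_eventually]) (auto simp: R_def intro: Phol)
      moreover have "\<forall>\<^sub>F N in sequentially. (deriv ^^ k) (P N) (lam n0) = 0"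
        using eventually_gt_at_top[of n0] by (rule eventually_mono) (use vanN k in \<open>auto simp: vanishes_def\<close>)
      hence "(\<lambda>N. (deriv ^^ k) (P N) (lam n0)) \<longlonglongrightarrow> 0" by (rule tendsto_eventually)
      ultimately show "(deriv ^^ k) (\<lambda>u. Phi f u x - Phi g u x) (lam n0) = 0" by (rule LIMSEQ_unique)
    qed
  qed
  have "f x = g x" if "x \<in> ?I" for x
    by (rule Phi_divisible_imp_eq[OF f gV van that])
  thus "f \<in> W_set lam mu \<gamma> \<beta>" unfolding W_set_iff using gsums by (intro exI[of _ c]) auto
qed

end

subsection \<open>Approximation in \<open>L\<^sup>p\<close>\<close>

lemma powr_add3_le:
  fixes a b c p :: real
  assumes "a \<ge> 0" "b \<ge> 0" "c \<ge> 0" "p \<ge> 0" "x \<ge> 0" "x \<le> a + b + c"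
  shows "x powr p \<le> 3 powr p * (a powr p + b powr p + c powr p)"
proof -
  define m where "m = max a (max b c)"
  have m: "m \<ge> 0" "m = a \<or> m = b \<or> m = c" using assms by (auto simp: m_def max_def)
  have "x \<le> 3 * m" using assms(6) by (auto simp: m_def)
  hence "x powr p \<le> (3 * m) powr p" using assms by (intro powr_mono2) auto
  also have "\<dots> = 3 powr p * m powr p" using m by (simp add: powr_mult)
  also have "m powr p \<le> a powr p + b powr p + c powr p" using m(2) by auto
  finally show ?thesis by simp
qed

text \<open>Dominated convergence along intervals shrinking to \<beta>. The width is written 2
  \<tau> because a later translation by less than \<tau> must keep points right of \<beta> - \<tau>
  inside the tail.\<close>

lemma set_integral_tail_small:
  fixes F :: "real \<Rightarrow> real"
  assumes int: "set_integrable lborel {\<gamma><..<\<beta>} F" and "\<gamma> < \<beta>" "s > 0"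
  obtains \<tau> where "\<tau> > 0" "\<gamma> < \<beta> - 2 * \<tau>" "(LINT x:{\<beta> - 2 * \<tau><..<\<beta>}|lborel. F x) < s"
proof -
  define u where "u = (\<lambda>k x. indicator {max \<gamma> (\<beta> - 1 / real (Suc k))<..<\<beta>} x *\<^sub>R F x)"
  have eq: "u k x = indicator {\<beta> - 1 / real (Suc k)<..<\<beta>} x *\<^sub>R (indicator {\<gamma><..<\<beta>} x *\<^sub>R F x)" for k x
    by (auto simp: u_def indicator_def)
  have meas: "u k \<in> borel_measurable lborel" for k
  proof -
    have m: "(\<lambda>x. indicator {\<gamma><..<\<beta>} x *\<^sub>R F x) \<in> borel_measurable lborel"
      using int unfolding set_integrable_def by (rule borel_measurable_integrable)
    have "(\<lambda>x. indicator {\<beta> - 1 / real (Suc k)<..<\<beta>} x *\<^sub>R (indicator {\<gamma><..<\<beta>} x *\<^sub>R F x)) \<in> borel_measurable lborel"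
      by (rule borel_measurable_scaleR[OF borel_measurable_indicator m]) simp
    moreover have "u k = (\<lambda>x. indicator {\<beta> - 1 / real (Suc k)<..<\<beta>} x *\<^sub>R (indicator {\<gamma><..<\<beta>} x *\<^sub>R F x))"
      using eq by blast
    ultimately show ?thesis by simp
  qed
  have "(\<lambda>k. integral\<^sup>L lborel (u k)) \<longlonglongrightarrow> integral\<^sup>L lborel (\<lambda>x::real. 0::real)"
  proof (rule integral_dominated_convergence)
    show "integrable lborel (\<lambda>x. norm (indicator {\<gamma><..<\<beta>} x *\<^sub>R F x))"
      using int unfolding set_integrable_def by (rule integrable_norm)
    show "AE x in lborel. (\<lambda>k. u k x) \<longlonglongrightarrow> 0"
    proof (rule AE_I2)
      fix x :: real
      show "(\<lambda>k. u k x) \<longlonglongrightarrow> 0"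
      proof (cases "x < \<beta>")
        case True
        have "(\<lambda>k. 1 / real (Suc k)) \<longlonglongrightarrow> 0" using LIMSEQ_inverse_real_of_nat by (simp add: inverse_eq_divide)
        hence "\<forall>\<^sub>F k in sequentially. 1 / real (Suc k) < \<beta> - x" using True by (intro order_tendstoD) auto
        hence "\<forall>\<^sub>F k in sequentially. u k x = 0" by eventually_elim (auto simp: u_def indicator_def)
        thus ?thesis by (rule tendsto_eventually)
      qed (simp add: u_def)
    qed
    show "AE x in lborel. norm (u k x) \<le> norm (indicator {\<gamma><..<\<beta>} x *\<^sub>R F x)" for k
      by (auto simp: u_def indicator_def)
  qed (use meas in auto)
  hence "\<forall>\<^sub>F k in sequentially. integral\<^sup>L lborel (u k) < s" using assms by (intro order_tendstoD) auto
  moreover have "\<forall>\<^sub>F k in sequentially. 1 / real (Suc k) < \<beta> - \<gamma>"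
    using LIMSEQ_inverse_real_of_nat assms by (intro order_tendstoD) (auto simp: inverse_eq_divide)
  ultimately have "\<forall>\<^sub>F k in sequentially. integral\<^sup>L lborel (u k) < s \<and> 1 / real (Suc k) < \<beta> - \<gamma>"
    by (rule eventually_conj)
  then obtain k where k: "integral\<^sup>L lborel (u k) < s" "1 / real (Suc k) < \<beta> - \<gamma>"
    by (auto simp: eventually_sequentially)
  have half: "2 * (1 / real (Suc k) / 2) = 1 / real (Suc k)" by (simp add: field_simps)
  show thesis
  proof (rule that[of "1 / real (Suc k) / 2"])
    show "(LINT x:{\<beta> - 2 * (1 / real (Suc k) / 2)<..<\<beta>}|lborel. F x) < s"
      using k unfolding half by (simp add: set_lebesgue_integral_def u_def max_def)
    show "\<gamma> < \<beta> - 2 * (1 / real (Suc k) / 2)" using k(2) unfolding half by linarith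
  qed simp
qed

context sector_seq
begin

text \<open>Re-expanding a translated polynomial keeps its degree, and exp (- lam n \<delta>) is
  absorbed into the coefficients.\<close>

lemma eterm_shift_in_span: "(\<lambda>x. \<Sum>n<N. eterm c n (complex_of_real (x - \<delta>))) \<in> span_E lam mu"
proof -
  have "\<exists>p. \<forall>z. (\<Sum>k<mu n. c n k * (z - of_real \<delta>) ^ k) = (\<Sum>k<mu n. p k * z ^ k)" for n
  proof -
    obtain p where "\<forall>z. (\<Sum>k<mu n. c n k * z ^ k) = (\<Sum>k<mu n. p k * (z - (- of_real \<delta>)) ^ k)"
      using poly_recenter[where c = "c n" and m = "mu n" and x = "- of_real \<delta>"] by blast
    hence "(\<Sum>k<mu n. c n k * (z - of_real \<delta>) ^ k) = (\<Sum>k<mu n. p k * z ^ k)" for z by simp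
    thus ?thesis by blast
  qed
  then obtain p where p: "\<And>n z. (\<Sum>k<mu n. c n k * (z - of_real \<delta>) ^ k) = (\<Sum>k<mu n. p n k * z ^ k)" by metis
  have "eterm c n (of_real (x - \<delta>)) =
      (\<Sum>k<mu n. (p n k * exp (- lam n * of_real \<delta>)) * of_real x ^ k * exp (lam n * of_real x))" for n x
  proof -
    have "exp (lam n * of_real (x - \<delta>)) = exp (- lam n * of_real \<delta>) * exp (lam n * of_real x)"
      by (simp add: exp_add[symmetric] algebra_simps)
    hence "eterm c n (of_real (x - \<delta>)) =
        (\<Sum>k<mu n. p n k * of_real x ^ k) * (exp (- lam n * of_real \<delta>) * exp (lam n * of_real x))"
      unfolding eterm_def using p[of n "of_real x"] by simp
    thus ?thesis by (simp add: sum_distrib_left sum_distrib_right mult_ac)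
  qed
  thus ?thesis unfolding span_E_def
    by (intro CollectI exI[of _ N] exI[of _ "\<lambda>n k. p n k * exp (- lam n * of_real \<delta>)"]) auto
qed

text \<open>Near \<beta> the function may be unbounded and its partial sums uncontrolled. With
  \<open>H\<close> the sum of the series, x \<mapsto> H (x - \<delta>) is a uniformly convergent
  series on the whole interval. It is close to \<open>f\<close> by uniform continuity away from
  \<beta>, and by the small mass of |f| powr p near \<beta>.\<close>

lemma W_Lp_closed_span:
  assumes ab: "\<gamma> < \<beta>" and f: "f \<in> W_set lam mu \<gamma> \<beta>" and p: "p \<ge> 1" and Lp: "in_Lp p \<gamma> \<beta> f"
  shows "in_closed_span_Lp lam mu p \<gamma> \<beta> f"
  unfolding in_closed_span_Lp_def
proof (intro allI impI)
  fix \<epsilon> :: real assume \<epsilon>: "\<epsilon> > 0"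
  obtain c where c: "\<And>x. x \<in> {\<gamma><..<\<beta>} \<Longrightarrow> (\<lambda>n. eterm c n (of_real x)) sums f x"
    using f unfolding W_set_iff by blast
  \<comment> \<open>Convergence propagates to all points left of \<beta>; this matters because x -
    \<delta> may fall below \<gamma>.\<close>
  have conv: "summable (\<lambda>n. eterm c n (of_real x))" if xb: "x < \<beta>" for x
  proof -
    have conv0: "summable (\<lambda>n. eterm c n (of_real x))" if "x \<in> {\<gamma><..<\<beta>}" for x
      using c[OF that] by (rule sums_summable)
    obtain \<tau> where \<tau>: "\<tau> > 0" "\<And>R. \<exists>m. summable m \<and>
      (\<forall>n z. Re z \<le> x \<longrightarrow> \<bar>Im z\<bar> \<le> \<tau> \<longrightarrow> norm z \<le> R \<longrightarrow> norm (eterm c n z) \<le> m n)"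
      using eterm_bound[OF ab conv0 xb] by metis
    from \<tau>(2)[of "\<bar>x\<bar>"] obtain m where m: "summable m"
      "\<And>n z. Re z \<le> x \<Longrightarrow> \<bar>Im z\<bar> \<le> \<tau> \<Longrightarrow> norm z \<le> \<bar>x\<bar> \<Longrightarrow> norm (eterm c n z) \<le> m n" by blast
    show ?thesis
      by (rule summable_comparison_test'[OF m(1)]) (use m(2)[of "of_real x"] \<tau>(1) in auto)
  qed
  define H where "H = (\<lambda>z. \<Sum>n. eterm c n z)"
  have fH: "f x = H (of_real x)" if "x \<in> {\<gamma><..<\<beta>}" for x
    using c[OF that] by (simp add: H_def sums_iff)
  have loc: "\<exists>S. H holomorphic_on S \<and> (\<forall>x\<in>{\<gamma>-2<..<b}. complex_of_real x \<in> S) \<and>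
      uniform_limit S (\<lambda>N z. \<Sum>n<N. eterm c n z) H sequentially" if b: "b < \<beta>" for b
  proof -
    obtain S r m where S: "open S" "r > 0" "summable m"
      "\<And>n z. z \<in> S \<Longrightarrow> norm (eterm c n z) \<le> m n"
      "\<And>x. x \<in> {\<gamma>-2<..<b} \<Longrightarrow> cball (complex_of_real x) r \<subseteq> S" "H holomorphic_on S"
      "uniform_limit S (\<lambda>N z. \<Sum>n<N. eterm c n z) H sequentially"
      unfolding H_def by (rule W_local[of "\<gamma>-2" \<beta> c b]) (use ab conv b in auto)
    thus ?thesis by (intro exI[of _ S]) (auto simp: subset_iff)
  qed
  define q where "q = 3 powr p"
  have q: "q > 0" by (simp add: q_def)
  \<comment> \<open>\<open>q\<close> is the constant of the three-term inequality. Each of the three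
    parts of the majorant integrates to at most \<open>s\<close>, and 3 q s is half of \<epsilon>
    powr p.\<close>
  define s where "s = \<epsilon> powr p / (6 * q)"
  have s: "s > 0" using \<epsilon> q by (simp add: s_def)
  define \<eta> where "\<eta> = (s / (\<beta> - \<gamma>)) powr (1 / p)"
  have \<eta>: "\<eta> > 0" "\<eta> powr p * (\<beta> - \<gamma>) = s" using s ab p by (auto simp: \<eta>_def powr_powr)
  define F where "F = (\<lambda>x. norm (f x) powr p)"
  have intF: "set_integrable lborel {\<gamma><..<\<beta>} F" using Lp by (simp add: in_Lp_def F_def)
  obtain \<tau> where \<tau>: "\<tau> > 0" "\<gamma> < \<beta> - 2 * \<tau>" "(LINT x:{\<beta> - 2 * \<tau><..<\<beta>}|lborel. F x) < s"
    using set_integral_tail_small[OF intF ab s] by blast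
  define u where "u = (\<lambda>x. indicator {\<beta> - 2 * \<tau><..<\<beta>} x *\<^sub>R F x)"
  have sub: "{\<beta> - 2 * \<tau><..<\<beta>} \<subseteq> {\<gamma><..<\<beta>}" using \<tau> by auto
  have intu: "integrable lborel u"
    using set_integrable_subset[OF intF _ sub] by (simp add: u_def set_integrable_def)
  have us: "integral\<^sup>L lborel u < s" using \<tau>(3) by (simp add: set_lebesgue_integral_def u_def)
  have u0: "u x \<ge> 0" for x by (simp add: u_def F_def)
  obtain d where d: "d > 0" "\<And>x y. x \<in> {\<gamma>-1..\<beta>-\<tau>} \<Longrightarrow> y \<in> {\<gamma>-1..\<beta>-\<tau>} \<Longrightarrow> dist y x < d \<Longrightarrow>
      dist (H (of_real y)) (H (of_real x)) < \<eta>"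
  proof -
    obtain S where S: "H holomorphic_on S" "\<forall>x\<in>{\<gamma>-2<..<\<beta>-\<tau>/2}. complex_of_real x \<in> S"
      using loc[of "\<beta>-\<tau>/2"] \<tau> by auto
    have "continuous_on (complex_of_real ` {\<gamma>-1..\<beta>-\<tau>}) H"
      by (rule continuous_on_subset[OF holomorphic_on_imp_continuous_on[OF S(1)]]) (use S(2) \<tau> in auto)
    hence "continuous_on {\<gamma>-1..\<beta>-\<tau>} (\<lambda>x. H (of_real x))"
      by (intro continuous_on_compose2[of _ H _ complex_of_real] continuous_intros) auto
    hence "uniformly_continuous_on {\<gamma>-1..\<beta>-\<tau>} (\<lambda>x. H (of_real x))"
      by (intro compact_uniformly_continuous) auto
    thus thesis using that \<eta>(1) unfolding uniformly_continuous_on_def by metis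
  qed
  define \<delta> where "\<delta> = min (d / 2) (min (\<tau> / 2) 1)"
  have \<delta>: "\<delta> > 0" "\<delta> < d" "\<delta> < \<tau>" "\<delta> \<le> 1" using d(1) \<tau>(1) by (auto simp: \<delta>_def min_def)
  obtain S where S: "\<forall>x\<in>{\<gamma>-2<..<\<beta>-\<delta>/2}. complex_of_real x \<in> S"
    "uniform_limit S (\<lambda>N z. \<Sum>n<N. eterm c n z) H sequentially"
    using loc[of "\<beta>-\<delta>/2"] \<delta> by auto
  have "\<forall>\<^sub>F N in sequentially. \<forall>z\<in>S. dist (\<Sum>n<N. eterm c n z) (H z) < \<eta>"
    using S(2) \<eta>(1) by (simp add: uniform_limit_iff)
  then obtain N where N: "\<And>z. z \<in> S \<Longrightarrow> dist (\<Sum>n<N. eterm c n z) (H z) < \<eta>"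
    by (auto simp: eventually_sequentially)
  define g where "g = (\<lambda>x. \<Sum>n<N. eterm c n (complex_of_real (x - \<delta>)))"
  have gH: "norm (H (of_real (x - \<delta>)) - g x) \<le> \<eta>" if "x \<in> {\<gamma><..<\<beta>}" for x
  proof -
    have "x - \<delta> \<in> {\<gamma>-2<..<\<beta>-\<delta>/2}" using that \<delta> by auto
    hence "dist (g x) (H (of_real (x - \<delta>))) < \<eta>" using N S(1) unfolding g_def by blast
    thus ?thesis by (simp add: dist_norm norm_minus_commute)
  qed
  define h where "h = (\<lambda>x. q * (\<eta> powr p * indicator {\<gamma><..<\<beta>} x + u x + u (x - \<delta>)))"
  have pw: "norm (f x - g x) powr p \<le> h x" if x: "x \<in> {\<gamma><..<\<beta>}" for x
  \<comment> \<open>Left of \<beta> - \<tau> uniform continuity compares \<open>f\<close> with its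
    translate; to the right both x and x - \<delta> lie in the tail, and the two functions are
    estimated separately.\<close>
  proof (cases "x < \<beta> - \<tau>")
    case True
    have "dist (H (of_real x)) (H (of_real (x - \<delta>))) < \<eta>"
      by (rule d(2)) (use True x \<delta> in \<open>auto simp: dist_real_def\<close>)
    hence "norm (f x - H (of_real (x - \<delta>))) \<le> \<eta>" using fH[OF x] by (simp add: dist_norm)
    hence "norm (f x - g x) \<le> \<eta> + \<eta>"
      using gH[OF x] norm_triangle_ineq[of "f x - H (of_real (x - \<delta>))" "H (of_real (x - \<delta>)) - g x"] by simp
    hence "norm (f x - g x) \<le> 3 * \<eta>" using \<eta>(1) by linarith
    hence "norm (f x - g x) powr p \<le> (3 * \<eta>) powr p" using p by (intro powr_mono2) auto
    also have "\<dots> = q * \<eta> powr p" using \<eta>(1) by (simp add: powr_mult q_def)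
    also have "\<dots> \<le> h x" unfolding h_def using x q u0[of x] u0[of "x - \<delta>"] by (intro mult_left_mono) auto
    finally show ?thesis .
  next
    case False
    have x': "x - \<delta> \<in> {\<gamma><..<\<beta>}" "x - \<delta> \<in> {\<beta> - 2 * \<tau><..<\<beta>}" "x \<in> {\<beta> - 2 * \<tau><..<\<beta>}"
      using False x \<delta> \<tau> by auto
    have "norm (f x - g x) \<le> norm (f x) + norm (g x)" by (rule norm_triangle_ineq4)
    also have "norm (g x) \<le> norm (f (x - \<delta>)) + \<eta>"
      using gH[OF x] fH[OF x'(1)] norm_triangle_ineq2[of "g x" "H (of_real (x - \<delta>))"]
      by (simp add: norm_minus_commute)
    finally have "norm (f x - g x) \<le> \<eta> + norm (f x) + norm (f (x - \<delta>))" by simp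
    hence "norm (f x - g x) powr p \<le> 3 powr p * (\<eta> powr p + norm (f x) powr p + norm (f (x - \<delta>)) powr p)"
      using \<eta>(1) p by (intro powr_add3_le) auto
    also have "\<dots> = h x" using x x' by (simp add: h_def q_def u_def F_def)
    finally show ?thesis .
  qed
  have intu': "integrable lborel (\<lambda>x. u (x - \<delta>))"
    using lborel_integrable_real_affine[OF intu, of 1 "- \<delta>"] by simp
  have eqI: "integral\<^sup>L lborel (\<lambda>x. u (x - \<delta>)) = integral\<^sup>L lborel u"
    using lborel_integral_real_affine[of 1 u "- \<delta>"] by simp
  have ind: "integrable lborel (\<lambda>x. \<eta> powr p * indicator {\<gamma><..<\<beta>} x)"
    using ab by (intro integrable_mult_right integrable_real_indicator) auto
  have inth: "integrable lborel h"
    unfolding h_def by (intro integrable_mult_right Bochner_Integration.integrable_add ind intu intu')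
  have "(LINT x:{\<gamma><..<\<beta>}|lborel. norm (f x - g x) powr p) \<le> integral\<^sup>L lborel h"
    unfolding set_lebesgue_integral_def
  proof (rule integral_mono'[OF inth])
    have h0: "h x \<ge> 0" for x unfolding h_def using q u0 by (intro mult_nonneg_nonneg add_nonneg_nonneg) auto
    show "indicator {\<gamma><..<\<beta>} x *\<^sub>R (norm (f x - g x) powr p) \<le> h x" for x
      using pw[of x] h0[of x] by (auto simp: indicator_def)
    show "0 \<le> h x" for x by (rule h0)
  qed
  also have "integral\<^sup>L lborel h = q * (\<eta> powr p * (\<beta> - \<gamma>) + integral\<^sup>L lborel u + integral\<^sup>L lborel u)"
    unfolding h_def using ind intu intu' ab by (simp add: eqI)
  also have "\<dots> < q * (s + s + s)" using us q \<eta>(2) by simp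
  also have "\<dots> \<le> \<epsilon> powr p" using q by (simp add: s_def)
  finally have "(LINT x:{\<gamma><..<\<beta>}|lborel. norm (f x - g x) powr p) < \<epsilon> powr p" .
  moreover have "(LINT x:{\<gamma><..<\<beta>}|lborel. norm (f x - g x) powr p) \<ge> 0"
    unfolding set_lebesgue_integral_def by (rule integral_nonneg_AE) auto
  ultimately have "(LINT x:{\<gamma><..<\<beta>}|lborel. norm (f x - g x) powr p) powr (1 / p) < (\<epsilon> powr p) powr (1 / p)"
    using p by (intro powr_less_mono2) auto
  also have "\<dots> = \<epsilon>" using \<epsilon> p by (simp add: powr_powr)
  finally show "\<exists>g\<in>span_E lam mu. (LINT x:{\<gamma><..<\<beta>}|lborel. norm (f x - g x) powr p) powr (1 / p) < \<epsilon>"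
    using eterm_shift_in_span[where N = N and c = c and \<delta> = \<delta>] unfolding g_def by (rule bexI)
qed

end

section \<open>From the class \<open>ABCD\<close> to the locale\<close>

text \<open>With \<theta> the supremum of the |Arg (lam n)|, Re (lam n) = |lam n| cos (Arg (lam n))
  is at least |lam n| cos \<theta>, and cos \<theta> > 0 because \<theta> < pi / 2.\<close>

lemma ABCD_imp_interp_seq:
  assumes "ABCD lam mu"
  shows "\<exists>\<kappa>. interp_seq lam mu \<kappa>"
proof -
  have ms: "inj lam" "\<And>n. lam n \<noteq> 0" "\<And>n. mu n \<ge> 1"
    and A: "summable (\<lambda>n. real (mu n) / norm (lam n))"
    and B: "(SUP n. \<bar>Arg (lam n)\<bar>) < pi / 2" and C: "interpolating_variety_A0 lam mu"
    using assms by (auto simp: ABCD_def multiplicity_seq_def)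
  define \<theta> where "\<theta> = (SUP n. \<bar>Arg (lam n)\<bar>)"
  have bdd: "bdd_above (range (\<lambda>n. \<bar>Arg (lam n)\<bar>))"
  proof (rule bdd_aboveI2)
    show "\<bar>Arg (lam n)\<bar> \<le> pi" for n using Arg_bounded[of "lam n"] by linarith
  qed
  have le: "\<bar>Arg (lam n)\<bar> \<le> \<theta>" for n unfolding \<theta>_def by (rule cSUP_upper[OF UNIV_I bdd])
  have \<theta>: "0 \<le> \<theta>" "\<theta> < pi / 2" using order_trans[OF abs_ge_zero le[of 0]] B by (auto simp: \<theta>_def)
  have cos: "cos \<theta> > 0" using \<theta> by (intro cos_gt_zero_pi) auto
  have "norm (lam n) \<le> 1 / cos \<theta> * Re (lam n)" for n
  proof -
    have "Re (lam n) = norm (lam n) * cos (Arg (lam n))"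
      using arg_cong[OF Arg_eq[OF ms(2)[of n]], of Re] by (simp add: Re_exp)
    moreover have "cos \<theta> \<le> cos \<bar>Arg (lam n)\<bar>"
      using le[of n] \<theta> by (intro cos_monotone_0_pi_le) auto
    hence "cos \<theta> \<le> cos (Arg (lam n))" by simp
    ultimately have "norm (lam n) * cos \<theta> \<le> Re (lam n)" by (simp add: mult_left_mono)
    thus ?thesis using cos by (simp add: field_simps)
  qed
  hence "interp_seq lam mu (1 / cos \<theta>)"
    using ms A C cos by unfold_locales (auto simp: Suc_le_eq)
  thus ?thesis ..
qed

theorem theorem10p2:
  fixes lam :: "nat \<Rightarrow> complex" and mu :: "nat \<Rightarrow> nat" and \<gamma> \<beta> :: real
  assumes "ABCD lam mu" and "\<gamma> < \<beta>"
  shows "V_set lam mu \<gamma> \<beta> = W_set lam mu \<gamma> \<beta> \<and>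
         (\<forall>f p. f \<in> W_set lam mu \<gamma> \<beta> \<longrightarrow> p \<ge> 1 \<longrightarrow> in_Lp p \<gamma> \<beta> f
           \<longrightarrow> in_closed_span_Lp lam mu p \<gamma> \<beta> f)"
proof -
  obtain \<kappa> where "interp_seq lam mu \<kappa>" using ABCD_imp_interp_seq[OF assms(1)] ..
  then interpret interp_seq lam mu \<kappa> .
  show ?thesis
    using V_subset_W[OF assms(2)] W_subset_V[OF assms(2)] W_Lp_closed_span[OF assms(2)] by blast
qed

end
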